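(* Let $(\Omega,\mu)$ be a non-atomic standard probability space. Then there exists a closed topological subgroup $G\le\mathrm{Aut}(\Omega,\mu)$ (with respect to the weak topology) such that $G$ is non-amenable and the natural near-action of $G$ on $(\Omega,\mu)$ is whirly.
   Context: For a probability space $(\Omega,\mu)$, $\mathrm{Aut}(\Omega,\mu)$ is the group of all $\mu$-equivalence classes of $\mu$-preserving automorphisms of the measurable space $\Omega$. Let $\mathcal{B}_\mu$ be the quotient of the $\sigma$-algebra of measurable subsets of $\Omega$ modulo the $\sigma$-ideal of $\mu$-null sets, with metric $d_\mu(A,B)=\mu(A\triangle B)$. The weak topology on $\mathrm{Aut}(\Omega,\mu)$ is the initial topology generated by the maps $\mathrm{Aut}(\Omega,\mu)\to\mathcal{B}_\mu$, $T\mapsto T(A)$, for $A\in\mathcal{B}_\mu$; it is a group topology. A near-action of a group $G$ on $(\Omega,\mu)$ is a homomorphism $G\to\mathrm{Aut}(\Omega,\mu)$; for a subgroup $G\le\mathrm{Aut}(\Omega,\mu)$ the natural near-action is the inclusion. A weakly continuous near-action of a Polish group $G$ on a standard probability space $(\Omega,\mu)$ is whirly if, for any two measurable $A,B\subseteq\Omega$ with $\mu(A)\mu(B)>0$, the set $\{g\in G\mid \mu(A\cap gB)>0\}$ has non-empty intersection with every neighborhood of the neutral element in $G$. A topological group is amenable if every continuous action of it on a non-void compact Hausdorff space admits an invariant regular Borel probability measure. *)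

theory Defs
  imports "HOL-Probability.Probability" "HOL-Algebra.Group_Action"
begin

section \<open>Standard probability spaces\<close>

definition polish_topology :: "'a topology \<Rightarrow> bool" where
  "polish_topology X \<longleftrightarrow> completely_metrizable_space X \<and>
     (\<exists>D. countable D \<and> D \<subseteq> topspace X \<and> X closure_of D = topspace X)"

definition borel_of :: "'a topology \<Rightarrow> 'a measure" where
  "borel_of X = sigma (topspace X) {U. openin X U}"

text \<open>The topology \<open>X\<close> is only required to exist; the \<open>\<sigma>\<close>-algebra of \<open>M\<close> is the Borel one, not
  its completion.\<close>

definition standard_prob_space :: "'a measure \<Rightarrow> bool" where
  "standard_prob_space M \<longleftrightarrow>
     prob_space M \<and> (\<exists>X. polish_topology X \<and> sets M = sets (borel_of X))"

definition atom_of :: "'a measure \<Rightarrow> 'a set \<Rightarrow> bool" where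
  "atom_of M A \<longleftrightarrow> A \<in> sets M \<and> emeasure M A > 0 \<and>
     (\<forall>B\<in>sets M. B \<subseteq> A \<longrightarrow> emeasure M B = 0 \<or> emeasure M B = emeasure M A)"

definition nonatomic :: "'a measure \<Rightarrow> bool" where
  "nonatomic M \<longleftrightarrow> (\<nexists>A. atom_of M A)"


section \<open>The group of measure-preserving automorphisms\<close>

text \<open>Automorphisms are functions on the whole type; their values outside \<open>space M\<close> are
  irrelevant, since \<open>aut_rel\<close> only looks at points of \<open>space M\<close>.\<close>

definition mp_auts :: "'a measure \<Rightarrow> ('a \<Rightarrow> 'a) set" where
  "mp_auts M = {f. bij_betw f (space M) (space M) \<and> f \<in> measurable M M \<and>
     inv_into (space M) f \<in> measurable M M \<and> distr M M f = M}"

definition aut_rel :: "'a measure \<Rightarrow> (('a \<Rightarrow> 'a) \<times> ('a \<Rightarrow> 'a)) set" where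
  "aut_rel M = {(f, g). f \<in> mp_auts M \<and> g \<in> mp_auts M \<and> (AE x in M. f x = g x)}"

definition Aut :: "'a measure \<Rightarrow> ('a \<Rightarrow> 'a) set monoid" where
  "Aut M = \<lparr>carrier = mp_auts M // aut_rel M,
            mult = (\<lambda>S T. \<Union>f\<in>S. \<Union>g\<in>T. aut_rel M `` {f \<circ> g}),
            one = aut_rel M `` {id}\<rparr>"


lemma equiv_aut_rel: "equiv (mp_auts M) (aut_rel M)"
proof (rule equivI)
  show "trans (aut_rel M)"
    unfolding trans_def aut_rel_def by (auto elim!: eventually_elim2)
  show "sym (aut_rel M)"
    unfolding sym_def aut_rel_def by (auto simp: eq_commute)
qed (auto simp: refl_on_def aut_rel_def)

lemma mp_auts_comp:
  assumes "f \<in> mp_auts M" "g \<in> mp_auts M"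
  shows "f \<circ> g \<in> mp_auts M"
proof -
  have b: "bij_betw f (space M) (space M)" "bij_betw g (space M) (space M)"
    and m: "f \<in> measurable M M" "g \<in> measurable M M"
    and i: "inv_into (space M) f \<in> measurable M M" "inv_into (space M) g \<in> measurable M M"
    and d: "distr M M f = M" "distr M M g = M"
    using assms by (auto simp: mp_auts_def)
  have bc: "bij_betw (f \<circ> g) (space M) (space M)" using b(2,1) by (rule bij_betw_trans)
  have "inv_into (space M) (f \<circ> g) x = (inv_into (space M) g \<circ> inv_into (space M) f) x"
    if "x \<in> space M" for x
  proof -
    let ?y = "inv_into (space M) g (inv_into (space M) f x)"
    have 1: "inv_into (space M) f x \<in> space M" using b(1) that
      by (metis bij_betw_def inv_into_into)
    then have 2: "?y \<in> space M" using b(2) by (metis bij_betw_def inv_into_into)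
    have "(f \<circ> g) ?y = x" using b 1 that
      by (simp add: bij_betw_inv_into_right)
    then show ?thesis using bij_betw_inv_into_left[OF bc 2] by simp
  qed
  then have "inv_into (space M) (f \<circ> g) \<in> measurable M M"
    using measurable_comp[OF i(1) i(2)] by (simp cong: measurable_cong)
  moreover have "distr M M (f \<circ> g) = M"
    using distr_distr[OF m] d by simp
  ultimately show ?thesis using bc measurable_comp[OF m(2,1)] by (simp add: mp_auts_def)
qed

lemma mp_auts_inv:
  assumes "f \<in> mp_auts M"
  shows "inv_into (space M) f \<in> mp_auts M"
proof -
  let ?i = "inv_into (space M) f"
  have b: "bij_betw f (space M) (space M)" and m: "f \<in> measurable M M"
    and i: "?i \<in> measurable M M" and d: "distr M M f = M"
    using assms by (auto simp: mp_auts_def)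
  have bi: "bij_betw ?i (space M) (space M)" using b by (rule bij_betw_inv_into)
  have "inv_into (space M) ?i x = f x" if "x \<in> space M" for x
    using b bi that by (simp add: inv_into_inv_into_eq)
  then have "inv_into (space M) ?i \<in> measurable M M" using m by (simp cong: measurable_cong)
  moreover have "distr M M ?i = M"
  proof -
    have "distr M M ?i = distr (distr M M f) M ?i" using d by simp
    also have "\<dots> = distr M M (?i \<circ> f)" using i m by (rule distr_distr)
    also have "\<dots> = distr M M (\<lambda>x. x)"
      using b by (intro distr_cong) (auto simp: bij_betw_inv_into_left)
    finally show ?thesis by simp
  qed
  ultimately show ?thesis using bi i by (simp add: mp_auts_def)
qed

lemma mp_auts_id: "id \<in> mp_auts M"
proof -
  have "inv_into (space M) id \<in> measurable M M \<longleftrightarrow> id \<in> measurable M M"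
    by (rule measurable_cong) (metis bij_betw_id bij_betw_inv_into_left id_apply)
  moreover have "distr M M id = M" by (simp add: id_def)
  ultimately show ?thesis by (simp add: mp_auts_def)
qed

lemma mp_auts_AE:
  assumes "f \<in> mp_auts M" "AE x in M. P x"
  shows "AE x in M. P (f x)"
proof -
  have f: "f \<in> measurable M M" "distr M M f = M" using assms(1) by (auto simp: mp_auts_def)
  have "AE x in distr M M f. P x" unfolding f(2) by (rule assms(2))
  with f(1) show ?thesis by (rule AE_distrD)
qed

lemma aut_rel_comp:
  assumes "(f, f') \<in> aut_rel M" "(g, g') \<in> aut_rel M"
  shows "(f \<circ> g, f' \<circ> g') \<in> aut_rel M"
proof -
  have "AE x in M. f (g x) = f' (g x)" "AE x in M. g x = g' x"
    using assms mp_auts_AE[of g M "\<lambda>x. f x = f' x"] by (auto simp: aut_rel_def)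
  then have "AE x in M. f (g x) = f' (g' x)" by eventually_elim simp
  then show ?thesis using assms by (auto simp: aut_rel_def mp_auts_comp)
qed

lemma Aut_mult_class:
  assumes "f \<in> mp_auts M" "g \<in> mp_auts M"
  shows "(aut_rel M `` {f}) \<otimes>\<^bsub>Aut M\<^esub> (aut_rel M `` {g}) = aut_rel M `` {f \<circ> g}"
proof -
  have "(\<lambda>f g. aut_rel M `` {f \<circ> g}) respects2 (aut_rel M)"
    by (rule congruent2I') (meson aut_rel_comp equiv_aut_rel equiv_class_eq)
  then show ?thesis
    using UN_equiv_class2[OF equiv_aut_rel equiv_aut_rel _ assms] by (simp add: Aut_def)
qed

lemma group_Aut: "group (Aut M)"
proof (rule groupI)
  note q = quotientI[of _ "mp_auts M" "aut_rel M"]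
  have one: "\<one>\<^bsub>Aut M\<^esub> = aut_rel M `` {id}" and c: "carrier (Aut M) = mp_auts M // aut_rel M"
    by (simp_all add: Aut_def)
  show "\<one>\<^bsub>Aut M\<^esub> \<in> carrier (Aut M)" unfolding one c by (rule q[OF mp_auts_id])
  show "x \<otimes>\<^bsub>Aut M\<^esub> y \<in> carrier (Aut M)" if "x \<in> carrier (Aut M)" "y \<in> carrier (Aut M)" for x y
    using that unfolding c by (auto elim!: quotientE simp: Aut_mult_class intro!: q mp_auts_comp)
  show "x \<otimes>\<^bsub>Aut M\<^esub> y \<otimes>\<^bsub>Aut M\<^esub> z = x \<otimes>\<^bsub>Aut M\<^esub> (y \<otimes>\<^bsub>Aut M\<^esub> z)"
    if "x \<in> carrier (Aut M)" "y \<in> carrier (Aut M)" "z \<in> carrier (Aut M)" for x y z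
    using that unfolding c
    by (auto elim!: quotientE simp: Aut_mult_class mp_auts_comp comp_assoc)
  show "\<one>\<^bsub>Aut M\<^esub> \<otimes>\<^bsub>Aut M\<^esub> x = x" if "x \<in> carrier (Aut M)" for x
    using that unfolding c one by (auto elim!: quotientE simp: Aut_mult_class mp_auts_id)
  show "\<exists>y\<in>carrier (Aut M). y \<otimes>\<^bsub>Aut M\<^esub> x = \<one>\<^bsub>Aut M\<^esub>" if x: "x \<in> carrier (Aut M)" for x
  proof -
    obtain f where f: "f \<in> mp_auts M" "x = aut_rel M `` {f}"
      using x unfolding c by (auto elim: quotientE)
    let ?i = "inv_into (space M) f"
    have "bij_betw f (space M) (space M)" using f by (simp add: mp_auts_def)
    then have "(?i \<circ> f, id) \<in> aut_rel M"
      using f by (auto simp: aut_rel_def mp_auts_comp mp_auts_inv mp_auts_id bij_betw_inv_into_left)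
    then have "(aut_rel M `` {?i}) \<otimes>\<^bsub>Aut M\<^esub> x = \<one>\<^bsub>Aut M\<^esub>"
      using f equiv_class_eq[OF equiv_aut_rel] by (simp add: Aut_mult_class mp_auts_inv one)
    then show ?thesis using q[OF mp_auts_inv[OF f(1)]] unfolding c by blast
  qed
qed


section \<open>The measure algebra and the weak topology\<close>

definition null_rel :: "'a measure \<Rightarrow> ('a set \<times> 'a set) set" where
  "null_rel M = {(A, B). A \<in> sets M \<and> B \<in> sets M \<and> sym_diff A B \<in> null_sets M}"

definition malg :: "'a measure \<Rightarrow> 'a set set set" where
  "malg M = sets M // null_rel M"

text \<open>The value does not depend on the chosen representatives, see \<open>malg_dist_class\<close> below.
  Unlike a definite description, the choice keeps the function nonnegative and symmetric also
  outside \<open>malg M\<close>, as the locale \<open>Metric_space\<close> requires.\<close>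

definition malg_dist :: "'a measure \<Rightarrow> 'a set set \<Rightarrow> 'a set set \<Rightarrow> real" where
  "malg_dist M P Q = measure M (sym_diff (SOME A. A \<in> P) (SOME B. B \<in> Q))"

definition malg_topology :: "'a measure \<Rightarrow> 'a set set topology" where
  "malg_topology M = Metric_space.mtopology (malg M) (malg_dist M)"

definition aut_app :: "'a measure \<Rightarrow> ('a \<Rightarrow> 'a) set \<Rightarrow> 'a set set \<Rightarrow> 'a set set" where
  "aut_app M S P = (\<Union>f\<in>S. \<Union>A\<in>P. null_rel M `` {f ` A})"

definition weak_topology :: "'a measure \<Rightarrow> ('a \<Rightarrow> 'a) set topology" where
  "weak_topology M = topology_generated_by
     {{S \<in> carrier (Aut M). aut_app M S P \<in> U} |P U. P \<in> malg M \<and> openin (malg_topology M) U}"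


lemma equiv_null_rel: "equiv (sets M) (null_rel M)"
proof (rule equivI)
  show "trans (null_rel M)"
  proof (rule transI)
    fix A B C assume "(A, B) \<in> null_rel M" "(B, C) \<in> null_rel M"
    then have "A \<in> sets M" "C \<in> sets M" "sym_diff A B \<union> sym_diff B C \<in> null_sets M"
      by (auto simp: null_rel_def)
    moreover have "sym_diff A C \<subseteq> sym_diff A B \<union> sym_diff B C" by blast
    ultimately show "(A, C) \<in> null_rel M"
      using null_sets_subset[of "sym_diff A B \<union> sym_diff B C" M "sym_diff A C"]
      by (simp add: null_rel_def sets.Un sets.Diff)
  qed
  show "sym (null_rel M)" unfolding sym_def null_rel_def by (auto simp: Un_commute)
qed (auto simp: refl_on_def null_rel_def)

lemma measure_null_rel:
  assumes "(A, B) \<in> null_rel M"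
  shows "measure M A = measure M B"
proof (rule measure_eq_AE)
  have "sym_diff A B \<in> null_sets M" using assms by (simp add: null_rel_def)
  then have "AE x in M. x \<notin> sym_diff A B" by (rule AE_not_in)
  then show "AE x in M. x \<in> A \<longleftrightarrow> x \<in> B" by eventually_elim auto
qed (use assms in \<open>auto simp: null_rel_def\<close>)

lemma sym_diff_null_rel:
  assumes "(A, A') \<in> null_rel M" "(B, B') \<in> null_rel M"
  shows "(sym_diff A B, sym_diff A' B') \<in> null_rel M"
proof -
  let ?N = "sym_diff A A' \<union> sym_diff B B'"
  have s: "A \<in> sets M" "A' \<in> sets M" "B \<in> sets M" "B' \<in> sets M" "?N \<in> null_sets M"
    using assms by (auto simp: null_rel_def)
  have "sym_diff (sym_diff A B) (sym_diff A' B') \<subseteq> ?N" by blast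
  with s(5) have "sym_diff (sym_diff A B) (sym_diff A' B') \<in> null_sets M"
    using s(1-4) null_sets_subset[OF s(5)] by (simp add: sets.Un sets.Diff)
  with s(1-4) show ?thesis by (simp add: null_rel_def sets.Un sets.Diff)
qed

lemma malg_dist_class:
  assumes "A \<in> sets M" "B \<in> sets M"
  shows "malg_dist M (null_rel M `` {A}) (null_rel M `` {B}) = measure M (sym_diff A B)"
proof -
  have c: "(C, SOME C'. C' \<in> null_rel M `` {C}) \<in> null_rel M" if "C \<in> sets M" for C
  proof -
    have "C \<in> null_rel M `` {C}" using that by (simp add: null_rel_def)
    then have "(SOME C'. C' \<in> null_rel M `` {C}) \<in> null_rel M `` {C}" by (rule someI)
    then show ?thesis by blast
  qed
  show ?thesis
    unfolding malg_dist_def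
    using measure_null_rel[OF sym_diff_null_rel[OF c[OF assms(1)] c[OF assms(2)]]] by simp
qed

lemma Metric_space_malg:
  assumes "finite_measure M"
  shows "Metric_space (malg M) (malg_dist M)"
proof
  interpret finite_measure M by fact
  fix P Q
  show "0 \<le> malg_dist M P Q" by (simp add: malg_dist_def)
  show "malg_dist M P Q = malg_dist M Q P" by (simp add: malg_dist_def Un_commute)
  assume "P \<in> malg M" "Q \<in> malg M"
  then obtain A B where AB: "A \<in> sets M" "B \<in> sets M"
    "P = null_rel M `` {A}" "Q = null_rel M `` {B}"
    by (auto simp: malg_def elim!: quotientE)
  have "malg_dist M P Q = 0 \<longleftrightarrow> sym_diff A B \<in> null_sets M"
    using AB measure_eq_0_null_sets by (auto simp: malg_dist_class null_sets_def emeasure_eq_measure)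
  also have "\<dots> \<longleftrightarrow> (A, B) \<in> null_rel M" using AB by (simp add: null_rel_def)
  also have "\<dots> \<longleftrightarrow> P = Q" using eq_equiv_class_iff[OF equiv_null_rel AB(1,2)] AB(3,4) by simp
  finally show "malg_dist M P Q = 0 \<longleftrightarrow> P = Q" .
  fix R assume "R \<in> malg M"
  then obtain C where C: "C \<in> sets M" "R = null_rel M `` {C}"
    by (auto simp: malg_def elim!: quotientE)
  have "measure M (sym_diff A C) \<le> measure M (sym_diff A B \<union> sym_diff B C)"
    using AB C by (intro finite_measure_mono) auto
  also have "\<dots> \<le> measure M (sym_diff A B) + measure M (sym_diff B C)"
    using AB C by (intro measure_Un_le) auto
  finally show "malg_dist M P R \<le> malg_dist M P Q + malg_dist M Q R"
    using AB C by (simp add: malg_dist_class)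
qed

lemma mp_auts_image:
  assumes "f \<in> mp_auts M" "A \<in> sets M"
  shows "f ` A \<in> sets M" "emeasure M (f ` A) = emeasure M A"
proof -
  have b: "bij_betw f (space M) (space M)" and m: "f \<in> measurable M M"
    and i: "inv_into (space M) f \<in> measurable M M" and d: "distr M M f = M"
    using assms(1) by (auto simp: mp_auts_def)
  have sub: "A \<subseteq> space M" using assms(2) by (rule sets.sets_into_space)
  have "f ` A = inv_into (space M) f -` A \<inter> space M"
  proof (intro equalityI subsetI)
    fix y assume "y \<in> f ` A"
    then obtain x where x: "x \<in> A" "y = f x" by blast
    then have "inv_into (space M) f y = x" using b sub by (auto simp: bij_betw_inv_into_left)
    then show "y \<in> inv_into (space M) f -` A \<inter> space M"
      using x b sub by (auto simp: bij_betw_def)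
  next
    fix y assume y: "y \<in> inv_into (space M) f -` A \<inter> space M"
    then have "f (inv_into (space M) f y) = y" using b by (simp add: bij_betw_inv_into_right)
    with y show "y \<in> f ` A" by (metis IntD1 imageI vimageD)
  qed
  with measurable_sets[OF i assms(2)] show s: "f ` A \<in> sets M" by simp
  have "f -` (f ` A) \<inter> space M = A" using b sub by (auto simp: bij_betw_def inj_on_def)
  with emeasure_distr[OF m s] d show "emeasure M (f ` A) = emeasure M A" by simp
qed

lemma aut_rel_image:
  assumes "(f, g) \<in> aut_rel M" "(A, B) \<in> null_rel M"
  shows "(f ` A, g ` B) \<in> null_rel M"
proof -
  have fg: "f \<in> mp_auts M" "g \<in> mp_auts M" and AE: "AE x in M. f x = g x"
    and AB: "A \<in> sets M" "B \<in> sets M" "sym_diff A B \<in> null_sets M"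
    using assms by (auto simp: aut_rel_def null_rel_def)
  obtain N where N: "{x \<in> space M. f x \<noteq> g x} \<subseteq> N" "N \<in> null_sets M"
    using AE by (auto simp: eventually_ae_filter)
  have K: "sym_diff A B \<union> N \<in> null_sets M" using AB(3) N(2) by auto
  have i: "h ` (sym_diff A B \<union> N) \<in> null_sets M" if "h \<in> mp_auts M" for h
    using mp_auts_image[OF that, of "sym_diff A B \<union> N"] K by (auto simp: null_sets_def)
  have sub: "sym_diff (f ` A) (g ` B)
      \<subseteq> f ` (sym_diff A B \<union> N) \<union> g ` (sym_diff A B \<union> N)"
  proof
    have fg_eq: "f x = g x" if "x \<in> A \<union> B" "x \<notin> N" for x
      using N(1) sets.sets_into_space[OF AB(1)] sets.sets_into_space[OF AB(2)] that by blast
    fix y assume "y \<in> sym_diff (f ` A) (g ` B)"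
    then consider x where "x \<in> A" "y = f x" "y \<notin> g ` B" | x where "x \<in> B" "y = g x" "y \<notin> f ` A"
      by blast
    then show "y \<in> f ` (sym_diff A B \<union> N) \<union> g ` (sym_diff A B \<union> N)"
    proof cases
      case 1
      then have "x \<in> sym_diff A B \<union> N" using fg_eq[of x] by (metis DiffI UnCI imageI)
      with 1 show ?thesis by blast
    next
      case 2
      then have "x \<in> sym_diff A B \<union> N" using fg_eq[of x] by (metis DiffI UnCI imageI)
      with 2 show ?thesis by blast
    qed
  qed
  have "f ` (sym_diff A B \<union> N) \<union> g ` (sym_diff A B \<union> N) \<in> null_sets M"
    using i[OF fg(1)] i[OF fg(2)] by (rule null_sets.Un)
  from null_sets_subset[OF this _ sub] have "sym_diff (f ` A) (g ` B) \<in> null_sets M"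
    using mp_auts_image(1)[OF fg(1) AB(1)] mp_auts_image(1)[OF fg(2) AB(2)]
    by (simp add: sets.Un sets.Diff)
  then show ?thesis
    using mp_auts_image(1)[OF fg(1) AB(1)] mp_auts_image(1)[OF fg(2) AB(2)]
    by (simp add: null_rel_def)
qed

lemma aut_app_class:
  assumes "f \<in> mp_auts M" "A \<in> sets M"
  shows "aut_app M (aut_rel M `` {f}) (null_rel M `` {A}) = null_rel M `` {f ` A}"
proof -
  have "congruent2 (aut_rel M) (null_rel M) (\<lambda>f A. null_rel M `` {f ` A})"
    by (auto simp: congruent2_def intro!: equiv_class_eq[OF equiv_null_rel] aut_rel_image)
  then show ?thesis
    unfolding aut_app_def by (rule UN_equiv_class2[OF equiv_aut_rel equiv_null_rel _ assms])
qed

lemma topspace_weak_topology: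
  assumes "finite_measure M"
  shows "topspace (weak_topology M) = carrier (Aut M)"
proof -
  interpret Metric_space "malg M" "malg_dist M" by (rule Metric_space_malg[OF assms])
  have P: "null_rel M `` {{}} \<in> malg M" by (simp add: malg_def quotientI)
  have op: "openin (malg_topology M) (malg M)"
    unfolding malg_topology_def by (metis openin_topspace topspace_mtopology)
  have "aut_app M S (null_rel M `` {{}}) \<in> malg M" if "S \<in> carrier (Aut M)" for S
    using that P by (auto simp: Aut_def aut_app_class elim!: quotientE)
  with P op show ?thesis
    unfolding weak_topology_def topology_generated_by_topspace by blast
qed


section \<open>Topological groups and amenability\<close>

definition topological_group :: "('g, 'm) monoid_scheme \<Rightarrow> 'g topology \<Rightarrow> bool" where
  "topological_group H T \<longleftrightarrow> group H \<and> topspace T = carrier H \<and>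
     continuous_map (prod_topology T T) T (\<lambda>(g, h). g \<otimes>\<^bsub>H\<^esub> h) \<and>
     continuous_map T T (\<lambda>g. inv\<^bsub>H\<^esub> g)"

definition continuous_action ::
  "('g, 'm) monoid_scheme \<Rightarrow> 'g topology \<Rightarrow> 'x topology \<Rightarrow> ('g \<Rightarrow> 'x \<Rightarrow> 'x) \<Rightarrow> bool" where
  "continuous_action H T X \<phi> \<longleftrightarrow> group_action H (topspace X) \<phi> \<and>
     continuous_map (prod_topology T X) X (\<lambda>(g, x). \<phi> g x)"

definition regular_borel_prob :: "'x topology \<Rightarrow> 'x measure \<Rightarrow> bool" where
  "regular_borel_prob X N \<longleftrightarrow> prob_space N \<and> sets N = sets (borel_of X) \<and>
     (\<forall>A\<in>sets N. emeasure N A = (INF U\<in>{U. openin X U \<and> A \<subseteq> U}. emeasure N U) \<and>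
                 emeasure N A = (SUP K\<in>{K. compactin X K \<and> K \<subseteq> A}. emeasure N K))"

definition has_invariant_measure ::
  "('g, 'm) monoid_scheme \<Rightarrow> 'x topology \<Rightarrow> ('g \<Rightarrow> 'x \<Rightarrow> 'x) \<Rightarrow> bool" where
  "has_invariant_measure H X \<phi> \<longleftrightarrow>
     (\<exists>N. regular_borel_prob X N \<and> (\<forall>g\<in>carrier H. distr N N (\<phi> g) = N))"

text \<open>A definition in HOL cannot quantify over all types of points.  Letting the compact spaces
  live on the type \<open>'g set set\<close> loses nothing: every nonempty compact Hausdorff \<open>H\<close>-space
  contains the closure of an orbit, whose points \<open>x\<close> are determined by the sets \<open>A\<close> of group
  elements such that \<open>x\<close> lies in the closure of \<open>A \<cdot> x\<^sub>0\<close>.  Lemma \<open>amenable_any_space\<close> below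
  derives the property for spaces over an arbitrary type.\<close>

definition amenable :: "('g, 'm) monoid_scheme \<Rightarrow> 'g topology \<Rightarrow> bool" where
  "amenable H T \<longleftrightarrow>
     (\<forall>(X :: 'g set set topology) \<phi>.
        topspace X \<noteq> {} \<and> compact_space X \<and> Hausdorff_space X \<and> continuous_action H T X \<phi>
        \<longrightarrow> has_invariant_measure H X \<phi>)"


lemma space_borel_of: "space (borel_of X) = topspace X"
  by (simp add: borel_of_def space_measure_of_conv)

lemma sets_borel_of: "sets (borel_of X) = sigma_sets (topspace X) {U. openin X U}"
  unfolding borel_of_def by (rule sets_measure_of) (auto dest: openin_subset)

lemma openin_borel_of: "openin X U \<Longrightarrow> U \<in> sets (borel_of X)"
  by (auto simp: sets_borel_of)

lemma closedin_borel_of: "closedin X C \<Longrightarrow> C \<in> sets (borel_of X)"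
  by (metis closedin_def openin_borel_of sets.compl_sets space_borel_of double_diff order_refl)

lemma continuous_map_borel_of:
  assumes "continuous_map X Y f"
  shows "f \<in> measurable (borel_of X) (borel_of Y)"
proof -
  have "f \<in> measurable (borel_of X) (sigma (topspace Y) {U. openin Y U})"
  proof (rule measurable_measure_of)
    show "f \<in> space (borel_of X) \<rightarrow> topspace Y"
      using continuous_map_image_subset_topspace[OF assms] by (auto simp: space_borel_of)
    fix U assume "U \<in> {U. openin Y U}"
    then have "openin X {x \<in> topspace X. f x \<in> U}"
      using assms by (simp add: openin_continuous_map_preimage)
    then show "f -` U \<inter> space (borel_of X) \<in> sets (borel_of X)"
      by (simp add: openin_borel_of space_borel_of vimage_def Int_def conj_commute)
  qed (auto dest: openin_subset)
  then show ?thesis by (simp add: borel_of_def)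
qed

lemma regular_borel_prob_distr:
  assumes N: "regular_borel_prob Z N" and f: "continuous_map Z X f" and H: "Hausdorff_space X"
  shows "regular_borel_prob X (distr N (borel_of X) f)"
proof -
  let ?D = "distr N (borel_of X) f"
  interpret N: prob_space N using N by (simp add: regular_borel_prob_def)
  have sN: "sets N = sets (borel_of Z)" using N by (simp add: regular_borel_prob_def)
  have Ninner: "emeasure N A = (SUP K\<in>{K. compactin Z K \<and> K \<subseteq> A}. emeasure N K)"
    if "A \<in> sets N" for A
    using N that unfolding regular_borel_prob_def by blast
  have m: "f \<in> measurable N (borel_of X)"
    using continuous_map_borel_of[OF f] measurable_cong_sets[OF sN refl] by blast
  interpret D: prob_space ?D using m by (rule N.prob_space_distr)
  have cK: "closedin X K" "K \<in> sets ?D" if "compactin X K" for K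
    using compactin_imp_closedin[OF H that] closedin_borel_of by auto
  have inner: "emeasure ?D A = (SUP K\<in>{K. compactin X K \<and> K \<subseteq> A}. emeasure ?D K)"
    if A: "A \<in> sets ?D" for A
  proof (rule antisym)
    have "f -` A \<inter> space N \<in> sets N" using m A by (auto intro: measurable_sets)
    then have "emeasure ?D A
        = (SUP K\<in>{K. compactin Z K \<and> K \<subseteq> f -` A \<inter> space N}. emeasure N K)"
      using A m Ninner by (simp add: emeasure_distr)
    also have "\<dots> \<le> (SUP K\<in>{K. compactin X K \<and> K \<subseteq> A}. emeasure ?D K)"
    proof (rule SUP_mono)
      fix K assume K: "K \<in> {K. compactin Z K \<and> K \<subseteq> f -` A \<inter> space N}"
      then have c: "compactin X (f ` K)" using image_compactin f by blast
      have "f -` (f ` K) \<inter> space N \<in> sets N" using m cK(2)[OF c] by (auto intro: measurable_sets)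
      then have "emeasure N K \<le> emeasure N (f -` (f ` K) \<inter> space N)"
        using K by (intro emeasure_mono) auto
      also have "\<dots> = emeasure ?D (f ` K)" using m cK(2)[OF c] by (simp add: emeasure_distr)
      finally show "\<exists>L\<in>{K. compactin X K \<and> K \<subseteq> A}. emeasure N K \<le> emeasure ?D L"
        using c K by (intro bexI[of _ "f ` K"]) auto
    qed
    finally show "emeasure ?D A \<le> (SUP K\<in>{K. compactin X K \<and> K \<subseteq> A}. emeasure ?D K)" .
  qed (use A in \<open>auto intro!: SUP_least emeasure_mono\<close>)
  have outer: "emeasure ?D A = (INF U\<in>{U. openin X U \<and> A \<subseteq> U}. emeasure ?D U)"
    if A: "A \<in> sets ?D" for A
  proof (rule antisym)
    show "emeasure ?D A \<le> (INF U\<in>{U. openin X U \<and> A \<subseteq> U}. emeasure ?D U)"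
      by (auto intro!: INF_greatest emeasure_mono openin_borel_of)
    have AX: "A \<subseteq> topspace X" using sets.sets_into_space[OF A] by (simp add: space_borel_of)
    have sp: "space ?D = topspace X" by (simp add: space_borel_of)
    show "(INF U\<in>{U. openin X U \<and> A \<subseteq> U}. emeasure ?D U) \<le> emeasure ?D A"
    proof (rule ennreal_le_epsilon)
      fix e :: real assume e: "0 < e"
      let ?B = "topspace X - A"
      have B: "?B \<in> sets ?D" using A sp by (metis sets.compl_sets)
      have "\<exists>K. compactin X K \<and> K \<subseteq> ?B \<and> measure ?D ?B < measure ?D K + e"
      proof (rule ccontr)
        assume *: "\<not> ?thesis"
        have le: "measure ?D K \<le> measure ?D ?B - e" if "compactin X K" "K \<subseteq> ?B" for K
        proof -
          have "\<not> measure ?D ?B < measure ?D K + e" using * that by blast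
          then show ?thesis by linarith
        qed
        have nn: "0 \<le> measure ?D ?B - e" using le[of "{}"] by simp
        have "emeasure ?D ?B \<le> ennreal (measure ?D ?B - e)"
          unfolding inner[OF B] using le by (auto intro!: SUP_least ennreal_leI simp: D.emeasure_eq_measure)
        then show False using e nn by (simp add: D.emeasure_eq_measure)
      qed
      then obtain K where K: "compactin X K" "K \<subseteq> ?B" "measure ?D ?B < measure ?D K + e" by blast
      have U: "openin X (topspace X - K)" "A \<subseteq> topspace X - K" using cK(1)[OF K(1)] K(2) AX by auto
      have "measure ?D (topspace X - K) = 1 - measure ?D K"
        using D.prob_compl[OF cK(2)[OF K(1)]] sp by simp
      moreover have "measure ?D ?B = 1 - measure ?D A"
        using D.prob_compl[OF A] sp by simp
      ultimately have "measure ?D (topspace X - K) \<le> measure ?D A + e" using K(3) by simp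
      then have "emeasure ?D (topspace X - K) \<le> emeasure ?D A + ennreal e"
        using e by (simp add: D.emeasure_eq_measure flip: ennreal_plus)
      then show "(INF U\<in>{U. openin X U \<and> A \<subseteq> U}. emeasure ?D U) \<le> emeasure ?D A + ennreal e"
        using U by (intro INF_lower2[of "topspace X - K"]) auto
    qed
  qed
  show ?thesis
    unfolding regular_borel_prob_def using D.prob_space_axioms inner outer by simp
qed

lemma amenable_any_space:
  fixes X :: "'x topology"
  assumes am: "amenable H T" and tg: "topological_group H T"
    and ne: "topspace X \<noteq> {}" and cX: "compact_space X" and hX: "Hausdorff_space X"
    and act: "continuous_action H T X \<phi>"
  shows "has_invariant_measure H X \<phi>"
proof -
  interpret group_action H "topspace X" \<phi> using act by (simp add: continuous_action_def)
  interpret G: group H using tg by (simp add: topological_group_def)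
  have T: "topspace T = carrier H" using tg by (simp add: topological_group_def)
  have jc: "continuous_map (prod_topology T X) X (\<lambda>(g, x). \<phi> g x)"
    using act by (simp add: continuous_action_def)
  have cont: "continuous_map X X (\<phi> g)" if g: "g \<in> carrier H" for g
  proof -
    have "continuous_map X (prod_topology T X) (\<lambda>x. (g, x))"
      using g T by (simp add: continuous_map_pairedI)
    from continuous_map_compose[OF this jc] show ?thesis by (simp add: comp_def)
  qed
  obtain x0 where x0: "x0 \<in> topspace X" using ne by blast
  define orb where "orb A = (\<lambda>g. \<phi> g x0) ` A" for A
  have orb_sub: "orb A \<subseteq> topspace X" if "A \<subseteq> carrier H" for A
    using element_image[OF _ x0] that by (auto simp: orb_def)
  define Y where "Y = X closure_of (orb (carrier H))"
  have Ycl: "closedin X Y" and Ysub: "Y \<subseteq> topspace X" 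
    by (simp_all add: Y_def closure_of_subset_topspace)
  have Yne: "x0 \<in> Y"
  proof -
    have "\<phi> \<one>\<^bsub>H\<^esub> x0 = x0" using id_eq_one x0 by (metis restrict_apply')
    then have "x0 \<in> orb (carrier H)" unfolding orb_def by (metis G.one_closed imageI)
    then show ?thesis using closure_of_subset[OF orb_sub[OF order_refl]] by (auto simp: Y_def)
  qed
  have Yinv: "\<phi> g y \<in> Y" if g: "g \<in> carrier H" and y: "y \<in> Y" for g y
  proof -
    have "\<phi> g ` orb (carrier H) \<subseteq> orb (carrier H)"
    proof
      fix z assume "z \<in> \<phi> g ` orb (carrier H)"
      then obtain h where h: "h \<in> carrier H" "z = \<phi> g (\<phi> h x0)" by (auto simp: orb_def)
      then have "z = \<phi> (g \<otimes>\<^bsub>H\<^esub> h) x0" using composition_rule[OF x0 g h(1)] by simp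
      with g h(1) show "z \<in> orb (carrier H)" by (auto simp: orb_def)
    qed
    moreover have "\<phi> g ` Y \<subseteq> X closure_of (\<phi> g ` orb (carrier H))"
      unfolding Y_def using cont[OF g] by (rule continuous_map_image_closure_subset)
    ultimately show ?thesis using y closure_of_mono unfolding Y_def by blast
  qed
  define enc where "enc y = {A. A \<subseteq> carrier H \<and> y \<in> X closure_of (orb A)}" for y
  have inj: "inj_on enc Y"
  proof (rule inj_onI, rule ccontr)
    fix x y assume xy: "x \<in> Y" "y \<in> Y" "enc x = enc y" "x \<noteq> y"
    have "x \<in> topspace X" "y \<in> topspace X" using xy(1,2) Ysub by auto
    with hX xy(4) obtain U V where UV: "openin X U" "openin X V" "x \<in> U" "y \<in> V" "disjnt U V"
      unfolding Hausdorff_space_def by metis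
    let ?A = "{g \<in> carrier H. \<phi> g x0 \<in> U}"
    have oA: "orb ?A = U \<inter> orb (carrier H)" by (auto simp: orb_def)
    have "x \<in> X closure_of (orb ?A)"
      using openin_Int_closure_of_subset[OF UV(1), of "orb (carrier H)"] xy(1) UV(3)
      unfolding oA Y_def by blast
    then have "y \<in> X closure_of (orb ?A)" using xy(3) by (auto simp: enc_def)
    then show False using UV oA by (auto simp: in_closure_of disjnt_iff)
  qed
  define dec where "dec = inv_into Y enc"
  have de [simp]: "dec (enc y) = y" if "y \<in> Y" for y using inj that by (simp add: dec_def)
  define Z where "Z = pullback_topology (enc ` Y) dec (subtopology X Y)"
  have tZ: "topspace Z = enc ` Y"
    using Ysub by (auto simp: Z_def topspace_pullback_topology)
  have cdecY: "continuous_map Z (subtopology X Y) dec"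
    using continuous_map_pullback[of "subtopology X Y" "subtopology X Y" id "enc ` Y" dec]
    by (simp add: Z_def)
  have cdec: "continuous_map Z X dec" using cdecY by (simp add: continuous_map_in_subtopology)
  have cenc: "continuous_map (subtopology X Y) Z enc"
    unfolding Z_def
  proof (rule continuous_map_pullback')
    show "continuous_map (subtopology X Y) (subtopology X Y) (dec \<circ> enc)"
      by (rule continuous_map_eq[of _ _ id]) auto
    show "topspace (subtopology X Y) \<subseteq> enc -` (enc ` Y)" by auto
  qed
  have hom: "homeomorphic_maps (subtopology X Y) Z enc dec"
    using cenc cdecY tZ Ysub by (auto simp: homeomorphic_maps_def)
  then have hs: "subtopology X Y homeomorphic_space Z" unfolding homeomorphic_space_def by blast
  have "compact_space (subtopology X Y)" "Hausdorff_space (subtopology X Y)"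
    using cX Ycl hX by (simp_all add: closedin_compact_space compact_space_subtopology Hausdorff_space_subtopology)
  with hs have Z: "compact_space Z" "Hausdorff_space Z"
    by (simp_all add: homeomorphic_compact_space homeomorphic_Hausdorff_space)
  define \<psi> where "\<psi> g = (\<lambda>z\<in>topspace Z. enc (\<phi> g (dec z)))" for g
  have \<psi>: "\<psi> g (enc y) = enc (\<phi> g y)" if "y \<in> Y" for g y using that tZ by (simp add: \<psi>_def)
  have \<psi>m: "\<psi> (g \<otimes>\<^bsub>H\<^esub> h) z = \<psi> g (\<psi> h z)"
    if "g \<in> carrier H" "h \<in> carrier H" "z \<in> enc ` Y" for g h z
    using that composition_rule[of _ g h] Ysub Yinv by (auto simp: \<psi> subset_iff)
  have \<psi>1: "\<psi> \<one>\<^bsub>H\<^esub> z = z" if z: "z \<in> enc ` Y" for z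
  proof -
    obtain y where y: "y \<in> Y" "z = enc y" using z by blast
    have "\<phi> \<one>\<^bsub>H\<^esub> y = y" using id_eq_one y(1) Ysub by (metis restrict_apply' subsetD)
    with y show ?thesis by (simp add: \<psi>)
  qed
  have \<psi>cl: "\<psi> g z \<in> enc ` Y" if "g \<in> carrier H" "z \<in> enc ` Y" for g z
    using that Yinv by (auto simp: \<psi>)
  have \<psi>b: "\<psi> g \<in> Bij (topspace Z)" if g: "g \<in> carrier H" for g
  proof -
    have "bij_betw (\<psi> g) (enc ` Y) (enc ` Y)"
    proof (rule bij_betwI[where g = "\<psi> (inv\<^bsub>H\<^esub> g)"])
      show "\<psi> (inv\<^bsub>H\<^esub> g) (\<psi> g z) = z" if "z \<in> enc ` Y" for z
        using \<psi>m[of "inv\<^bsub>H\<^esub> g" g z] g that by (simp add: \<psi>1)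
      show "\<psi> g (\<psi> (inv\<^bsub>H\<^esub> g) z) = z" if "z \<in> enc ` Y" for z
        using \<psi>m[of g "inv\<^bsub>H\<^esub> g" z] g that by (simp add: \<psi>1)
    qed (use \<psi>cl g in auto)
    moreover have "\<psi> g \<in> extensional (topspace Z)" by (simp add: \<psi>_def)
    ultimately show ?thesis by (simp add: Bij_def tZ)
  qed
  have "group_action H (topspace Z) \<psi>"
    unfolding group_action_def group_hom_def group_hom_axioms_def
  proof (intro conjI homI)
    show "\<psi> g \<in> carrier (BijGroup (topspace Z))" if "g \<in> carrier H" for g
      using \<psi>b[OF that] by (simp add: BijGroup_def)
    show "\<psi> (g \<otimes>\<^bsub>H\<^esub> h) = \<psi> g \<otimes>\<^bsub>BijGroup (topspace Z)\<^esub> \<psi> h"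
      if gh: "g \<in> carrier H" "h \<in> carrier H" for g h
    proof (rule extensionalityI)
      show "\<psi> (g \<otimes>\<^bsub>H\<^esub> h) \<in> extensional (topspace Z)" by (simp add: \<psi>_def)
      show "\<psi> g \<otimes>\<^bsub>BijGroup (topspace Z)\<^esub> \<psi> h \<in> extensional (topspace Z)"
        using gh \<psi>b by (simp add: BijGroup_def)
      show "\<psi> (g \<otimes>\<^bsub>H\<^esub> h) z = (\<psi> g \<otimes>\<^bsub>BijGroup (topspace Z)\<^esub> \<psi> h) z" if "z \<in> topspace Z" for z
        using gh that \<psi>b by (simp add: BijGroup_def compose_eq \<psi>m tZ)
    qed
  qed (simp_all add: G.is_group group_BijGroup)
  moreover have "continuous_map (prod_topology T Z) Z (\<lambda>(g, z). \<psi> g z)"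
  proof -
    have "continuous_map (prod_topology T Z) (prod_topology T X) (\<lambda>p. (fst p, dec (snd p)))"
      using continuous_map_compose[OF continuous_map_snd cdec]
      by (intro continuous_map_pairedI continuous_map_fst) (simp add: comp_def)
    from continuous_map_compose[OF this jc]
    have "continuous_map (prod_topology T Z) X (\<lambda>p. \<phi> (fst p) (dec (snd p)))"
      by (simp add: comp_def)
    moreover have "\<phi> (fst p) (dec (snd p)) \<in> Y" if "p \<in> topspace (prod_topology T Z)" for p
      using that Yinv T tZ by auto
    ultimately have "continuous_map (prod_topology T Z) (subtopology X Y) (\<lambda>p. \<phi> (fst p) (dec (snd p)))"
      by (auto simp: continuous_map_in_subtopology)
    from continuous_map_compose[OF this cenc]
    have "continuous_map (prod_topology T Z) Z (\<lambda>p. enc (\<phi> (fst p) (dec (snd p))))"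
      by (simp add: comp_def)
    then show ?thesis
      by (rule continuous_map_eq) (auto simp: \<psi>_def)
  qed
  ultimately have actZ: "continuous_action H T Z \<psi>" by (simp add: continuous_action_def)
  have "topspace Z \<noteq> {}" using tZ Yne by auto
  with am Z actZ have "has_invariant_measure H Z \<psi>" by (simp add: amenable_def)
  then obtain N where N: "regular_borel_prob Z N" and inv: "\<And>g. g \<in> carrier H \<Longrightarrow> distr N N (\<psi> g) = N"
    unfolding has_invariant_measure_def by blast
  let ?D = "distr N (borel_of X) dec"
  have sN: "sets N = sets (borel_of Z)" using N by (simp add: regular_borel_prob_def)
  have spN: "space N = enc ` Y" using sets_eq_imp_space_eq[OF sN] by (simp add: space_borel_of tZ)
  have m: "dec \<in> measurable N (borel_of X)"
    using continuous_map_borel_of[OF cdec] measurable_cong_sets[OF sN refl] by blast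
  have "distr ?D ?D (\<phi> g) = ?D" if g: "g \<in> carrier H" for g
  proof -
    have mg: "\<phi> g \<in> measurable (borel_of X) (borel_of X)"
      by (rule continuous_map_borel_of[OF cont[OF g]])
    have "continuous_map (prod_topology T Z) Z (\<lambda>(g, z). \<psi> g z)"
      using actZ by (simp add: continuous_action_def)
    moreover have "continuous_map Z (prod_topology T Z) (\<lambda>z. (g, z))"
      using g T by (simp add: continuous_map_pairedI)
    ultimately have "continuous_map Z Z (\<psi> g)"
      using continuous_map_compose[of Z "prod_topology T Z" "\<lambda>z. (g, z)" Z "\<lambda>(g, z). \<psi> g z"]
      by (simp add: comp_def)
    then have m\<psi>: "\<psi> g \<in> measurable N N"
      using continuous_map_borel_of measurable_cong_sets[OF sN sN] by blast
    have "distr ?D ?D (\<phi> g) = distr ?D (borel_of X) (\<phi> g)" by (rule distr_cong) auto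
    also have "\<dots> = distr N (borel_of X) (\<phi> g \<circ> dec)" by (rule distr_distr[OF mg m])
    also have "\<dots> = distr N (borel_of X) (dec \<circ> \<psi> g)"
      using g Yinv by (intro distr_cong) (auto simp: spN \<psi>)
    also have "\<dots> = distr (distr N N (\<psi> g)) (borel_of X) dec"
      by (rule distr_distr[OF m m\<psi>, symmetric])
    finally show ?thesis by (simp add: inv[OF g])
  qed
  then show ?thesis
    unfolding has_invariant_measure_def using regular_borel_prob_distr[OF N cdec hX] by blast
qed


section \<open>Whirly near-actions\<close>

definition polish_group :: "('g, 'm) monoid_scheme \<Rightarrow> 'g topology \<Rightarrow> bool" where
  "polish_group H T \<longleftrightarrow> topological_group H T \<and> polish_topology T"

definition near_action ::
  "'a measure \<Rightarrow> ('g, 'm) monoid_scheme \<Rightarrow> ('g \<Rightarrow> ('a \<Rightarrow> 'a) set) \<Rightarrow> bool" where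
  "near_action M H \<phi> \<longleftrightarrow> \<phi> \<in> hom H (Aut M)"

text \<open>The measure of \<open>A \<inter> gB\<close> does not depend on the representative \<open>f\<close> of \<open>\<phi> g\<close>, by
  \<open>aut_rel_image\<close>.  The set \<open>U\<close> ranges over all neighbourhoods of the neutral element.\<close>

definition whirly ::
  "'a measure \<Rightarrow> ('g, 'm) monoid_scheme \<Rightarrow> 'g topology \<Rightarrow> ('g \<Rightarrow> ('a \<Rightarrow> 'a) set) \<Rightarrow> bool" where
  "whirly M H T \<phi> \<longleftrightarrow>
     standard_prob_space M \<and> polish_group H T \<and> near_action M H \<phi> \<and>
     continuous_map T (weak_topology M) \<phi> \<and>
     (\<forall>A\<in>sets M. \<forall>B\<in>sets M. measure M A * measure M B > 0 \<longrightarrow>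
        (\<forall>U V. openin T V \<and> \<one>\<^bsub>H\<^esub> \<in> V \<and> V \<subseteq> U \<longrightarrow>
           {g \<in> carrier H. \<exists>f\<in>\<phi> g. measure M (A \<inter> f ` B) > 0} \<inter> U \<noteq> {}))"

end

theory Submission
  imports Defs
begin

text \<open>Let a countable group \<open>\<Gamma>\<close> without invariant mean act on \<open>M\<close> as a Bernoulli shift over a
  base with two independent coordinates, and let \<open>G\<close> consist of the elements of the full group,
  \<open>f x = h x \<cdot> x\<close>, whose cocycle \<open>h\<close> (and that of the inverse) depends on the first coordinates
  only.  The second coordinates see the cocycle: for a fixed set \<open>A\<close> of measure \<open>1/2\<close> depending on
  a single second coordinate, \<open>2 \<mu>(f A \<triangle> g A)\<close> is the measure of the set where the cocycles of the
  inverses of \<open>f\<close> and \<open>g\<close> differ.  Hence on \<open>G\<close> the weak topology is induced by the bi-invariant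
  uniform metric, for which \<open>G\<close> is complete; in particular \<open>G\<close> is Polish and closed.  It is whirly
  because, by mixing, some \<open>\<gamma>\<close> moves part of any given set into any other one, and the action of
  \<open>\<gamma>\<close> can be cut down to an involution in \<open>G\<close> supported on a small set.  Finally, \<open>G\<close> acts on the compact space of finitely additive
  measures on \<open>\<Omega> \<times> \<Gamma>\<close> with first marginal \<open>\<mu>\<close>, and averaging an invariant measure over it would
  give an invariant mean on \<open>\<Gamma>\<close>.\<close>

section \<open>Isomorphisms modulo null sets\<close>

text \<open>A topological group can be amenable although it contains a non-amenable discrete group:
  \<open>Aut M\<close> itself is amenable in the weak topology. So the presence of \<Gamma> in
  \<open>G\<close> decides nothing, and what has to obstruct amenability is an action of
  \<open>G\<close> that is continuous for the weak topology. The natural one uses the cocycle and is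
  continuous for the uniform metric. On the whole full group that metric is too fine, and for an
  ergodic action the full group is weakly dense in \<open>Aut M\<close>, hence far from closed. The
  second coordinates remove the discrepancy: for distinct \<gamma>, \<delta> the preimages of
  \<open>A\<close> under them are independent events of probability 1/2, and both are independent of
  the first coordinates. Two cocycles over the first coordinates that differ on a set of measure t
  are therefore told apart by \<open>A\<close> on exactly t/2. Enough freedom remains, since
  constant cocycles and swaps over sets in the first coordinates stay available. Fixing the first
  marginal in the compact space gives continuity: a change of the cocycle on a set of measure t
  changes the value on any set by at most t.\<close>

definition mod0_iso ::
  "'a measure \<Rightarrow> 'b measure \<Rightarrow> ('a \<Rightarrow> 'b) \<Rightarrow> ('b \<Rightarrow> 'a) \<Rightarrow> bool" where
  "mod0_iso M N f g \<longleftrightarrow> f \<in> measurable M N \<and> g \<in> measurable N M \<and>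
     distr M N f = N \<and> distr N M g = M \<and>
     (AE x in M. g (f x) = x) \<and> (AE y in N. f (g y) = y)"

lemma AE_distr_eqD:
  assumes "f \<in> measurable M N" "distr M N f = N" "AE y in N. P y"
  shows "AE x in M. P (f x)"
  using assms by (metis AE_distrD)

lemma mod0_iso_sym: "mod0_iso M N f g \<Longrightarrow> mod0_iso N M g f"
  by (auto simp: mod0_iso_def)

lemma mod0_iso_trans:
  assumes "mod0_iso M N f g" "mod0_iso N L f' g'"
  shows "mod0_iso M L (f' \<circ> f) (g \<circ> g')"
proof -
  have m: "f \<in> measurable M N" "g \<in> measurable N M" "f' \<in> measurable N L" "g' \<in> measurable L N"
    and d: "distr M N f = N" "distr N M g = M" "distr N L f' = L" "distr L N g' = N"
    and ae: "AE x in M. g (f x) = x" "AE y in N. f (g y) = y"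
      "AE y in N. g' (f' y) = y" "AE z in L. f' (g' z) = z"
    using assms by (auto simp: mod0_iso_def)
  have "AE x in M. g' (f' (f x)) = f x" "AE z in L. f (g (g' z)) = g' z"
    using AE_distr_eqD[OF m(1) d(1) ae(3)] AE_distr_eqD[OF m(4) d(4) ae(2)] by auto
  then have "AE x in M. g (g' (f' (f x))) = x" "AE z in L. f' (f (g (g' z))) = z"
    using ae(1,4) by (auto elim: eventually_elim2)
  moreover have "distr M L (f' \<circ> f) = L" "distr L M (g \<circ> g') = M"
    using distr_distr[OF m(3,1)] distr_distr[OF m(2,4)] d by auto
  ultimately show ?thesis
    using m by (auto simp: mod0_iso_def)
qed

lemma AE_funpow:
  assumes f: "f \<in> measurable M M" "distr M M f = M" and "AE x in M. P x"
  shows "AE x in M. P ((f ^^ n) x)"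
proof (induction n)
  case (Suc n)
  then show ?case using AE_distr_eqD[OF f Suc] by (simp add: funpow_swap1)
qed (use assms in simp)

lemma measurable_funpow:
  "f \<in> measurable M M \<Longrightarrow> (f ^^ n) \<in> measurable M M"
  by (induction n) (auto simp: measurable_ident_sets id_def intro: measurable_comp)

lemma mp_autsI:
  assumes f: "f \<in> measurable M M" "distr M M f = M" and g: "g \<in> measurable M M"
    and gf: "\<And>x. x \<in> space M \<Longrightarrow> g (f x) = x" and fg: "\<And>x. x \<in> space M \<Longrightarrow> f (g x) = x"
  shows "f \<in> mp_auts M" "\<And>x. x \<in> space M \<Longrightarrow> inv_into (space M) f x = g x"
proof -
  have bij: "bij_betw f (space M) (space M)"
    by (rule bij_betwI[where g = g]) (use gf fg measurable_space[OF f(1)] measurable_space[OF g] in auto)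
  show inv: "inv_into (space M) f x = g x" if "x \<in> space M" for x
    using that bij fg measurable_space[OF g that] by (intro inv_into_f_eq) (auto simp: bij_betw_def)
  show "f \<in> mp_auts M"
    using bij f g by (auto simp: mp_auts_def cong: measurable_cong[OF inv])
qed

text \<open>An automorphism modulo null sets becomes an honest bijection after being replaced by the
  identity outside the points whose whole two-sided orbit is well behaved.\<close>

lemma mod0_iso_mp_auts:
  assumes iso: "mod0_iso M M f g"
  obtains f' where "f' \<in> mp_auts M" "AE x in M. f' x = f x"
    "AE x in M. inv_into (space M) f' x = g x"
proof -
  have m[measurable]: "f \<in> measurable M M" "g \<in> measurable M M"
    and d: "distr M M f = M" "distr M M g = M"
    and ae: "AE x in M. g (f x) = x \<and> f (g x) = x"
    using iso by (auto simp: mod0_iso_def)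
  from ae obtain N where N: "{x \<in> space M. \<not> (g (f x) = x \<and> f (g x) = x)} \<subseteq> N" "N \<in> null_sets M"
    unfolding eventually_ae_filter by blast
  define Q where "Q = space M - N"
  have [measurable]: "Q \<in> sets M" using N by (auto simp: Q_def)
  have Qfg: "g (f x) = x" "f (g x) = x" if "x \<in> Q" for x using N that by (auto simp: Q_def)
  have aeQ: "AE x in M. x \<in> Q"
    using N(2) by (auto simp: Q_def eventually_ae_filter)
  define D where "D = {x \<in> space M. \<forall>n. (f ^^ n) x \<in> Q \<and> (g ^^ n) x \<in> Q}"
  have [measurable]: "(f ^^ n) \<in> measurable M M" "(g ^^ n) \<in> measurable M M" for n
    by (auto intro: measurable_funpow)
  have D[measurable]: "D \<in> sets M" unfolding D_def by measurable
  have aeD: "AE x in M. x \<in> D"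
    unfolding D_def using AE_funpow[OF m(1) d(1) aeQ] AE_funpow[OF m(2) d(2) aeQ]
    by (auto simp: AE_all_countable)
  have DQ: "x \<in> Q" if "x \<in> D" for x using that by (auto simp: D_def dest: spec[of _ 0])
  have sub: "D \<subseteq> space M" by (auto simp: D_def)
  \<comment> \<open>\<open>F\<close> and \<open>G\<close> are \<open>f\<close> and \<open>g\<close>
    in either order. The \<open>F\<close>-iterates of \<open>F x\<close> are later iterates of
    \<open>x\<close>; a \<open>G\<close>-iterate of positive order loses one step, and the one of
    order 0 is the first \<open>F\<close>-iterate of \<open>x\<close>.\<close>
  have step: "F x \<in> D" if x: "x \<in> D" and FG: "(F = f \<and> G = g) \<or> (F = g \<and> G = f)" for F G x
  proof -
    have FGx: "G (F y) = y" if "y \<in> Q" for y using FG Qfg that by auto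
    have inD: "y \<in> D \<longleftrightarrow> y \<in> space M \<and> (\<forall>n. (F ^^ n) y \<in> Q \<and> (G ^^ n) y \<in> Q)" for y
      using FG by (auto simp: D_def)
    have "F x \<in> space M" using x FG sub measurable_space[OF m(1)] measurable_space[OF m(2)] by auto
    moreover have "(F ^^ n) (F x) \<in> Q" for n
      using x inD[of x] by (metis funpow_Suc_right comp_apply)
    moreover have "(G ^^ n) (F x) \<in> Q" for n
    proof (cases n)
      case 0
      then show ?thesis using x inD[of x] by (auto dest: spec[of _ "Suc 0"])
    next
      case (Suc k)
      then have "(G ^^ n) (F x) = (G ^^ k) (G (F x))" by (simp add: funpow_swap1)
      then show ?thesis using FGx DQ[OF x] x inD[of x] by simp
    qed
    ultimately show ?thesis using inD by blast
  qed
  have fD: "f x \<in> D" and gD: "g x \<in> D" if "x \<in> D" for x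
    using step[OF that] by blast+
  define f' where "f' x = (if x \<in> D then f x else x)" for x
  define g' where "g' x = (if x \<in> D then g x else x)" for x
  have [measurable]: "f' \<in> measurable M M" "g' \<in> measurable M M"
    unfolding f'_def g'_def by measurable
  have fg: "g' (f' x) = x" "f' (g' x) = x" for x
    using fD gD Qfg DQ by (auto simp: f'_def g'_def)
  have ae': "AE x in M. f' x = f x" "AE x in M. g' x = g x"
    using aeD by (auto simp: f'_def g'_def)
  have "distr M M f' = distr M M f" by (rule distr_cong_AE) (use ae' in auto)
  then have inv: "f' \<in> mp_auts M" "\<And>x. x \<in> space M \<Longrightarrow> inv_into (space M) f' x = g' x"
    using mp_autsI[of f' M g'] fg d by auto
  have "AE x in M. inv_into (space M) f' x = g x"
    using ae'(2) AE_space by eventually_elim (simp add: inv)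
  then show ?thesis using ae'(1) inv that by blast
qed

section \<open>Standard probability spaces without atoms\<close>

text \<open>Ternary digits: a sequence of bits is recovered from \<open>\<Sum>i. b i / 3 ^ i\<close> by the greedy
  algorithm, since the tail after an index contributes at most half of its weight.\<close>

fun ternary_rest :: "nat \<Rightarrow> real \<Rightarrow> real" where
  "ternary_rest 0 y = y"
| "ternary_rest (Suc n) y = ternary_rest n y - (if ternary_rest n y \<ge> (1/3) ^ n then (1/3) ^ n else 0)"

lemma measurable_ternary_rest [measurable]: "ternary_rest n \<in> borel_measurable borel"
proof (induction n)
  case (Suc n)
  note [measurable] = Suc
  have "ternary_rest (Suc n)
      = (\<lambda>y. ternary_rest n y - (if ternary_rest n y \<ge> (1/3) ^ n then (1/3) ^ n else 0))"
    by (simp add: fun_eq_iff)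
  then show ?case by simp
qed (simp add: fun_eq_iff[of "ternary_rest 0"] cong: measurable_cong)

definition ternary_sum :: "(nat \<Rightarrow> bool) \<Rightarrow> real" where
  "ternary_sum b = (\<Sum>i. of_bool (b i) * (1/3) ^ i)"

lemma summable_ternary: "summable (\<lambda>i. of_bool (b (i + n)) * (1/3 :: real) ^ (i + n))"
proof (rule summable_comparison_test')
  show "summable (\<lambda>i. (1/3 :: real) ^ (i + n))"
    using summable_geometric[of "1/3 :: real"] by (subst summable_iff_shift) simp
qed (simp add: of_bool_def)

lemma ternary_digit: "(1/3) ^ n \<le> ternary_rest n (ternary_sum b) \<longleftrightarrow> b n"
proof -
  let ?T = "\<lambda>n. \<Sum>i. of_bool (b (i + n)) * (1/3 :: real) ^ (i + n)"
  have split: "?T n = of_bool (b n) * (1/3) ^ n + ?T (Suc n)" for n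
    using suminf_split_head[OF summable_ternary[of b n]] by simp
  have T0: "0 \<le> ?T n" for n by (intro suminf_nonneg summable_ternary) simp
  \<comment> \<open>Base 3 makes this strict. In base 2 a tail of ones would equal the preceding
    weight, and two bit sequences could share a sum.\<close>
  have lt: "?T (Suc n) < (1/3) ^ n" for n
  proof -
    have g: "summable (\<lambda>i. (1/3 :: real) ^ (i + Suc n))"
      using summable_geometric[of "1/3 :: real"] by (subst summable_iff_shift) simp
    have "?T (Suc n) \<le> (\<Sum>i. (1/3) ^ (i + Suc n))"
      by (intro suminf_le summable_ternary g) (simp add: of_bool_def)
    also have "\<dots> = (\<Sum>i. (1/3) ^ i) * (1/3) ^ Suc n"
      unfolding power_add by (subst suminf_mult2[symmetric]) (auto intro: summable_geometric)
    also have "\<dots> = (1/3) ^ n / 2"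
      by (subst suminf_geometric) simp_all
    also have "\<dots> < (1/3) ^ n" by simp
    finally show ?thesis .
  qed
  have dig: "(1/3) ^ n \<le> ?T n \<longleftrightarrow> b n" for n
    using split[of n] lt[of n] T0[of "Suc n"] by (cases "b n") auto
  have rest: "ternary_rest n (ternary_sum b) = ?T n" for n
  proof (induction n)
    case (Suc n)
    then show ?case using split[of n] dig[of n] by simp
  qed (simp add: ternary_sum_def)
  show ?thesis using rest dig by simp
qed

text \<open>A point is encoded by the bits \<open>near x n k\<close>, which compare its distance to
  the \<open>k\<close>-th point of a dense sequence with \<open>(1/2) ^ n\<close>. The decoder takes
  the least admissible index \<open>c y n\<close> for each \<open>n\<close>; for a code this is a
  Cauchy sequence converging to the encoded point. Since \<open>g\<close> must be Borel on the whole
  line, it returns the default \<open>x0\<close> where decoding fails.\<close>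

lemma polish_borel_embedding:
  fixes M :: "'a measure"
  assumes X: "polish_topology X" and sM: "sets M = sets (borel_of X)" and ne: "space M \<noteq> {}"
  obtains e :: "'a \<Rightarrow> real" and g where "e \<in> borel_measurable M" "g \<in> measurable borel M"
    "\<And>x. x \<in> space M \<Longrightarrow> g (e x) = x"
proof -
  obtain m d where "Metric_space m d" and mc: "Metric_space.mcomplete m d"
    and Xd: "X = Metric_space.mtopology m d"
    using X unfolding polish_topology_def completely_metrizable_space_def by blast
  interpret Metric_space m d by fact
  obtain D where D: "countable D" "D \<subseteq> topspace X" "X closure_of D = topspace X"
    using X unfolding polish_topology_def by blast
  have spM: "space M = m" using sets_eq_imp_space_eq[OF sM] by (simp add: space_borel_of Xd)
  obtain x0 where x0: "x0 \<in> m" using ne spM by blast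
  have dense: "\<exists>y\<in>D. d x y < r" if "x \<in> m" "r > 0" for x r
  proof -
    have "x \<in> X closure_of D" using that D by (simp add: Xd)
    then show ?thesis using that by (auto simp: Xd metric_closure_of in_mball)
  qed
  have "D \<noteq> {}" using dense[OF x0, of 1] by auto
  define q where "q = from_nat_into D"
  have qD: "range q = D" unfolding q_def using D(1) \<open>D \<noteq> {}\<close> by (rule range_from_nat_into[rotated])
  have qm: "q k \<in> m" for k using qD D(2) by (auto simp: Xd)
  define near where "near x n k \<longleftrightarrow> d x (q k) < (1/2) ^ n" for x n k
  define e where "e x = ternary_sum (\<lambda>i. near x (fst (prod_decode i)) (snd (prod_decode i)))" for x
  have [measurable]: "Measurable.pred M (\<lambda>x. near x n k)" for n k
  proof -
    have "{x \<in> space M. near x n k} = mball (q k) ((1/2) ^ n)"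
      using qm by (auto simp: near_def spM in_mball commute)
    moreover have "mball (q k) ((1/2) ^ n) \<in> sets M"
      unfolding sM Xd by (rule openin_borel_of) simp
    ultimately show ?thesis by (simp add: pred_def)
  qed
  have em: "e \<in> borel_measurable M"
    unfolding e_def ternary_sum_def by measurable
  define bit where "bit y n k \<longleftrightarrow> (1/3) ^ prod_encode (n, k) \<le> ternary_rest (prod_encode (n, k)) y"
    for y :: real and n k
  have bite: "bit (e x) n k \<longleftrightarrow> near x n k" for x n k
    unfolding bit_def e_def ternary_digit by simp
  have [measurable]: "Measurable.pred borel (\<lambda>y. bit y n k)" for n k
    unfolding bit_def by measurable
  define c where "c y n = (LEAST k. bit y n k)" for y n
  have c[measurable]: "(\<lambda>y. c y n) \<in> measurable borel (count_space UNIV)" for n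
    unfolding c_def by measurable
  \<comment> \<open>The explicit Cauchy rate makes \<open>Y\<close> a countable intersection of
    conditions on the discrete values \<open>c y n\<close>, hence Borel. Codes satisfy it by the
    triangle inequality through the encoded point.\<close>
  define Y where "Y = {y. \<forall>n k. d (q (c y n)) (q (c y k)) \<le> (1/2) ^ n + (1/2) ^ k}"
  have Y[measurable]: "Y \<in> sets borel" unfolding Y_def by measurable
  have lim: "\<exists>!x. x \<in> m \<and> (\<forall>n. d x (q (c y n)) \<le> (1/2) ^ n)" if "y \<in> Y" for y
  proof -
    let ?p = "\<lambda>n. q (c y n)"
    have le: "d (?p n) (?p k) \<le> (1/2) ^ n + (1/2) ^ k" for n k using that by (simp add: Y_def)
    have small: "\<exists>N. \<forall>n\<ge>N. (1/2 :: real) ^ n < r" if r: "r > 0" for r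
    proof -
      obtain N where N: "(1/2 :: real) ^ N < r" using real_arch_pow_inv[OF r, of "1/2"] by auto
      have "(1/2 :: real) ^ n < r" if "n \<ge> N" for n
        by (rule le_less_trans[OF power_decreasing N]) (use that in auto)
      then show ?thesis by blast
    qed
    have "MCauchy ?p"
      unfolding MCauchy_def
    proof (intro conjI allI impI)
      fix r :: real assume "r > 0"
      then obtain N where N: "\<And>n. n \<ge> N \<Longrightarrow> (1/2 :: real) ^ n < r / 2" using small[of "r/2"] by auto
      show "\<exists>N. \<forall>n n'. N \<le> n \<longrightarrow> N \<le> n' \<longrightarrow> d (?p n) (?p n') < r"
      proof (intro exI allI impI)
        fix n n' assume "N \<le> n" "N \<le> n'"
        then show "d (?p n) (?p n') < r" using le[of n n'] N[of n] N[of n'] by auto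
      qed
    qed (use qm in auto)
    then obtain x where "limitin mtopology ?p x sequentially"
      using mc unfolding mcomplete_def by blast
    then have x: "x \<in> m" "\<And>r. r > 0 \<Longrightarrow> \<exists>N. \<forall>n\<ge>N. d (?p n) x < r"
      by (simp_all add: limit_metric_sequentially) blast
    have dx: "d x (?p n) \<le> (1/2) ^ n" for n
    proof (rule field_le_epsilon)
      fix r :: real assume "r > 0"
      obtain N N' where N: "\<forall>n\<ge>N. d (?p n) x < r / 2" and N': "\<forall>n\<ge>N'. (1/2 :: real) ^ n < r / 2"
        using x(2)[of "r/2"] small[of "r/2"] \<open>r > 0\<close> by auto
      let ?k = "max N N'"
      have "d x (?p n) \<le> d x (?p ?k) + d (?p ?k) (?p n)" using x qm by (intro triangle) auto
      then show "d x (?p n) \<le> (1/2) ^ n + r"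
        using N[rule_format, of ?k] N'[rule_format, of ?k] le[of ?k n] commute[of x "?p ?k"] by auto
    qed
    moreover have "x' = x" if x': "x' \<in> m" "\<forall>n. d x' (?p n) \<le> (1/2) ^ n" for x'
    proof (rule ccontr)
      assume "x' \<noteq> x"
      then have "d x' x > 0" using x x' by simp
      then obtain n where n: "(1/2 :: real) ^ n < d x' x / 2" using small[of "d x' x / 2"] by auto
      have "d x' x \<le> d x' (?p n) + d (?p n) x" using x x' qm by (intro triangle) auto
      then show False using n x'(2)[rule_format, of n] dx[of n] commute[of x "?p n"] by auto
    qed
    ultimately show ?thesis using x(1) by blast
  qed
  define g where "g y = (if y \<in> Y then THE x. x \<in> m \<and> (\<forall>n. d x (q (c y n)) \<le> (1/2) ^ n) else x0)" for y
  have gY: "g y \<in> m" "d (g y) (q (c y n)) \<le> (1/2) ^ n" if "y \<in> Y" for y n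
    using theI'[OF lim[OF that]] that by (auto simp: g_def)
  have gm: "g y \<in> m" for y using gY x0 by (cases "y \<in> Y") (auto simp: g_def)
  have ge: "e x \<in> Y \<and> g (e x) = x" if x: "x \<in> space M" for x
  proof -
    have dx: "d x (q (c (e x) n)) < (1/2) ^ n" for n
    proof -
      have "\<exists>k. bit (e x) n k" using dense[of x "(1/2) ^ n"] x qD by (auto simp: spM bite near_def)
      then have "bit (e x) n (c (e x) n)" unfolding c_def by (rule LeastI_ex)
      then show ?thesis by (simp add: bite near_def)
    qed
    have "d (q (c (e x) n)) (q (c (e x) k)) \<le> (1/2) ^ n + (1/2) ^ k" for n k
    proof -
      have "d (q (c (e x) n)) (q (c (e x) k)) \<le> d (q (c (e x) n)) x + d x (q (c (e x) k))"
        using x qm by (intro triangle) (auto simp: spM)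
      then show ?thesis using dx[of n] dx[of k] commute[of x "q (c (e x) n)"] by auto
    qed
    then have Y: "e x \<in> Y" by (simp add: Y_def)
    moreover have "g (e x) = x"
      using lim[OF Y] Y x dx by (auto simp: g_def spM less_imp_le intro!: the1_equality)
    ultimately show ?thesis by simp
  qed
  \<comment> \<open>Closed sets are tested instead of open ones: \<open>g y\<close> lies in a closed
    \<open>C\<close> iff \<open>C\<close> meets the closed ball of radius \<open>(1/2) ^ n\<close>
    around the \<open>n\<close>-th approximant for every \<open>n\<close>, and this condition
    depends on \<open>c y n\<close> alone.\<close>
  have "g \<in> measurable borel (sigma m {C. closedin X C})"
  proof (rule measurable_measure_of)
    fix C assume C: "C \<in> {C. closedin X C}"
    have Cm: "C \<subseteq> m" using C closedin_subset[of X C] by (auto simp: Xd)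
    have eq: "g y \<in> C \<longleftrightarrow> (\<forall>n. \<exists>x\<in>C. d x (q (c y n)) \<le> (1/2) ^ n)" if y: "y \<in> Y" for y
    proof
      assume R: "\<forall>n. \<exists>x\<in>C. d x (q (c y n)) \<le> (1/2) ^ n"
      have "g y \<in> X closure_of C"
        unfolding Xd metric_closure_of
      proof (safe)
        show "g y \<in> m" by (rule gm)
        fix r :: real assume "r > 0"
        then obtain n where n: "(1/2 :: real) ^ n < r / 2" using real_arch_pow_inv[of "r/2" "1/2"] by auto
        obtain x where x: "x \<in> C" "d x (q (c y n)) \<le> (1/2) ^ n" using R by blast
        have "d (g y) x \<le> d (g y) (q (c y n)) + d (q (c y n)) x"
          using x Cm gm qm by (intro triangle) auto
        then have "d (g y) x < r" using n x(2) gY(2)[OF y, of n] commute[of x] by auto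
        then show "\<exists>x\<in>C. x \<in> mball (g y) r" using x Cm gm by (auto simp: in_mball)
      qed
      then show "g y \<in> C" using C closure_of_closedin by auto
    qed (use gY y in blast)
    have "g -` C \<inter> space borel = (if x0 \<in> C then - Y else {}) \<union>
        {y \<in> Y. \<forall>n. \<exists>x\<in>C. d x (q (c y n)) \<le> (1/2) ^ n}"
    proof (intro Set.set_eqI)
      fix y
      have "g y = x0" if "y \<notin> Y" using that by (simp add: g_def)
      then show "y \<in> g -` C \<inter> space borel \<longleftrightarrow> y \<in> (if x0 \<in> C then - Y else {}) \<union>
          {y \<in> Y. \<forall>n. \<exists>x\<in>C. d x (q (c y n)) \<le> (1/2) ^ n}"
        using eq[of y] by (cases "y \<in> Y") auto
    qed
    also have "\<dots> \<in> sets borel"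
    proof -
      have "(\<lambda>y. c y n) -` {k. \<exists>x\<in>C. d x (q k) \<le> (1/2) ^ n} \<inter> space borel \<in> sets borel" for n
        by (rule measurable_sets[OF c]) simp
      then have "Y \<inter> (\<Inter>n. (\<lambda>y. c y n) -` {k. \<exists>x\<in>C. d x (q k) \<le> (1/2) ^ n}) \<in> sets borel"
        using Y by (intro sets.Int sets.countable_INT'') auto
      moreover have "{y \<in> Y. \<forall>n. \<exists>x\<in>C. d x (q (c y n)) \<le> (1/2) ^ n}
          = Y \<inter> (\<Inter>n. (\<lambda>y. c y n) -` {k. \<exists>x\<in>C. d x (q k) \<le> (1/2) ^ n})" by auto
      ultimately show ?thesis using Y by (auto intro!: sets.Un)
    qed
    finally show "g -` C \<inter> space borel \<in> sets borel" .
  qed (use gm closedin_subset[of X] in \<open>auto simp: Xd\<close>)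
  moreover have "sets (sigma m {C. closedin X C}) = sets M"
  proof -
    have "sigma_sets m {C. closedin X C} = sigma_sets m {U. openin X U}"
    proof (rule sigma_sets_eqI)
      fix U assume "U \<in> {U. openin X U}"
      then have "m - (m - U) \<in> sigma_sets m {C. closedin X C}"
        by (intro sigma_sets.Compl sigma_sets.Basic) (auto simp: Xd)
      moreover have "m - (m - U) = U" using \<open>U \<in> {U. openin X U}\<close> openin_subset[of X U] by (auto simp: Xd)
      ultimately show "U \<in> sigma_sets m {C. closedin X C}" by simp
    next
      fix C assume C: "C \<in> {C. closedin X C}"
      then have "m - (m - C) \<in> sigma_sets m {U. openin X U}"
        by (intro sigma_sets.Compl sigma_sets.Basic) (auto simp: Xd)
      moreover have "m - (m - C) = C" using C closedin_subset[of X C] by (auto simp: Xd)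
      ultimately show "C \<in> sigma_sets m {U. openin X U}" by simp
    qed
    then show ?thesis
      using closedin_subset[of X]
      by (subst sets_measure_of) (auto simp: sM sets_borel_of Xd)
  qed
  ultimately have "g \<in> measurable borel M"
    using measurable_cong_sets[OF refl] by blast
  then show ?thesis using that em ge by blast
qed

abbreviation unit_interval :: "real measure" where
  "unit_interval \<equiv> restrict_space lborel {0<..<1}"

text \<open>Carried to the line by a Borel embedding, \<open>M\<close> becomes a law without point
  masses. Its distribution function \<open>N.C\<close> is continuous, so it transports the law to
  the uniform one, and the quantile function \<open>N.I\<close> inverts it almost
  everywhere.\<close>

lemma mod0_iso_unit_interval:
  assumes std: "standard_prob_space M" and diffuse: "\<And>x. x \<in> space M \<Longrightarrow> emeasure M {x} = 0"
  obtains f g where "mod0_iso M unit_interval f g"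
proof -
  interpret prob_space M using std by (simp add: standard_prob_space_def)
  obtain e :: "'a \<Rightarrow> real" and r where [measurable]: "e \<in> borel_measurable M" "r \<in> measurable borel M"
    and re: "\<And>x. x \<in> space M \<Longrightarrow> r (e x) = x"
    using std polish_borel_embedding[of _ M] not_empty unfolding standard_prob_space_def by metis
  let ?N = "distr M borel e"
  interpret N: cdf_distribution ?N
    unfolding cdf_distribution_def by (rule real_distribution_distr) measurable
  have single: "measure ?N {y} = 0" for y
  proof -
    have "e -` {y} \<inter> space M \<subseteq> {r y} \<inter> space M" using re by auto
    then have "measure M (e -` {y} \<inter> space M) = 0"
    proof (cases "r y \<in> space M")
      case True
      have "{r y} \<in> sets M"
      proof -
        have "{x \<in> space M. e x = e (r y)} \<in> sets M" by measurable
        moreover have "{x \<in> space M. e x = e (r y)} = {r y}"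
          using True by (auto intro: re[symmetric] simp: re) (metis re)
        ultimately show ?thesis by simp
      qed
      then have "emeasure M (e -` {y} \<inter> space M) \<le> emeasure M {r y}"
        using re by (intro emeasure_mono) auto
      then show ?thesis using diffuse[OF True] by (simp add: measure_def)
    qed auto
    then show ?thesis by (simp add: measure_distr)
  qed
  have cont: "isCont N.C x" for x using N.isCont_cdf single by simp
  \<comment> \<open>The inequality \<open>N.C (N.I u) \<le> u\<close> is where continuity enters:
    all values to the left of \<open>N.I u\<close> are below \<open>u\<close>, and so is their
    limit.\<close>
  have CI: "N.C (N.I u) = u" if u: "0 < u" "u < 1" for u
  proof (rule antisym)
    show "u \<le> N.C (N.I u)" using N.pseudoinverse[OF u, of "N.I u"] by simp
    have "N.C x < u" if "x < N.I u" for x using N.pseudoinverse[OF u, of x] that by simp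
    moreover have "(N.C \<longlongrightarrow> N.C (N.I u)) (at_left (N.I u))"
      using cont[of "N.I u"] by (auto simp: continuous_at_imp_continuous_at_within isCont_def
          intro: tendsto_within_subset)
    ultimately show "N.C (N.I u) \<le> u"
      by (intro tendsto_upperbound[where F = "at_left (N.I u)"])
        (auto simp: eventually_at_filter less_imp_le intro!: always_eventually)
  qed
  have [measurable]: "N.I \<in> borel_measurable unit_interval"
    using N.measurable_CI by (simp cong: measurable_cong_sets add: sets_restrict_space)
  have dI: "distr unit_interval borel N.I = ?N" by (rule N.distr_I_eq_M)
  \<comment> \<open>The value 1/2 replaces 0 and 1 so that the map lands in the open interval;
    points in the range of \<open>N.I\<close> are not affected.\<close>
  let ?C = "\<lambda>y. if N.C y \<in> {0<..<1} then N.C y else 1/2"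
  have Cm: "?C \<in> measurable borel unit_interval"
    by (rule measurable_restrict_space2) (auto simp: measurable_lborel2)
  have CI': "?C (N.I u) = u" if "u \<in> space unit_interval" for u
    using that CI by (auto simp: space_restrict_space)
  let ?f = "?C \<circ> e" and ?g = "r \<circ> N.I"
  have dr: "distr ?N M r = M"
  proof -
    have "distr ?N M r = distr M M (r \<circ> e)" by (rule distr_distr) measurable
    also have "\<dots> = distr M M (\<lambda>x. x)" by (rule distr_cong) (auto simp: re)
    finally show ?thesis by simp
  qed
  have dC: "distr ?N unit_interval ?C = unit_interval"
  proof -
    have "distr (distr unit_interval borel N.I) unit_interval ?C
        = distr unit_interval unit_interval (?C \<circ> N.I)"
      by (rule distr_distr) (use Cm in measurable)
    also have "\<dots> = distr unit_interval unit_interval (\<lambda>x. x)"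
      by (rule distr_cong) (simp_all only: comp_apply CI')
    finally show ?thesis unfolding dI by simp
  qed
  have IC: "AE y in ?N. N.I (?C y) = y"
  proof -
    have "AE y in distr unit_interval borel N.I. N.I (?C y) = y"
    proof (subst AE_distr_iff)
      show "{y \<in> space borel. N.I (?C y) = y} \<in> sets borel"
        using measurable_compose[OF Cm \<open>N.I \<in> borel_measurable unit_interval\<close>]
        by measurable
      show "AE u in unit_interval. N.I (?C (N.I u)) = N.I u"
        by (rule AE_I2) (simp only: CI')
    qed measurable
    then show ?thesis unfolding dI .
  qed
  have er: "AE y in ?N. e (r y) = y"
    by (subst AE_distr_iff) (auto simp: re)
  have "mod0_iso M unit_interval ?f ?g"
    unfolding mod0_iso_def
  proof (intro conjI)
    show "?f \<in> measurable M unit_interval"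
      by (rule measurable_comp[OF _ Cm]) measurable
    show "?g \<in> measurable unit_interval M"
      by (rule measurable_comp[where N = borel]) measurable
    show "distr M unit_interval ?f = unit_interval"
      using distr_distr[OF Cm, of e M] dC by simp
    show "distr unit_interval M ?g = M"
      using distr_distr[of r borel M N.I unit_interval] dI dr by simp
    have "AE x in M. N.I (?C (e x)) = e x"
      by (rule AE_distrD[OF _ IC]) measurable
    then show "AE x in M. ?g (?f x) = x"
      using AE_space by eventually_elim (simp add: re)
    have er': "AE y in distr unit_interval borel N.I. e (r y) = y" unfolding dI by (rule er)
    have "AE u in unit_interval. e (r (N.I u)) = N.I u"
      using er' by (rule AE_distrD[rotated]) measurable
    then show "AE u in unit_interval. ?f (?g u) = u"
      using AE_space by eventually_elim (simp only: comp_apply CI')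
  qed
  then show ?thesis by (rule that)
qed

lemma nonatomic_diffuse:
  assumes "standard_prob_space M" "nonatomic M" "x \<in> space M"
  shows "emeasure M {x} = 0"
proof (rule ccontr)
  assume ne: "emeasure M {x} \<noteq> 0"
  then have "{x} \<in> sets M" using emeasure_notin_sets by blast
  moreover have "B = {} \<or> B = {x}" if "B \<subseteq> {x}" for B using that by blast
  ultimately have "atom_of M {x}" using ne unfolding atom_of_def
    by (metis emeasure_empty not_gr_zero)
  then show False using assms by (auto simp: nonatomic_def)
qed

section \<open>Approximation and stabilization\<close>

lemma (in finite_measure) AE_small_exceptions:
  assumes "\<And>\<epsilon>::real. \<epsilon> > 0 \<Longrightarrow> \<exists>S\<in>sets M. measure M S < \<epsilon> \<and> (AE x in M. x \<notin> S \<longrightarrow> P x)"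
  shows "AE x in M. P x"
proof -
  have "\<forall>n. \<exists>S\<in>sets M. measure M S < 1 / real (Suc n) \<and> (AE x in M. x \<notin> S \<longrightarrow> P x)"
    using assms by simp
  then obtain S where S: "\<And>n. S n \<in> sets M" "\<And>n. measure M (S n) < 1 / real (Suc n)"
    "\<And>n. AE x in M. x \<notin> S n \<longrightarrow> P x"
    by metis
  have "measure M (\<Inter>n. S n) \<le> 0"
  proof (rule field_le_epsilon)
    fix \<epsilon> :: real assume "\<epsilon> > 0"
    then obtain n where n: "1 / real (Suc n) < \<epsilon>" using nat_approx_posE by blast
    have "measure M (\<Inter>n. S n) \<le> measure M (S n)" using S(1) by (intro finite_measure_mono) auto
    then show "measure M (\<Inter>n. S n) \<le> 0 + \<epsilon>" using S(2)[of n] n by linarith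
  qed
  then have "(\<Inter>n. S n) \<in> null_sets M"
    using S(1) by (auto simp: null_sets_def emeasure_eq_measure intro!: antisym measure_nonneg)
  then have "AE x in M. x \<notin> (\<Inter>n. S n)" by (rule AE_not_in)
  moreover have "AE x in M. \<forall>n. x \<notin> S n \<longrightarrow> P x" unfolding AE_all_countable using S(3) by blast
  ultimately show ?thesis by eventually_elim auto
qed

lemma (in finite_measure) measure_le_Un_AE:
  assumes "AE x in M. x \<in> A \<longrightarrow> x \<in> B \<or> x \<in> C" "B \<in> sets M" "C \<in> sets M"
  shows "measure M A \<le> measure M B + measure M C"
proof -
  have "measure M A \<le> measure M (B \<union> C)"
    by (rule finite_measure_mono_AE) (use assms in auto)
  also have "\<dots> \<le> measure M B + measure M C" using assms by (intro measure_Un_le) auto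
  finally show ?thesis .
qed

text \<open>Borel-Cantelli in quantitative form: discrete values whose changes have summable
  probabilities are eventually constant almost everywhere. The limit is read off at the first stable
  index, which keeps it measurable for the smaller sigma-algebra \<open>F\<close>; in the
  application \<open>F\<close> is \<open>base\<close>, so limits of cocycles still depend on the
  first coordinates only.\<close>

lemma (in finite_measure) rapidly_stabilizing_limit:
  fixes h :: "nat \<Rightarrow> 'a \<Rightarrow> 'g::countable"
  assumes F: "space F = space M" "sets F \<subseteq> sets M"
    and h: "\<And>n. h n \<in> measurable F (count_space UNIV)"
    and le: "\<And>n. measure M {x \<in> space M. h n x \<noteq> h (Suc n) x} \<le> (1/2) ^ n"
  obtains l where "l \<in> measurable F (count_space UNIV)"
    "\<And>n. measure M {x \<in> space M. h n x \<noteq> l x} \<le> 2 * (1/2) ^ n"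
proof -
  note [measurable] = h
  define st where "st N x \<longleftrightarrow> (\<forall>n\<ge>N. h n x = h N x)" for N x
  have [measurable]: "Measurable.pred F (\<lambda>x. st N x)" for N unfolding st_def by measurable
  define l where "l x = h (LEAST N. st N x) x" for x
  have [measurable]: "(\<lambda>x. LEAST N. st N x) \<in> measurable F (count_space UNIV)" by measurable
  have lm: "l \<in> measurable F (count_space UNIV)"
    unfolding l_def by (rule measurable_compose_countable) (auto intro: h)
  have l: "h n x = l x" if "st n x" for n x
  proof -
    have "st (LEAST N. st N x) x" "(LEAST N. st N x) \<le> n" using that by (auto intro: LeastI Least_le)
    then show ?thesis unfolding l_def by (metis st_def)
  qed
  let ?D = "\<lambda>n. {x \<in> space M. h n x \<noteq> h (Suc n) x}"
  have D: "?D n \<in> sets M" for n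
  proof -
    have "{x \<in> space F. h n x \<noteq> h (Suc n) x} \<in> sets F" by measurable
    then show ?thesis using F by auto
  qed
  have "measure M {x \<in> space M. h n x \<noteq> l x} \<le> 2 * (1/2) ^ n" for n
  proof -
    have sub: "{x \<in> space M. h n x \<noteq> l x} \<subseteq> (\<Union>m. ?D (m + n))"
    proof (rule ccontr)
      assume "\<not> ?thesis"
      then obtain x where x: "x \<in> space M" "h n x \<noteq> l x" "\<And>m. h (m + n) x = h (Suc (m + n)) x" by blast
      have "h (m + n) x = h n x" for m by (induction m) (use x(3) in auto)
      then have "st n x" unfolding st_def by (metis le_add_diff_inverse2)
      with l x(2) show False by blast
    qed
    have sm: "summable (\<lambda>m. measure M (?D (m + n)))"
    proof (rule summable_comparison_test')
      show "summable (\<lambda>m. (1/2 :: real) ^ (m + n))"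
        using summable_geometric[of "1/2 :: real"] by (subst summable_iff_shift) simp
      show "norm (measure M (?D (m + n))) \<le> (1/2) ^ (m + n)" for m using le by simp
    qed
    have "measure M {x \<in> space M. h n x \<noteq> l x} \<le> measure M (\<Union>m. ?D (m + n))"
      using sub D by (intro finite_measure_mono) auto
    also have "\<dots> \<le> (\<Sum>m. measure M (?D (m + n)))"
      using D sm by (intro finite_measure_subadditive_countably) auto
    also have "\<dots> \<le> (\<Sum>m. (1/2) ^ m * (1/2) ^ n)"
    proof (rule suminf_le[OF _ sm])
      show "summable (\<lambda>m. (1/2 :: real) ^ m * (1/2) ^ n)"
        by (intro summable_mult2 summable_geometric) simp
    qed (use le in \<open>simp add: power_add[symmetric]\<close>)
    also have "\<dots> = (\<Sum>m. (1/2) ^ m) * (1/2) ^ n"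
      by (rule suminf_mult2[symmetric]) (auto intro: summable_geometric)
    also have "\<dots> = 2 * (1/2) ^ n" by (subst suminf_geometric) simp_all
    finally show ?thesis .
  qed
  with lm show ?thesis by (rule that)
qed

text \<open>Induction over the generation of \<open>B\<close>. A countable union is first cut to
  finitely many sets, which are then approximated one by one with equal shares of the error.\<close>

lemma (in finite_measure) approximation_by_algebra:
  assumes A: "algebra (space M) \<A>" "\<A> \<subseteq> sets M"
    and B: "B \<in> sigma_sets (space M) \<A>" and e: "\<epsilon> > 0"
  shows "\<exists>C\<in>\<A>. measure M (sym_diff B C) < \<epsilon>"
proof -
  interpret A: algebra "space M" \<A> by fact
  have sub: "sigma_sets (space M) \<A> \<subseteq> sets M" using A(2) by (rule sets.sigma_sets_subset)
  show ?thesis using B e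
  proof (induction arbitrary: \<epsilon>)
    case (Basic a)
    then show ?case by (intro bexI[of _ a]) auto
  next
    case Empty
    then show ?case by (intro bexI[of _ "{}"]) auto
  next
    case (Compl a)
    then obtain C where C: "C \<in> \<A>" "measure M (sym_diff a C) < \<epsilon>" by blast
    have "sym_diff (space M - a) (space M - C) = sym_diff a C"
      using sub Compl(1) A(2) C(1) sets.sets_into_space by blast
    with C show ?case by (intro bexI[of _ "space M - C"]) auto
  next
    case (Union a)
    have a: "a i \<in> sets M" for i using Union(1) sub by blast
    let ?U = "\<Union>i. a i"
    have "(\<lambda>n. measure M (\<Union>i<n. a i)) \<longlonglongrightarrow> measure M (\<Union>n. \<Union>i<n. a i)"
      using a by (intro finite_Lim_measure_incseq) (auto simp: incseq_def, force)
    moreover have "(\<Union>n. \<Union>i<n. a i) = ?U" by auto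
    ultimately have "eventually (\<lambda>n. measure M (\<Union>i<n. a i) > measure M ?U - \<epsilon> / 2) sequentially"
      using Union(3) by (intro order_tendstoD(1)) auto
    then obtain n where n: "measure M (\<Union>i<n. a i) > measure M ?U - \<epsilon> / 2"
      by (auto simp: eventually_sequentially)
    \<comment> \<open>Half of \<epsilon> was spent on the cut. \<open>Suc n\<close> in place of
      \<open>n\<close> keeps the share defined and positive for \<open>n = 0\<close>.\<close>
    have "\<forall>i. \<exists>C\<in>\<A>. measure M (sym_diff (a i) C) < \<epsilon> / (2 * real (Suc n))"
      using Union(2)[of "\<epsilon> / (2 * real (Suc n))"] Union(3) by simp
    then obtain C where C: "\<And>i. C i \<in> \<A>" "\<And>i. measure M (sym_diff (a i) (C i)) < \<epsilon> / (2 * real (Suc n))"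
      by metis
    have CM: "C i \<in> sets M" for i using C A(2) by blast
    have "measure M (sym_diff ?U (\<Union>i<n. C i))
        \<le> measure M ((?U - (\<Union>i<n. a i)) \<union> (\<Union>i<n. sym_diff (a i) (C i)))"
      using a CM by (intro finite_measure_mono) auto
    also have "\<dots> \<le> measure M (?U - (\<Union>i<n. a i)) + measure M (\<Union>i<n. sym_diff (a i) (C i))"
      using a CM by (intro measure_Un_le) auto
    also have "measure M (?U - (\<Union>i<n. a i)) = measure M ?U - measure M (\<Union>i<n. a i)"
      using a by (intro finite_measure_Diff) auto
    also have "measure M (\<Union>i<n. sym_diff (a i) (C i)) \<le> (\<Sum>i<n. measure M (sym_diff (a i) (C i)))"
      using a CM by (intro measure_UNION_le) auto
    also have "\<dots> \<le> (\<Sum>i<n. \<epsilon> / (2 * real (Suc n)))"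
      using C(2) by (intro sum_mono) (simp add: less_imp_le)
    also have "\<dots> = \<epsilon> / 2 * (real n / real (Suc n))" by simp
    also have "\<dots> \<le> \<epsilon> / 2 * 1" using Union(3) by (intro mult_left_mono) auto
    finally have "measure M (sym_diff ?U (\<Union>i<n. C i)) < \<epsilon>" using n by linarith
    then show ?case using C(1) by (intro bexI[of _ "\<Union>i<n. C i"]) auto
  qed
qed

text \<open>On the line, compact sets \<open>K\<close> inside the given set and \<open>L\<close>
  inside its complement carry almost all the mass. A finite union of basic open sets covers
  \<open>K\<close> and avoids \<open>L\<close>, so it can be wrong only on the two small leftovers.
  Such unions form a countable family, which is pulled back along \<open>e\<close>.\<close>

lemma (in finite_measure) separable_measure_algebra:
  fixes e :: "'a \<Rightarrow> real"
  assumes [measurable]: "e \<in> borel_measurable M" and r: "r \<in> measurable borel M"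
    and re: "\<And>x. x \<in> space M \<Longrightarrow> r (e x) = x"
  obtains \<C> where "countable \<C>" "\<C> \<subseteq> sets M"
    "\<And>B \<epsilon>. B \<in> sets M \<Longrightarrow> \<epsilon> > 0 \<Longrightarrow> \<exists>C\<in>\<C>. measure M (sym_diff B C) < \<epsilon>"
proof -
  let ?N = "distr M borel e"
  interpret N: finite_measure ?N by (rule finite_measure_distr) simp
  obtain \<B> :: "real set set" where \<B>: "countable \<B>" "\<And>B. B \<in> \<B> \<Longrightarrow> open B"
    "\<And>U x. open U \<Longrightarrow> x \<in> U \<Longrightarrow> \<exists>B\<in>\<B>. x \<in> B \<and> B \<subseteq> U"
  proof -
    obtain \<B> :: "real set set" where \<B>: "countable \<B>" "topological_basis \<B>"
      using ex_countable_basis by blast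
    show ?thesis
    proof (rule that[OF \<B>(1)])
      show "open B" if "B \<in> \<B>" for B using \<B>(2) that by (rule topological_basis_open)
      show "\<exists>B\<in>\<B>. x \<in> B \<and> B \<subseteq> U" if U: "open U" "x \<in> U" for U x
      proof -
        obtain B where "B \<in> \<B>" "x \<in> B" "B \<subseteq> U" by (rule topological_basisE[OF \<B>(2) U])
        then show ?thesis by blast
      qed
    qed
  qed
  define \<C> where "\<C> = (\<lambda>F. e -` \<Union>F \<inter> space M) ` {F. finite F \<and> F \<subseteq> \<B>}"
  have compact: "\<exists>K. K \<subseteq> B \<and> compact K \<and> measure ?N B < measure ?N K + \<epsilon>"
    if B: "B \<in> sets borel" and e: "\<epsilon> > 0" for B \<epsilon>
  proof (rule ccontr)
    assume "\<not> ?thesis"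
    then have le: "measure ?N K \<le> measure ?N B - \<epsilon>" if "K \<subseteq> B" "compact K" for K using that by force
    have nn: "0 \<le> measure ?N B - \<epsilon>" using le[of "{}"] by simp
    have "emeasure ?N B = (SUP K\<in>{K. K \<subseteq> B \<and> compact K}. emeasure ?N K)"
      by (rule inner_regular) (use B in auto)
    also have "\<dots> \<le> ennreal (measure ?N B - \<epsilon>)"
      using le by (auto intro!: SUP_least ennreal_leI simp: N.emeasure_eq_measure)
    finally show False using e nn by (simp add: N.emeasure_eq_measure)
  qed
  have "\<exists>C\<in>\<C>. measure M (sym_diff B C) < \<epsilon>" if B: "B \<in> sets M" and e: "\<epsilon> > 0" for B \<epsilon>
  proof -
    let ?B = "r -` B"
    have B': "?B \<in> sets borel" using measurable_sets[OF r B] by simp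
    obtain K where K: "K \<subseteq> ?B" "compact K" "measure ?N ?B < measure ?N K + \<epsilon> / 2"
      using compact[OF B', of "\<epsilon>/2"] e by auto
    obtain L where L: "L \<subseteq> - ?B" "compact L" "measure ?N (- ?B) < measure ?N L + \<epsilon> / 2"
      using compact[of "- ?B" "\<epsilon>/2"] B' e by auto
    have KL: "K \<in> sets borel" "L \<in> sets borel" 
      using K(2) L(2) by (simp_all add: borel_compact)
    have "\<forall>x\<in>K. \<exists>V\<in>\<B>. x \<in> V \<and> V \<subseteq> - L"
    proof
      fix x assume "x \<in> K"
      then have "x \<in> - L" using K(1) L(1) by blast
      then show "\<exists>V\<in>\<B>. x \<in> V \<and> V \<subseteq> - L"
        using L(2) by (intro \<B>(3)) (auto simp: compact_imp_closed open_Compl)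
    qed
    then obtain V where V: "\<And>x. x \<in> K \<Longrightarrow> V x \<in> \<B> \<and> x \<in> V x \<and> V x \<subseteq> - L" by metis
    obtain F where F: "F \<subseteq> K" "finite F" "K \<subseteq> (\<Union>x\<in>F. V x)"
    proof (rule compactE_image[OF K(2), of K V])
      show "open (V x)" if "x \<in> K" for x using V[OF that] \<B>(2) by blast
      show "K \<subseteq> (\<Union>x\<in>K. V x)" using V by blast
    qed blast
    let ?U = "\<Union>(V ` F)"
    have VB: "V x \<in> \<B>" "V x \<subseteq> - L" if "x \<in> F" for x using F(1) V that by auto
    have U: "?U \<in> sets borel"
      by (intro borel_open open_UN ballI \<B>(2) VB(1))
    have "?U \<subseteq> - L" using VB(2) by blast
    then have "sym_diff ?B ?U \<subseteq> (?B - K) \<union> (- ?B - L)" using F(3) by blast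
    then have "measure ?N (sym_diff ?B ?U) \<le> measure ?N ((?B - K) \<union> (- ?B - L))"
      using B' KL by (intro N.finite_measure_mono) auto
    also have "\<dots> \<le> measure ?N (?B - K) + measure ?N (- ?B - L)"
      using B' KL by (intro measure_Un_le) auto
    also have "\<dots> = (measure ?N ?B - measure ?N K) + (measure ?N (- ?B) - measure ?N L)"
      using B' KL K(1) L(1) by (simp add: N.finite_measure_Diff)
    also have "\<dots> < \<epsilon>" using K L by linarith
    finally have "measure ?N (sym_diff ?B ?U) < \<epsilon>" .
    moreover have "measure ?N (sym_diff ?B ?U) = measure M (e -` sym_diff ?B ?U \<inter> space M)"
      using B' U by (intro measure_distr) auto
    moreover have "e -` sym_diff ?B ?U \<inter> space M = sym_diff B (e -` ?U \<inter> space M)"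
      using re sets.sets_into_space[OF B] by auto
    moreover have "e -` ?U \<inter> space M \<in> \<C>"
      unfolding \<C>_def by (rule image_eqI[of _ _ "V ` F"]) (use F V in auto)
    ultimately show ?thesis by auto
  qed
  moreover have "countable \<C>"
    unfolding \<C>_def by (intro countable_image countable_Collect_finite_subset \<B>)
  moreover have "\<C> \<subseteq> sets M"
    unfolding \<C>_def using \<B>(2) by (auto intro!: measurable_sets[OF assms(1)] borel_open open_Union)
  ultimately show ?thesis using that by blast
qed

section \<open>Bernoulli actions\<close>

text \<open>The flag in the index is \<open>False\<close> for the first coordinates of the overview
  and \<open>True\<close> for the second ones. The action laws and equivariance hold at every point
  of the space; only \<open>generate\<close> is modulo null sets. The Borel embedding
  \<open>e\<close> with left inverse \<open>r\<close> supplies separability and a countable family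
  of sets separating points.\<close>

locale bernoulli_action = prob_space M
  for M :: "'a measure" +
  fixes act :: "'g::{group_add,countable} \<Rightarrow> 'a \<Rightarrow> 'a"
    and \<xi> :: "'g \<times> bool \<Rightarrow> 'a \<Rightarrow> real"
    and e :: "'a \<Rightarrow> real" and r :: "real \<Rightarrow> 'a"
  assumes infinite_group: "infinite (UNIV :: 'g set)"
    and act_mp: "act \<gamma> \<in> mp_auts M"
    and act_zero: "x \<in> space M \<Longrightarrow> act 0 x = x"
    and act_add: "x \<in> space M \<Longrightarrow> act (\<gamma> + \<delta>) x = act \<gamma> (act \<delta> x)"
    and indep_xi: "indep_vars (\<lambda>_. borel) \<xi> UNIV"
    and distr_xi: "distr M borel (\<xi> i) = uniform_measure lborel {0<..<1}"
    and xi_act: "x \<in> space M \<Longrightarrow> \<xi> (\<delta>, b) (act \<gamma> x) = \<xi> (- \<gamma> + \<delta>, b) x"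
    and generate: "B \<in> sets M \<Longrightarrow>
      \<exists>D\<in>sets (PiM UNIV (\<lambda>_. borel)). AE x in M. x \<in> B \<longleftrightarrow> (\<lambda>i. \<xi> i x) \<in> D"
    and e_measurable [measurable]: "e \<in> borel_measurable M"
    and r_measurable [measurable]: "r \<in> measurable borel M"
    and r_e: "x \<in> space M \<Longrightarrow> r (e x) = x"

section \<open>Transport of the Bernoulli shift from a cube\<close>

abbreviation cube :: "('i \<Rightarrow> real) measure" where
  "cube \<equiv> PiM UNIV (\<lambda>_. uniform_measure lborel {0<..<1})"

lemma prob_space_uniform_unit: "prob_space (uniform_measure lborel {0<..<1::real})"
  by (rule prob_space_uniform_measure) auto

lemma sets_cube: "sets (cube :: ('i::countable \<Rightarrow> real) measure) = sets borel"
proof -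
  have "sets (cube :: ('i \<Rightarrow> real) measure) = sets (PiM UNIV (\<lambda>_. borel))"
    by (rule sets_PiM_cong) auto
  then show ?thesis by (simp add: sets_PiM_equal_borel)
qed

lemma standard_cube: "standard_prob_space (cube :: ('i::countable \<Rightarrow> real) measure)"
  unfolding standard_prob_space_def
proof
  show "prob_space (cube :: ('i \<Rightarrow> real) measure)"
    by (intro prob_space_PiM prob_space_uniform_unit)
  obtain D :: "('i \<Rightarrow> real) set" where D: "countable D" "\<And>X. open X \<Longrightarrow> X \<noteq> {} \<Longrightarrow> \<exists>d\<in>D. d \<in> X"
    by (rule countable_dense_setE) blast
  have "closure D = UNIV"
    using D(2)[of "- closure D"] closure_subset[of D] by (auto simp: open_Compl)
  then have "polish_topology (euclidean :: ('i \<Rightarrow> real) topology)"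
    using D(1) completely_metrizable_space_euclidean by (auto simp: polish_topology_def)
  moreover have "sets (borel_of (euclidean :: ('i \<Rightarrow> real) topology)) = sets borel"
    by (simp add: sets_borel_of borel_def)
  ultimately show "\<exists>X. polish_topology X \<and> sets (cube :: ('i \<Rightarrow> real) measure) = sets (borel_of X)"
    using sets_cube by blast
qed

lemma diffuse_cube: "emeasure (cube :: ('i::countable \<Rightarrow> real) measure) {x} = 0"
proof -
  interpret product_prob_space "\<lambda>_ :: 'i. uniform_measure lborel {0<..<1::real}" UNIV
    by (intro product_prob_spaceI prob_space_uniform_unit)
  fix i :: 'i
  have *: "{y \<in> space cube. y i \<in> {x i}} \<in> sets (cube :: ('i \<Rightarrow> real) measure)"
    by measurable
  have "emeasure cube {x} \<le> emeasure cube {y \<in> space cube. y i \<in> {x i}}"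
    by (rule emeasure_mono[OF _ *]) (auto simp: space_PiM)
  also have "\<dots> = emeasure (uniform_measure lborel {0<..<1}) {x i}"
    by (rule emeasure_PiM_Collect_single) auto
  also have "\<dots> = 0"
    by (subst emeasure_uniform_measure) (auto intro: emeasure_mono[of _ "{x i}" lborel, THEN order_antisym, simplified])
  finally show ?thesis by simp
qed

text \<open>\<open>M\<close> and the cube are both isomorphic modulo null sets to the unit interval,
  so the shift can be carried over. To obtain an honest action, it is transported only on an
  invariant set of full measure where the isomorphism is exact along whole orbits; elsewhere the
  group acts trivially.\<close>

lemma ex_bernoulli_action:
  fixes M :: "'a measure"
  assumes std: "standard_prob_space M" and na: "nonatomic M"
    and inf: "infinite (UNIV :: 'g::{group_add,countable} set)"
  shows "\<exists>(act :: 'g \<Rightarrow> 'a \<Rightarrow> 'a) \<xi> e r. bernoulli_action M act \<xi> e r"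
proof -
  interpret prob_space M using std by (simp add: standard_prob_space_def)
  obtain e :: "'a \<Rightarrow> real" and r where er[measurable]: "e \<in> borel_measurable M" "r \<in> measurable borel M"
    and re: "\<And>x. x \<in> space M \<Longrightarrow> r (e x) = x"
    using std polish_borel_embedding[of _ M] not_empty unfolding standard_prob_space_def by metis
  let ?N = "cube :: ('g \<times> bool \<Rightarrow> real) measure"
  obtain f g where 1: "mod0_iso M unit_interval f g"
    using mod0_iso_unit_interval[OF std] nonatomic_diffuse[OF std na] by blast
  obtain f' g' where 2: "mod0_iso ?N unit_interval f' g'"
    using mod0_iso_unit_interval[OF standard_cube] diffuse_cube by blast
  obtain \<Phi> \<Psi> where iso: "mod0_iso M ?N \<Phi> \<Psi>"
    using mod0_iso_trans[OF 1 mod0_iso_sym[OF 2]] by blast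
  then have \<Phi>[measurable]: "\<Phi> \<in> measurable M ?N" and \<Psi>[measurable]: "\<Psi> \<in> measurable ?N M"
    and d\<Phi>: "distr M ?N \<Phi> = ?N" and d\<Psi>: "distr ?N M \<Psi> = M"
    and ae\<Phi>: "AE x in M. \<Psi> (\<Phi> x) = x" and ae\<Psi>: "AE y in ?N. \<Phi> (\<Psi> y) = y"
    by (auto simp: mod0_iso_def)
  have spN[simp]: "space ?N = UNIV" by (simp add: space_PiM)
  \<comment> \<open>Shifting by the inverse makes this a left action of a possibly noncommutative
    group.\<close>
  define s where "s \<gamma> y = (\<lambda>i. y (- \<gamma> + fst i, snd i))" for \<gamma> :: 'g and y :: "'g \<times> bool \<Rightarrow> real"
  have s0: "s 0 y = y" and sadd: "s (\<gamma> + \<delta>) y = s \<gamma> (s \<delta> y)" for \<gamma> \<delta> y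
    by (simp_all add: s_def fun_eq_iff minus_add add.assoc del: add_uminus_conv_diff)
  have ds: "distr ?N ?N (s \<gamma>) = ?N" for \<gamma>
  proof -
    have "distr ?N ?N (\<lambda>\<omega>. \<lambda>n\<in>UNIV. \<omega> (- \<gamma> + fst n, snd n)) = ?N"
      by (rule distr_PiM_reindex) (auto simp: inj_on_def prod_eq_iff prob_space_uniform_unit)
    then show ?thesis by (simp add: s_def[abs_def] restrict_UNIV)
  qed
  have sm[measurable]: "s \<gamma> \<in> measurable ?N ?N" for \<gamma>
    unfolding s_def[abs_def]
    by (rule measurable_PiM_single') (auto intro: measurable_component_singleton)
  have comp[measurable]: "(\<lambda>y. y i) \<in> borel_measurable ?N" for i
  proof -
    have "measurable ?N (uniform_measure lborel {0<..<1::real}) = borel_measurable ?N"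
      by (rule measurable_cong_sets) auto
    moreover have "(\<lambda>y. y i) \<in> measurable ?N (uniform_measure lborel {0<..<1::real})"
      by (rule measurable_component_singleton) simp
    ultimately show ?thesis by (rule subst)
  qed
  \<comment> \<open>Quantifying over all translates makes \<open>N0\<close> invariant under the
    shift, while countability of the group keeps it of full measure.\<close>
  define N0 where "N0 = {y. \<forall>\<gamma>. \<Phi> (\<Psi> (s \<gamma> y)) = s \<gamma> y}"
  have N0s: "s \<gamma> y \<in> N0" if "y \<in> N0" for \<gamma> y
    using that by (simp add: N0_def sadd[symmetric])
  have N0[measurable]: "N0 \<in> sets ?N"
  proof -
    have "N0 = {y \<in> space ?N. \<forall>\<gamma> i. \<Phi> (\<Psi> (s \<gamma> y)) i = s \<gamma> y i}" by (auto simp: N0_def fun_eq_iff)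
    also have "\<dots> \<in> sets ?N"
    proof (intro sets.sets_Collect_countable_All)
      have "(\<lambda>x. \<Phi> (\<Psi> (s \<gamma> x)) i) \<in> borel_measurable ?N" for \<gamma> i
        by (rule measurable_compose[OF sm measurable_compose[OF \<Psi> measurable_compose[OF \<Phi> comp]]])
      moreover have "(\<lambda>x. s \<gamma> x i) \<in> borel_measurable ?N" for \<gamma> i
        by (rule measurable_compose[OF sm comp])
      ultimately show "{y \<in> space ?N. \<Phi> (\<Psi> (s \<gamma> y)) i = s \<gamma> y i} \<in> sets ?N" for \<gamma> i
        by (rule borel_measurable_eq)
    qed
    finally show ?thesis .
  qed
  have aeN0: "AE y in ?N. y \<in> N0"
    unfolding N0_def using AE_distr_eqD[OF sm ds ae\<Psi>] by (auto simp: AE_all_countable)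
  define M0 where "M0 = {x \<in> space M. \<Psi> (\<Phi> x) = x \<and> \<Phi> x \<in> N0}"
  have M0[measurable]: "M0 \<in> sets M"
  proof -
    \<comment> \<open>The injection \<open>e\<close> turns equality of points of \<open>M\<close>
      into equality of reals, which is visibly a measurable condition.\<close>
    have "\<Psi> (\<Phi> x) = x \<longleftrightarrow> e (\<Psi> (\<Phi> x)) = e x" if "x \<in> space M" for x
      using re that measurable_space[OF \<Phi> that] measurable_space[OF \<Psi>] by (metis)
    then have "M0 = {x \<in> space M. e (\<Psi> (\<Phi> x)) = e x \<and> \<Phi> x \<in> N0}" by (auto simp: M0_def)
    also have "\<dots> \<in> sets M" by measurable
    finally show ?thesis .
  qed
  have aeM0: "AE x in M. x \<in> M0"
    unfolding M0_def using ae\<Phi> AE_distr_eqD[OF \<Phi> d\<Phi> aeN0] by auto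
  define act where "act \<gamma> x = (if x \<in> M0 then \<Psi> (s \<gamma> (\<Phi> x)) else x)" for \<gamma> x
  \<comment> \<open>Outside \<open>M0\<close> the action is trivial, so equivariance forces the
    coordinates to be invariant under index shifts there; a constant achieves this.\<close>
  define \<xi> where "\<xi> i x = (if x \<in> M0 then \<Phi> x i else 0)" for i x
  have actM0: "act \<gamma> x \<in> M0 \<and> \<Phi> (act \<gamma> x) = s \<gamma> (\<Phi> x)" if x: "x \<in> M0" for \<gamma> x
  proof -
    have "\<Phi> (\<Psi> (s \<gamma> (\<Phi> x))) = s \<gamma> (\<Phi> x)" using x by (auto simp: M0_def N0_def)
    moreover have "\<Psi> (s \<gamma> (\<Phi> x)) \<in> space M" by (rule measurable_space[OF \<Psi>]) simp
    moreover have "s \<gamma> (\<Phi> x) \<in> N0" using x N0s by (auto simp: M0_def)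
    ultimately show ?thesis using x by (simp add: act_def) (simp add: M0_def)
  qed
  have act0: "act 0 x = x" for x by (simp add: act_def s0 M0_def)
  have actadd: "act (\<gamma> + \<delta>) x = act \<gamma> (act \<delta> x)" for \<gamma> \<delta> x
    using actM0[of x \<delta>] by (cases "x \<in> M0") (simp_all add: act_def[of "\<gamma> + \<delta>"] act_def[of \<gamma>] sadd,
      simp add: act_def)
  have actm[measurable]: "act \<gamma> \<in> measurable M M" for \<gamma> unfolding act_def by measurable
  have "distr M M (act \<gamma>) = M" for \<gamma>
  proof -
    have "distr M M (act \<gamma>) = distr M M (\<Psi> \<circ> (s \<gamma> \<circ> \<Phi>))"
      by (rule distr_cong_AE) (use aeM0 in \<open>auto simp: act_def\<close>)
    also have "\<dots> = distr (distr M ?N (s \<gamma> \<circ> \<Phi>)) M \<Psi>"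
      by (rule distr_distr[symmetric, OF \<Psi> measurable_comp[OF \<Phi> sm]])
    also have "distr M ?N (s \<gamma> \<circ> \<Phi>) = distr (distr M ?N \<Phi>) ?N (s \<gamma>)"
      by (rule distr_distr[symmetric, OF sm \<Phi>])
    finally show ?thesis by (simp add: d\<Phi> ds d\<Psi>)
  qed
  then have actmp: "act \<gamma> \<in> mp_auts M" for \<gamma>
    using actadd[of "- \<gamma>" \<gamma>] actadd[of \<gamma> "- \<gamma>"] act0
    by (intro mp_autsI(1)[where g = "act (- \<gamma>)"]) auto
  have xim[measurable]: "\<xi> i \<in> borel_measurable M" for i
  proof -
    have "(\<lambda>x. \<Phi> x i) \<in> borel_measurable M" by (rule measurable_compose[OF \<Phi> comp])
    then show ?thesis unfolding \<xi>_def by measurable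
  qed
  have ae\<xi>: "AE x in M. (\<lambda>i. \<xi> i x) = \<Phi> x" using aeM0 by (auto simp: \<xi>_def)
  have setsPi: "sets (PiM UNIV (\<lambda>_. borel)) = sets ?N" by (rule sets_PiM_cong) auto
  have \<xi>Pi: "(\<lambda>x i. \<xi> i x) \<in> measurable M ?N"
    by (rule measurable_PiM_single') auto
  have ae\<xi>1: "AE x in M. \<xi> i x = \<Phi> x i" for i using ae\<xi> by eventually_elim metis
  have d\<xi>: "distr M borel (\<xi> i) = uniform_measure lborel {0<..<1}" for i
  proof -
    have "distr M borel (\<xi> i) = distr M borel ((\<lambda>y. y i) \<circ> \<Phi>)"
      by (rule distr_cong_AE) (use ae\<xi>1 measurable_comp[OF \<Phi> comp] in auto)
    also have "\<dots> = distr ?N borel (\<lambda>y. y i)"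
      by (subst distr_distr[symmetric, OF comp \<Phi>]) (simp add: d\<Phi>)
    also have "\<dots> = distr ?N (uniform_measure lborel {0<..<1}) (\<lambda>y. y i)"
      by (rule distr_cong) auto
    also have "\<dots> = uniform_measure lborel {0<..<1}"
      by (rule distr_PiM_component) (auto simp: prob_space_uniform_unit)
    finally show ?thesis .
  qed
  have "distr M (PiM UNIV (\<lambda>_. borel)) (\<lambda>x. \<lambda>i\<in>UNIV. \<xi> i x) = PiM UNIV (\<lambda>i. distr M borel (\<xi> i))"
  proof -
    have "distr M (PiM UNIV (\<lambda>_. borel)) (\<lambda>x. \<lambda>i\<in>UNIV. \<xi> i x) = distr M ?N \<Phi>"
      using ae\<xi> \<xi>Pi \<Phi> measurable_cong_sets[OF refl[of "sets M"] setsPi]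
      by (intro distr_cong_AE) (auto simp: setsPi restrict_UNIV)
    then show ?thesis by (simp add: d\<Phi> d\<xi>)
  qed
  then have ind: "indep_vars (\<lambda>_. borel) \<xi> UNIV"
    by (subst indep_vars_iff_distr_eq_PiM) auto
  have "bernoulli_action M act \<xi> e r"
  proof (unfold_locales)
    show "\<xi> (\<delta>, b) (act \<gamma> x) = \<xi> (- \<gamma> + \<delta>, b) x" for \<gamma> \<delta> b x
      using actM0[of x \<gamma>] by (cases "x \<in> M0") (simp add: \<xi>_def s_def, simp add: \<xi>_def act_def)
    fix B assume B: "B \<in> sets M"
    have "\<Psi> -` B \<in> sets ?N" using measurable_sets[OF \<Psi> B] by simp
    moreover have "AE x in M. x \<in> B \<longleftrightarrow> (\<lambda>i. \<xi> i x) \<in> \<Psi> -` B"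
      using ae\<xi> ae\<Phi> by eventually_elim auto
    ultimately show "\<exists>D\<in>sets (PiM UNIV (\<lambda>_. borel)). AE x in M. x \<in> B \<longleftrightarrow> (\<lambda>i. \<xi> i x) \<in> D"
      unfolding setsPi by blast
  qed (use inf actmp act0 actadd ind d\<xi> re in auto)
  then show ?thesis by blast
qed

section \<open>Cylinder sets, independence and the marker\<close>

context bernoulli_action
begin

lemma xi_measurable [measurable]: "\<xi> i \<in> borel_measurable M"
  using indep_xi unfolding indep_vars_def by blast

text \<open>The sigma-algebra generated by the coordinates in \<open>I\<close>, without completion;
  \<open>generate\<close> compares \<open>M\<close> with \<open>cyl UNIV\<close> up to null sets
  only.\<close>

definition cyl :: "('g \<times> bool) set \<Rightarrow> 'a measure" where
  "cyl I = vimage_algebra (space M) (\<lambda>x. restrict (\<lambda>i. \<xi> i x) I) (PiM I (\<lambda>_. borel))"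

lemma space_cyl [simp]: "space (cyl I) = space M"
  by (simp add: cyl_def)

lemma restrict_xi_measurable: "(\<lambda>x. restrict (\<lambda>i. \<xi> i x) I) \<in> measurable M (PiM I (\<lambda>_. borel))"
  by (rule measurable_restrict) simp

lemma sets_cyl:
  "B \<in> sets (cyl I) \<longleftrightarrow>
     (\<exists>D\<in>sets (PiM I (\<lambda>_. borel)). B = (\<lambda>x. restrict (\<lambda>i. \<xi> i x) I) -` D \<inter> space M)"
  unfolding cyl_def by (subst sets_vimage_algebra2) (auto simp: space_PiM)

lemma cyl_subset: "sets (cyl I) \<subseteq> sets M"
  using measurable_sets[OF restrict_xi_measurable] by (auto simp: sets_cyl)

lemma xi_measurable_cyl: "i \<in> I \<Longrightarrow> \<xi> i \<in> borel_measurable (cyl I)"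
proof -
  assume i: "i \<in> I"
  have "(\<lambda>x. restrict (\<lambda>i. \<xi> i x) I) \<in> measurable (cyl I) (PiM I (\<lambda>_. borel))"
    unfolding cyl_def by (rule measurable_vimage_algebra1) (auto simp: space_PiM)
  from measurable_compose[OF this measurable_component_singleton[OF i]] show ?thesis
    using i by simp
qed

lemma measurable_cyl_I:
  assumes "f \<in> space N \<rightarrow> space M" "\<And>i. i \<in> I \<Longrightarrow> (\<lambda>x. \<xi> i (f x)) \<in> borel_measurable N"
  shows "f \<in> measurable N (cyl I)"
  unfolding cyl_def
  by (rule measurable_vimage_algebra2) (use assms in \<open>auto intro!: measurable_restrict\<close>)

lemma cyl_mono: "I \<subseteq> J \<Longrightarrow> sets (cyl I) \<subseteq> sets (cyl J)"
proof
  fix B assume IJ: "I \<subseteq> J" and B: "B \<in> sets (cyl I)"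
  have "(\<lambda>x. x) \<in> measurable (cyl J) (cyl I)"
    by (rule measurable_cyl_I) (use IJ in \<open>auto intro: xi_measurable_cyl\<close>)
  from measurable_sets[OF this B] show "B \<in> sets (cyl J)"
    using sets.sets_into_space[OF B] by (simp add: Int_absorb2)
qed

lemma act_measurable [measurable]: "act \<gamma> \<in> measurable M M"
  using act_mp[of \<gamma>] by (simp add: mp_auts_def)

lemma act_space: "x \<in> space M \<Longrightarrow> act \<gamma> x \<in> space M"
  using measurable_space[OF act_measurable] .

lemma act_measurable_cyl:
  "act \<gamma> \<in> measurable (cyl ((\<lambda>(\<delta>, b). (- \<gamma> + \<delta>, b)) ` I)) (cyl I)"
proof (rule measurable_cyl_I)
  let ?J = "(\<lambda>(\<delta>, b). (- \<gamma> + \<delta>, b)) ` I"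
  fix i assume i: "i \<in> I"
  obtain \<delta> b where ib: "i = (\<delta>, b)" by (cases i)
  have "(- \<gamma> + \<delta>, b) \<in> ?J" using i ib by force
  then have "\<xi> (- \<gamma> + \<delta>, b) \<in> borel_measurable (cyl ?J)" by (rule xi_measurable_cyl)
  then show "(\<lambda>x. \<xi> i (act \<gamma> x)) \<in> borel_measurable (cyl ?J)"
    by (rule measurable_cong[THEN iffD1, rotated]) (simp add: ib xi_act)
qed (simp add: act_space)

lemma cyl_indep:
  assumes "I \<inter> J = {}" "B \<in> sets (cyl I)" "C \<in> sets (cyl J)"
  shows "prob (B \<inter> C) = prob B * prob C"
proof -
  have "indep_var (PiM I (\<lambda>_. borel)) (\<lambda>x. restrict (\<lambda>i. \<xi> i x) I)
      (PiM J (\<lambda>_. borel)) (\<lambda>x. restrict (\<lambda>i. \<xi> i x) J)"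
    by (rule indep_var_restrict[OF indep_xi assms(1)]) auto
  from indep_varD[OF this] show ?thesis
    using assms(2,3) unfolding sets_cyl
    by (auto simp: vimage_def Int_def conj_ac)
qed

lemma prob_xi:
  assumes "S \<in> sets borel"
  shows "prob {x \<in> space M. \<xi> i x \<in> S} = measure lborel ({0<..<1} \<inter> S)"
proof -
  have "prob {x \<in> space M. \<xi> i x \<in> S} = measure (distr M borel (\<xi> i)) S"
    using assms by (subst measure_distr) (auto simp: vimage_def Int_def conj_commute)
  also have "\<dots> = measure lborel ({0<..<1} \<inter> S)"
    unfolding distr_xi using assms by (subst measure_uniform_measure) auto
  finally show ?thesis .
qed

definition base :: "'a measure" where
  "base = cyl (UNIV \<times> {False})"

text \<open>This is the set \<open>A\<close> of the overview. Its preimage under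
  \<open>act \<gamma>\<close> depends only on the second coordinate at \<open>- \<gamma>\<close>, so
  different group elements give independent preimages.\<close>

definition marker :: "'a set" where
  "marker = {x \<in> space M. \<xi> (0, True) x < 1/2}"

lemma space_base [simp]: "space base = space M"
  by (simp add: base_def)

lemma base_subset: "sets base \<subseteq> sets M"
  unfolding base_def by (rule cyl_subset)

lemma measurable_base_M: "f \<in> measurable base N \<Longrightarrow> f \<in> measurable M N"
  using base_subset by (auto simp: measurable_def)

lemma marker_sets [measurable]: "marker \<in> sets M"
  unfolding marker_def by measurable

lemma act_measurable_base: "act \<gamma> \<in> measurable base base"
proof -
  have "(\<lambda>(\<delta>, b). (- \<gamma> + \<delta>, b)) ` (UNIV \<times> {False}) = UNIV \<times> {False}"
  proof (safe)
    fix \<delta>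
    have "(\<delta>, False) = (\<lambda>(\<delta>, b). (- \<gamma> + \<delta>, b)) (\<gamma> + \<delta>, False)" by (simp add: add.assoc[symmetric])
    then show "(\<delta>, False) \<in> (\<lambda>(\<delta>, b). (- \<gamma> + \<delta>, b)) ` (UNIV \<times> {False})" by (rule image_eqI) simp
  qed auto
  then show ?thesis using act_measurable_cyl[of \<gamma> "UNIV \<times> {False}"] by (simp add: base_def)
qed

lemma act_random_measurable:
  assumes "h \<in> measurable M (count_space UNIV)"
  shows "(\<lambda>x. act (h x) x) \<in> measurable M M"
  using assms by (rule measurable_compose_countable[rotated]) simp

lemma act_random_measurable_base:
  assumes "h \<in> measurable base (count_space UNIV)"
  shows "(\<lambda>x. act (h x) x) \<in> measurable base base"
  using assms by (rule measurable_compose_countable[rotated]) (rule act_measurable_base)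

lemma act_marker:
  "x \<in> space M \<Longrightarrow> act \<gamma> x \<in> marker \<longleftrightarrow> \<xi> (- \<gamma>, True) x < 1/2"
  by (simp add: marker_def act_space xi_act)

text \<open>Two independent events of probability 1/2 have a symmetric difference of probability
  1/2, and this difference is independent of \<open>E\<close>, which depends on the first
  coordinates only. Extended measures allow summation over a countable partition afterwards.\<close>

lemma prob_marker_xor:
  assumes "\<gamma> \<noteq> \<delta>" "E \<in> sets base"
  shows "emeasure M E = 2 * emeasure M {x \<in> E. (act \<gamma> x \<in> marker) \<noteq> (act \<delta> x \<in> marker)}"
proof -
  let ?P = "\<lambda>\<gamma>. {x \<in> space M. \<xi> (- \<gamma>, True) x \<in> {..<1/2}}"
  have PM: "?P \<gamma> \<in> sets M" for \<gamma> by measurable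
  have P: "?P \<gamma> \<in> sets (cyl {(- \<gamma>, True)})" for \<gamma>
    using measurable_sets[OF xi_measurable_cyl[of "(- \<gamma>, True)" "{(- \<gamma>, True)}"], of "{..<1/2}"]
    by (simp add: vimage_def Int_def conj_commute)
  have half: "prob (?P \<gamma>) = 1/2" for \<gamma>
  proof -
    have "{0<..<1::real} \<inter> {..<1/2} = {0<..<1/2}" by auto
    then show ?thesis by (subst prob_xi) simp_all
  qed
  have "prob (?P \<gamma> \<inter> ?P \<delta>) = prob (?P \<gamma>) * prob (?P \<delta>)"
    by (rule cyl_indep[OF _ P P]) (use assms in auto)
  then have quarter: "prob (?P \<gamma> \<inter> ?P \<delta>) = 1/4" by (simp only: half)
  let ?X = "sym_diff (?P \<gamma>) (?P \<delta>)"
  have "?P \<epsilon> \<in> sets (cyl {(- \<gamma>, True), (- \<delta>, True)})" if "\<epsilon> = \<gamma> \<or> \<epsilon> = \<delta>" for \<epsilon>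
    using P[of \<epsilon>] cyl_mono[of "{(- \<epsilon>, True)}" "{(- \<gamma>, True), (- \<delta>, True)}"] that by auto
  then have X: "?X \<in> sets (cyl {(- \<gamma>, True), (- \<delta>, True)})" by auto
  have "prob ?X = prob (?P \<gamma> - ?P \<delta>) + prob (?P \<delta> - ?P \<gamma>)"
    using PM by (intro finite_measure_Union) auto
  also have "\<dots> = (prob (?P \<gamma>) - prob (?P \<gamma> \<inter> ?P \<delta>)) + (prob (?P \<delta>) - prob (?P \<delta> \<inter> ?P \<gamma>))"
    using PM by (simp only: finite_measure_Diff')
  also have "\<dots> = 1/2" using quarter by (simp only: half Int_commute[of "?P \<delta>"])
  finally have X2: "prob ?X = 1/2" .
  have "prob (E \<inter> ?X) = prob E * prob ?X"
    using assms(2) X unfolding base_def by (intro cyl_indep) auto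
  also have "E \<inter> ?X = {x \<in> E. (act \<gamma> x \<in> marker) \<noteq> (act \<delta> x \<in> marker)}"
    using sets.sets_into_space[OF assms(2)] by (auto simp: act_marker subset_iff)
  finally show ?thesis using X2 by (simp add: emeasure_eq_measure ennreal_mult'[symmetric] flip: ennreal_numeral)
qed

text \<open>The set where \<open>h\<close> and \<open>k\<close> differ is split according to the
  pair of their values. On each piece both maps are fixed group elements and the piece lies in
  \<open>base\<close>, so \<open>prob_marker_xor\<close> applies.\<close>

lemma prob_cocycle_neq:
  assumes h: "h \<in> measurable base (count_space UNIV)" and k: "k \<in> measurable base (count_space UNIV)"
  shows "prob {x \<in> space M. h x \<noteq> k x}
    = 2 * prob {x \<in> space M. (act (h x) x \<in> marker) \<noteq> (act (k x) x \<in> marker)}"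
proof -
  let ?I = "{p :: 'g \<times> 'g. fst p \<noteq> snd p}"
  let ?E = "\<lambda>p. {x \<in> space M. h x = fst p \<and> k x = snd p}"
  let ?X = "\<lambda>p. {x \<in> ?E p. (act (fst p) x \<in> marker) \<noteq> (act (snd p) x \<in> marker)}"
  have E: "?E p \<in> sets base" for p
  proof -
    note [measurable] = h k
    have "{x \<in> space base. h x = fst p \<and> k x = snd p} \<in> sets base" by measurable
    then show ?thesis by simp
  qed
  have EM: "?E p \<in> sets M" for p using E base_subset by blast
  have XM: "?X p \<in> sets M" for p
  proof -
    have "{x \<in> space M. (act (fst p) x \<in> marker) \<noteq> (act (snd p) x \<in> marker)} \<in> sets M" by measurable
    from sets.Int[OF EM[of p] this] show ?thesis by (rule back_subst[of "\<lambda>S. S \<in> sets M"]) auto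
  qed
  have "emeasure M {x \<in> space M. h x \<noteq> k x} = emeasure M (\<Union>p\<in>?I. ?E p)"
    by (rule arg_cong[where f = "emeasure M"]) auto
  also have "\<dots> = (\<integral>\<^sup>+p. emeasure M (?E p) \<partial>count_space ?I)"
    by (rule emeasure_UN_countable) (use EM in \<open>auto simp: disjoint_family_on_def\<close>)
  also have "\<dots> = (\<integral>\<^sup>+p. 2 * emeasure M (?X p) \<partial>count_space ?I)"
    by (rule nn_integral_cong) (use prob_marker_xor[OF _ E] in auto)
  also have "\<dots> = 2 * (\<integral>\<^sup>+p. emeasure M (?X p) \<partial>count_space ?I)"
    by (rule nn_integral_cmult) simp
  also have "(\<integral>\<^sup>+p. emeasure M (?X p) \<partial>count_space ?I) = emeasure M (\<Union>p\<in>?I. ?X p)"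
    by (rule emeasure_UN_countable[symmetric]) (use XM in \<open>auto simp: disjoint_family_on_def\<close>)
  also have "(\<Union>p\<in>?I. ?X p) = {x \<in> space M. (act (h x) x \<in> marker) \<noteq> (act (k x) x \<in> marker)}"
    by auto
  finally show ?thesis
    by (simp add: emeasure_eq_measure ennreal_mult'[symmetric] flip: ennreal_numeral)
qed

end

section \<open>The closed subgroup\<close>

lemma mp_autsD:
  assumes "f \<in> mp_auts M"
  shows "f \<in> measurable M M" "inv_into (space M) f \<in> measurable M M" "distr M M f = M"
    "x \<in> space M \<Longrightarrow> f x \<in> space M" "x \<in> space M \<Longrightarrow> inv_into (space M) f x \<in> space M"
    "x \<in> space M \<Longrightarrow> inv_into (space M) f (f x) = x" "x \<in> space M \<Longrightarrow> f (inv_into (space M) f x) = x"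
proof -
  show f: "f \<in> measurable M M" "inv_into (space M) f \<in> measurable M M" "distr M M f = M"
    using assms by (auto simp: mp_auts_def)
  have b: "bij_betw f (space M) (space M)" using assms by (simp add: mp_auts_def)
  show "x \<in> space M \<Longrightarrow> f x \<in> space M" "x \<in> space M \<Longrightarrow> inv_into (space M) f x \<in> space M"
    using measurable_space[OF f(1)] measurable_space[OF f(2)] by auto
  show "x \<in> space M \<Longrightarrow> inv_into (space M) f (f x) = x" "x \<in> space M \<Longrightarrow> f (inv_into (space M) f x) = x"
    using b by (simp_all add: bij_betw_inv_into_left bij_betw_inv_into_right)
qed

lemma mp_auts_image_eq:
  assumes "f \<in> mp_auts M" "B \<subseteq> space M"
  shows "f ` B = {x \<in> space M. inv_into (space M) f x \<in> B}"
proof (intro Set.set_eqI iffI)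
  fix y assume "y \<in> {x \<in> space M. inv_into (space M) f x \<in> B}"
  then show "y \<in> f ` B" using mp_autsD(7)[OF assms(1), of y] by (auto intro!: image_eqI)
qed (use assms mp_autsD(4,6)[OF assms(1)] in auto)

lemma mp_auts_inv_inv:
  assumes "f \<in> mp_auts M" "x \<in> space M"
  shows "inv_into (space M) (inv_into (space M) f) x = f x"
  using mp_autsI(2)[of "inv_into (space M) f" M f x] mp_autsD[OF assms(1)]
    mp_autsD(3)[OF mp_auts_inv[OF assms(1)]] assms(2) by auto

lemma mp_auts_inv_comp:
  assumes "f \<in> mp_auts M" "g \<in> mp_auts M" "x \<in> space M"
  shows "inv_into (space M) (f \<circ> g) x = inv_into (space M) g (inv_into (space M) f x)"
proof -
  note f = mp_autsD[OF assms(1)] and g = mp_autsD[OF assms(2)]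
  have fg: "distr M M (f \<circ> g) = M"
    using mp_autsD(3)[OF mp_auts_comp[OF assms(1,2)]] .
  have "inv_into (space M) (f \<circ> g) x = (inv_into (space M) g \<circ> inv_into (space M) f) x"
    by (rule mp_autsI(2)[OF measurable_comp[OF g(1) f(1)] fg measurable_comp[OF f(2) g(2)] _ _ assms(3)])
      (use f g in auto)
  then show ?thesis by simp
qed

lemma mp_auts_inv_AE:
  assumes "f \<in> mp_auts M" "g \<in> mp_auts M" "AE x in M. f x = g x"
  shows "AE x in M. inv_into (space M) f x = inv_into (space M) g x"
proof -
  have "AE x in M. f (inv_into (space M) g x) = g (inv_into (space M) g x)"
    by (rule mp_auts_AE[OF mp_auts_inv[OF assms(2)] assms(3)])
  then show ?thesis
    using AE_space
  proof eventually_elim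
    case (elim x)
    then have "f (inv_into (space M) g x) = x" using mp_autsD(7)[OF assms(2)] by simp
    then show ?case
      using mp_autsD(6)[OF assms(1), of "inv_into (space M) g x"] mp_autsD(5)[OF assms(2)] elim by simp
  qed
qed

lemma mp_auts_measure:
  assumes "f \<in> mp_auts M" "B \<in> sets M"
  shows "measure M {x \<in> space M. f x \<in> B} = measure M B"
proof -
  have "measure M B = measure (distr M M f) B" using mp_autsD(3)[OF assms(1)] by simp
  also have "\<dots> = measure M {x \<in> space M. f x \<in> B}"
    using assms mp_autsD(1)[OF assms(1)] by (subst measure_distr) (auto simp: vimage_def Int_def conj_commute)
  finally show ?thesis by simp
qed

lemma mp_auts_image_sym_diff:
  assumes f: "f \<in> mp_auts M" and BC: "B \<in> sets M" "C \<in> sets M"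
  shows "measure M (sym_diff (f ` B) (f ` C)) = measure M (sym_diff B C)"
proof -
  have sub: "B \<subseteq> space M" "C \<subseteq> space M" using BC sets.sets_into_space by auto
  have "sym_diff (f ` B) (f ` C) = f ` sym_diff B C"
  proof -
    have "sym_diff B C \<subseteq> space M" using sub by blast
    note eq = mp_auts_image_eq[OF f sub(1)] mp_auts_image_eq[OF f sub(2)] mp_auts_image_eq[OF f this]
    show ?thesis unfolding eq by auto
  qed
  then show ?thesis
    using mp_auts_image(2)[OF f, of "sym_diff B C"] BC by (simp add: measure_def)
qed

section \<open>Cocycles over the first coordinates and the uniform metric\<close>

context bernoulli_action
begin

definition cocycle :: "('a \<Rightarrow> 'g) \<Rightarrow> ('a \<Rightarrow> 'a) \<Rightarrow> bool" where
  "cocycle h f \<longleftrightarrow> h \<in> measurable base (count_space UNIV) \<and> (AE x in M. f x = act (h x) x)"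

text \<open>A cocycle for the inverse is required as well, which makes the set closed under
  inverses. It is also the cocycle that \<open>marker\<close> detects, because an image under
  \<open>f\<close> is a preimage under the inverse of \<open>f\<close>.\<close>

definition cauts :: "('a \<Rightarrow> 'a) set" where
  "cauts = {f \<in> mp_auts M. (\<exists>h. cocycle h f) \<and> (\<exists>k. cocycle k (inv_into (space M) f))}"

abbreviation inverse_map :: "('a \<Rightarrow> 'a) \<Rightarrow> 'a \<Rightarrow> 'a" where
  "inverse_map f \<equiv> inv_into (space M) f"

lemma cautsE:
  assumes "f \<in> cauts"
  obtains h k where "f \<in> mp_auts M" "cocycle h f" "cocycle k (inverse_map f)"
  using assms unfolding cauts_def by blast

lemma cauts_mp: "f \<in> cauts \<Longrightarrow> f \<in> mp_auts M"
  by (simp add: cauts_def)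

lemma cocycle_AE: "cocycle h f \<Longrightarrow> AE x in M. f x = g x \<Longrightarrow> cocycle h g"
  unfolding cocycle_def by (auto elim: eventually_elim2)

lemma cocycle_measurable: "cocycle h f \<Longrightarrow> h \<in> measurable base (count_space UNIV)"
  "cocycle h f \<Longrightarrow> h \<in> measurable M (count_space UNIV)"
  using measurable_base_M by (auto simp: cocycle_def)

text \<open>The chain rule for cocycles. The result is again measurable over \<open>base\<close>
  because moving a point by a cocycle over \<open>base\<close> is a measurable map from
  \<open>base\<close> to itself.\<close>

lemma cocycle_comp:
  assumes f: "cocycle h f" and g: "cocycle k g" "g \<in> mp_auts M"
  shows "cocycle (\<lambda>x. h (act (k x) x) + k x) (f \<circ> g)"
  unfolding cocycle_def
proof
  have h: "h \<in> measurable base (count_space UNIV)" and k: "k \<in> measurable base (count_space UNIV)"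
    using f g by (auto simp: cocycle_def)
  have "(\<lambda>x. h (act (k x) x)) \<in> measurable base (count_space UNIV)"
    using act_random_measurable_base[OF k] h by (rule measurable_compose)
  then show "(\<lambda>x. h (act (k x) x) + k x) \<in> measurable base (count_space UNIV)"
    using k by measurable
  have "AE x in M. f (g x) = act (h (g x)) (g x)" "AE x in M. g x = act (k x) x"
    using mp_auts_AE[OF g(2), of "\<lambda>x. f x = act (h x) x"] f g(1) by (auto simp: cocycle_def)
  then show "AE x in M. (f \<circ> g) x = act (h (act (k x) x) + k x) x"
    using AE_space by eventually_elim (simp add: act_add)
qed

lemma cocycle_0: "cocycle (\<lambda>_. 0) id"
  by (auto simp: cocycle_def act_zero)

lemma cauts_id: "id \<in> cauts"
proof -
  have "AE x in M. id x = inverse_map id x"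
    using AE_space by eventually_elim (simp add: mp_autsD(6)[OF mp_auts_id, simplified])
  then show ?thesis
    unfolding cauts_def using cocycle_0 cocycle_AE[OF cocycle_0] mp_auts_id by blast
qed

lemma cauts_inv: "f \<in> cauts \<Longrightarrow> inverse_map f \<in> cauts"
proof (erule cautsE)
  fix h k assume hk: "f \<in> mp_auts M" "cocycle h f" "cocycle k (inverse_map f)"
  have "cocycle h (inverse_map (inverse_map f))"
    using hk(2) by (rule cocycle_AE) (use AE_space in \<open>eventually_elim, simp add: mp_auts_inv_inv hk(1)\<close>)
  then show "inverse_map f \<in> cauts" using hk mp_auts_inv by (auto simp: cauts_def)
qed

lemma cocycle_inverse_comp:
  assumes "f \<in> mp_auts M" "g \<in> mp_auts M" "cocycle k (inverse_map f)" "cocycle l (inverse_map g)"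
  shows "cocycle (\<lambda>x. l (act (k x) x) + k x) (inverse_map (f \<circ> g))"
  using cocycle_comp[OF assms(4,3) mp_auts_inv[OF assms(1)]]
  by (rule cocycle_AE) (use AE_space in \<open>eventually_elim, simp add: mp_auts_inv_comp assms\<close>)

lemma cauts_comp: "f \<in> cauts \<Longrightarrow> g \<in> cauts \<Longrightarrow> f \<circ> g \<in> cauts"
  by (elim cautsE, unfold cauts_def)
    (blast intro: mp_auts_comp cocycle_comp cocycle_inverse_comp)

text \<open>On \<open>cauts\<close> this is half the uniform distance of the inverses, by
  \<open>cocycle_marker_dist\<close>; \<open>marker_dist_inv\<close> removes the distinction between
  a map and its inverse.\<close>

definition marker_dist :: "('a \<Rightarrow> 'a) \<Rightarrow> ('a \<Rightarrow> 'a) \<Rightarrow> real" where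
  "marker_dist f g = measure M (sym_diff (f ` marker) (g ` marker))"

lemma marker_dist_commute: "marker_dist f g = marker_dist g f"
  by (simp add: marker_dist_def Un_commute)

lemma cocycle_neq_sets [measurable]:
  assumes "h \<in> measurable M (count_space UNIV)" "k \<in> measurable M (count_space (UNIV :: 'g set))"
  shows "{x \<in> space M. h x \<noteq> k x} \<in> sets M"
  using assms by measurable

lemma cocycle_marker_dist:
  assumes "f \<in> mp_auts M" "g \<in> mp_auts M" "cocycle k (inverse_map f)" "cocycle l (inverse_map g)"
  shows "prob {x \<in> space M. k x \<noteq> l x} = 2 * marker_dist f g"
proof -
  have k[measurable]: "k \<in> measurable M (count_space UNIV)" "l \<in> measurable M (count_space UNIV)"
    using assms(3,4) by (auto dest: cocycle_measurable)
  have [measurable]: "(\<lambda>x. act (k x) x) \<in> measurable M M" "(\<lambda>x. act (l x) x) \<in> measurable M M"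
    by (auto intro: act_random_measurable k)
  have ms: "marker \<subseteq> space M" by (auto simp: marker_def)
  have "AE x in M. inverse_map f x = act (k x) x" "AE x in M. inverse_map g x = act (l x) x"
    using assms(3,4) by (auto simp: cocycle_def)
  then have "AE x in M. x \<in> sym_diff (f ` marker) (g ` marker) \<longleftrightarrow>
      x \<in> {x \<in> space M. (act (k x) x \<in> marker) \<noteq> (act (l x) x \<in> marker)}"
    using AE_space
    by eventually_elim (auto simp: mp_auts_image_eq[OF assms(1) ms] mp_auts_image_eq[OF assms(2) ms])
  then have "marker_dist f g = prob {x \<in> space M. (act (k x) x \<in> marker) \<noteq> (act (l x) x \<in> marker)}"
    unfolding marker_dist_def
    using mp_auts_image(1)[OF assms(1) marker_sets] mp_auts_image(1)[OF assms(2) marker_sets]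
    by (intro measure_eq_AE) auto
  then show ?thesis
    using prob_cocycle_neq[of k l] assms(3,4) by (simp add: cocycle_measurable)
qed

text \<open>The marker controls every other set: where the cocycles of the inverses agree, the
  inverses agree, so a point lies in both images or in neither. This is why one set suffices to
  metrize the weak topology on the group.\<close>

lemma image_dist_le:
  assumes f: "f \<in> cauts" and g: "g \<in> cauts" and B: "B \<in> sets M"
  shows "measure M (sym_diff (f ` B) (g ` B)) \<le> 2 * marker_dist f g"
proof -
  obtain k l where kl: "cocycle k (inverse_map f)" "cocycle l (inverse_map g)"
    using f g by (meson cautsE)
  have mp: "f \<in> mp_auts M" "g \<in> mp_auts M" using f g by (auto simp: cauts_def)
  have sub: "B \<subseteq> space M" using B by (rule sets.sets_into_space)
  have "AE x in M. inverse_map f x = act (k x) x" "AE x in M. inverse_map g x = act (l x) x"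
    using kl by (auto simp: cocycle_def)
  then have "AE x in M. x \<in> sym_diff (f ` B) (g ` B) \<longrightarrow> x \<in> {x \<in> space M. k x \<noteq> l x}"
    using AE_space by eventually_elim (auto simp: mp_auts_image_eq[OF mp(1) sub] mp_auts_image_eq[OF mp(2) sub])
  then have "measure M (sym_diff (f ` B) (g ` B)) \<le> prob {x \<in> space M. k x \<noteq> l x}"
    by (rule finite_measure_mono_AE) (intro cocycle_neq_sets cocycle_measurable(2)[OF kl(1)]
        cocycle_measurable(2)[OF kl(2)])
  then show ?thesis using cocycle_marker_dist[OF mp kl] by simp
qed

text \<open>Left translation preserves the distance because it preserves measure. Right translation
  needs the cocycles: that of the inverse of \<open>f \<circ> u\<close> at \<open>x\<close> is
  determined by \<open>x\<close> and \<open>k x\<close>, so it cannot differ where \<open>k\<close>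
  and \<open>l\<close> agree.\<close>

lemma marker_dist_right:
  assumes "f \<in> cauts" "g \<in> cauts" "u \<in> cauts"
  shows "marker_dist (f \<circ> u) (g \<circ> u) \<le> marker_dist f g"
proof -
  obtain k l m where klm: "cocycle k (inverse_map f)" "cocycle l (inverse_map g)" "cocycle m (inverse_map u)"
    using assms by (meson cautsE)
  have mp: "f \<in> mp_auts M" "g \<in> mp_auts M" "u \<in> mp_auts M" using assms by (auto simp: cauts_def)
  have "2 * marker_dist (f \<circ> u) (g \<circ> u)
      = prob {x \<in> space M. m (act (k x) x) + k x \<noteq> m (act (l x) x) + l x}"
    using cocycle_marker_dist[OF mp_auts_comp[OF mp(1,3)] mp_auts_comp[OF mp(2,3)]
        cocycle_inverse_comp[OF mp(1,3) klm(1,3)] cocycle_inverse_comp[OF mp(2,3) klm(2,3)]] by simp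
  also have "\<dots> \<le> prob {x \<in> space M. k x \<noteq> l x}"
    by (rule finite_measure_mono[OF _ cocycle_neq_sets])
      (auto intro: cocycle_measurable(2)[OF klm(1)] cocycle_measurable(2)[OF klm(2)])
  also have "\<dots> = 2 * marker_dist f g" by (rule cocycle_marker_dist[OF mp(1,2) klm(1,2)])
  finally show ?thesis by simp
qed

lemma marker_dist_left:
  assumes "f \<in> mp_auts M" "g \<in> mp_auts M" "u \<in> mp_auts M"
  shows "marker_dist (u \<circ> f) (u \<circ> g) = marker_dist f g"
  unfolding marker_dist_def image_comp[symmetric]
  by (intro mp_auts_image_sym_diff mp_auts_image marker_sets assms)

text \<open>Translation by \<open>g\<close> on the left turns the distance of the inverses into that
  of \<open>g \<circ> inverse_map f\<close> from the identity. The identity is then rewritten as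
  \<open>f \<circ> inverse_map f\<close>, and the common right factor is dropped.\<close>

lemma marker_dist_inv:
  assumes "f \<in> cauts" "g \<in> cauts"
  shows "marker_dist (inverse_map f) (inverse_map g) \<le> marker_dist f g"
proof -
  have mp: "f \<in> mp_auts M" "g \<in> mp_auts M" using assms by (auto simp: cauts_def)
  have ms: "marker \<subseteq> space M" by (auto simp: marker_def)
  have id: "(u \<circ> inverse_map u) ` marker = marker" if "u \<in> mp_auts M" for u
    using ms mp_autsD(7)[OF that] by (force simp: subset_iff)
  have "marker_dist (inverse_map f) (inverse_map g) = marker_dist (g \<circ> inverse_map f) (g \<circ> inverse_map g)"
    using mp by (simp add: marker_dist_left mp_auts_inv)
  also have "\<dots> = marker_dist (g \<circ> inverse_map f) (f \<circ> inverse_map f)"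
    unfolding marker_dist_def id[OF mp(1)] id[OF mp(2)] ..
  also have "\<dots> \<le> marker_dist g f"
    using assms by (intro marker_dist_right cauts_inv)
  finally show ?thesis by (simp add: marker_dist_commute)
qed

text \<open>Completeness of the uniform metric. The cocycles of the maps and of their inverses
  stabilize almost everywhere, and the limit cocycles define maps that are inverse to each other
  modulo null sets; \<open>mod0_iso_mp_auts\<close> makes them honest automorphisms. The hypothesis
  has exponent \<open>Suc n\<close> because cocycles differ on twice the marker distance.\<close>

lemma cauts_limit:
  fixes f :: "nat \<Rightarrow> 'a \<Rightarrow> 'a"
  assumes f: "\<And>n. f n \<in> cauts" and le: "\<And>n. marker_dist (f n) (f (Suc n)) \<le> (1/2) ^ Suc n"
  obtains g where "g \<in> cauts" "\<And>n. marker_dist (f n) g \<le> (1/2) ^ n"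
proof -
  have mp: "f n \<in> mp_auts M" "inverse_map (f n) \<in> mp_auts M" for n
    using f cauts_inv by (auto simp: cauts_def)
  have "\<forall>n. \<exists>h. cocycle h (f n)" "\<forall>n. \<exists>k. cocycle k (inverse_map (f n))" using f cautsE by metis+
  then obtain h k where hk: "\<And>n. cocycle (h n) (f n)" "\<And>n. cocycle (k n) (inverse_map (f n))"
    by metis
  note [measurable] = cocycle_measurable(2)[OF hk(1)] cocycle_measurable(2)[OF hk(2)]
  have hk': "cocycle (h n) (inverse_map (inverse_map (f n)))" for n
    by (rule cocycle_AE[OF hk(1)]) (use AE_space in \<open>eventually_elim, simp add: mp_auts_inv_inv mp\<close>)
  have kle: "prob {x \<in> space M. k n x \<noteq> k (Suc n) x} \<le> (1/2) ^ n" for n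
    using cocycle_marker_dist[OF mp(1,1) hk(2,2)] le[of n] by simp
  have hle: "prob {x \<in> space M. h n x \<noteq> h (Suc n) x} \<le> (1/2) ^ n" for n
    using cocycle_marker_dist[OF mp(2,2) hk'(1,1), of n "Suc n"]
      marker_dist_inv[OF f f, of n "Suc n"] le[of n] by simp
  obtain h' where h': "h' \<in> measurable base (count_space UNIV)"
    "\<And>n. prob {x \<in> space M. h n x \<noteq> h' x} \<le> 2 * (1/2) ^ n"
    using rapidly_stabilizing_limit[OF space_base base_subset cocycle_measurable(1)[OF hk(1)] hle] by blast
  obtain k' where k': "k' \<in> measurable base (count_space UNIV)"
    "\<And>n. prob {x \<in> space M. k n x \<noteq> k' x} \<le> 2 * (1/2) ^ n"
    using rapidly_stabilizing_limit[OF space_base base_subset cocycle_measurable(1)[OF hk(2)] kle] by blast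
  note [measurable] = h'(1)[THEN measurable_base_M] k'(1)[THEN measurable_base_M]
  let ?F = "\<lambda>x. act (h' x) x" and ?K = "\<lambda>x. act (k' x) x"
  have F[measurable]: "?F \<in> measurable M M" and K[measurable]: "?K \<in> measurable M M"
    by (auto intro!: act_random_measurable measurable_base_M h' k')
  have small: "\<exists>n. c * (1/2 :: real) ^ n < \<epsilon>" if "\<epsilon> > 0" "c > 0" for \<epsilon> c :: real
  proof -
    have "\<epsilon> / c > 0" using that by simp
    from real_arch_pow_inv[OF this, of "1/2"] show ?thesis using that by (auto simp: field_simps)
  qed
  \<comment> \<open>Stated for both orders of a map and its inverse at once. At stage
    \<open>n\<close> something can go wrong only where the cocycle at \<open>x\<close>, or that of
    the inverse at \<open>p n x\<close>, has not reached its limit. The second set is a preimage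
    under \<open>p n\<close>, so its measure is unchanged; two bounds \<open>2 * (1/2) ^ n\<close>
    give the factor 4.\<close>
  have inverse: "AE x in M. K' (F' x) = x"
    if d: "(H = h \<and> L = k \<and> H' = h' \<and> L' = k' \<and> p = f \<and> q = (\<lambda>n. inverse_map (f n))) \<or>
        (H = k \<and> L = h \<and> H' = k' \<and> L' = h' \<and> p = (\<lambda>n. inverse_map (f n)) \<and> q = f)"
      and FK: "F' = (\<lambda>x. act (H' x) x)" "K' = (\<lambda>x. act (L' x) x)" for H L H' L' F' K' p q
  proof (rule AE_small_exceptions)
    fix \<epsilon> :: real assume "\<epsilon> > 0"
    then obtain n where n: "4 * (1/2 :: real) ^ n < \<epsilon>" using small[of \<epsilon> 4] by auto
    have [measurable]: "H n \<in> measurable M (count_space UNIV)" "H' \<in> measurable M (count_space UNIV)"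
      "L n \<in> measurable M (count_space UNIV)" "L' \<in> measurable M (count_space UNIV)"
      using d by auto
    have pn: "p n \<in> mp_auts M" using d mp by auto
    have [measurable]: "p n \<in> measurable M M" by (rule mp_autsD(1)[OF pn])
    let ?A = "{x \<in> space M. H n x \<noteq> H' x}" and ?B = "{x \<in> space M. L n (p n x) \<noteq> L' (p n x)}"
    have "?B = {x \<in> space M. p n x \<in> {y \<in> space M. L n y \<noteq> L' y}}"
      using mp_autsD(4)[OF pn] by auto
    then have B: "prob ?B = prob {y \<in> space M. L n y \<noteq> L' y}"
      using mp_auts_measure[OF pn, of "{y \<in> space M. L n y \<noteq> L' y}"] by simp
    have "prob (?A \<union> ?B) \<le> prob ?A + prob ?B" by (rule measure_Un_le) measurable
    also have "\<dots> \<le> 4 * (1/2) ^ n"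
      using B h'(2)[of n] k'(2)[of n] d by auto
    finally have "prob (?A \<union> ?B) < \<epsilon>" using n by simp
    moreover have "AE x in M. x \<notin> ?A \<union> ?B \<longrightarrow> K' (F' x) = x"
    proof -
      have "AE x in M. p n x = act (H n x) x" using d hk by (auto simp: cocycle_def)
      moreover have "AE x in M. q n x = act (L n x) x" using d hk by (auto simp: cocycle_def)
      from mp_auts_AE[OF pn this] have "AE x in M. q n (p n x) = act (L n (p n x)) (p n x)" .
      ultimately show ?thesis using AE_space
      proof eventually_elim
        case (elim x)
        have qp: "q n (p n x) = x" using elim(3) d mp by (auto simp: mp_autsD)
        show ?case
        proof
          assume x: "x \<notin> ?A \<union> ?B"
          then have "F' x = p n x" using elim FK by auto
          moreover have "K' (p n x) = q n (p n x)" using x elim FK by auto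
          ultimately show "K' (F' x) = x" using qp by simp
        qed
      qed
    qed
    ultimately show "\<exists>S\<in>sets M. measure M S < \<epsilon> \<and> (AE x in M. x \<notin> S \<longrightarrow> K' (F' x) = x)"
      by (intro bexI[of _ "?A \<union> ?B"]) auto
  qed
  have invs: "AE x in M. ?K (?F x) = x" "AE x in M. ?F (?K x) = x"
    using inverse[of h k h' k' f "\<lambda>n. inverse_map (f n)" ?F ?K]
      inverse[of k h k' h' "\<lambda>n. inverse_map (f n)" f ?K ?F] by auto
  \<comment> \<open>\<open>F'\<close> agrees with the measure-preserving \<open>p n\<close> off a
    set of measure at most \<open>2 * (1/2) ^ n\<close>, so the preimage of \<open>B\<close> has
    almost the right measure for every \<open>n\<close>.\<close>
  have distr: "distr M M F' = M"
    if FH: "F' = (\<lambda>x. act (H' x) x)" and F'm: "F' \<in> measurable M M"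
      and H'm: "H' \<in> measurable M (count_space UNIV)" and p: "\<And>n. p n \<in> mp_auts M" "\<And>n. cocycle (H n) (p n)"
      and le: "\<And>n. prob {x \<in> space M. H n x \<noteq> H' x} \<le> 2 * (1/2) ^ n"
    for H H' F' and p :: "nat \<Rightarrow> 'a \<Rightarrow> 'a"
  proof (rule measure_eqI)
    fix B assume "B \<in> sets (distr M M F')"
    then have B: "B \<in> sets M" by simp
    let ?V = "{x \<in> space M. F' x \<in> B}"
    have V: "?V \<in> sets M" using B F'm by measurable
    have "\<bar>prob ?V - prob B\<bar> \<le> 0"
    proof (rule field_le_epsilon)
      fix \<epsilon> :: real assume "\<epsilon> > 0"
      then obtain n where n: "2 * (1/2 :: real) ^ n < \<epsilon>" using small[of \<epsilon> 2] by auto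
      let ?W = "{x \<in> space M. p n x \<in> B}" and ?D = "{x \<in> space M. H n x \<noteq> H' x}"
      have W: "?W \<in> sets M" using B mp_autsD(1)[OF p(1)[of n]] by measurable
      have D: "?D \<in> sets M" using H'm cocycle_measurable(2)[OF p(2)] by (intro cocycle_neq_sets)
      have ae: "AE x in M. p n x = act (H n x) x" using p(2)[of n] by (simp add: cocycle_def)
      have "prob ?V \<le> prob ?W + prob ?D"
        by (rule measure_le_Un_AE[OF _ W D]) (use ae FH in \<open>eventually_elim, auto\<close>)
      moreover have "prob ?W \<le> prob ?V + prob ?D"
        by (rule measure_le_Un_AE[OF _ V D]) (use ae FH in \<open>eventually_elim, auto\<close>)
      moreover have "prob ?W = prob B" by (rule mp_auts_measure[OF p(1) B])
      ultimately show "\<bar>prob ?V - prob B\<bar> \<le> 0 + \<epsilon>" using le[of n] n by linarith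
    qed
    then show "emeasure (distr M M F') B = emeasure M B"
      using B F'm by (subst emeasure_distr) (auto simp: emeasure_eq_measure vimage_def Int_def conj_commute)
  qed simp
  have "mod0_iso M M ?F ?K"
    unfolding mod0_iso_def
    using F K invs distr[OF refl F _ mp(1) hk(1) h'(2)] distr[OF refl K _ mp(2) hk(2) k'(2)]
      measurable_base_M[OF h'(1)] measurable_base_M[OF k'(1)] by blast
  then obtain g where g: "g \<in> mp_auts M" "AE x in M. g x = ?F x" "AE x in M. inverse_map g x = ?K x"
    by (rule mod0_iso_mp_auts)
  have c: "cocycle h' g" "cocycle k' (inverse_map g)" using g h' k' by (auto simp: cocycle_def)
  then have "g \<in> cauts" using g by (auto simp: cauts_def)
  moreover have "marker_dist (f n) g \<le> (1/2) ^ n" for n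
    using cocycle_marker_dist[OF mp(1) g(1) hk(2) c(2), of n] k'(2)[of n] by simp
  ultimately show ?thesis by (rule that)
qed

section \<open>The group of classes and its topology\<close>

abbreviation cls :: "('a \<Rightarrow> 'a) \<Rightarrow> ('a \<Rightarrow> 'a) set" where
  "cls f \<equiv> aut_rel M `` {f}"

abbreviation mcls :: "'a set \<Rightarrow> 'a set set" where
  "mcls B \<equiv> null_rel M `` {B}"

definition cgroup :: "('a \<Rightarrow> 'a) set set" where
  "cgroup = cls ` cauts"

lemma cls_carrier: "f \<in> mp_auts M \<Longrightarrow> cls f \<in> carrier (Aut M)"
  by (simp add: Aut_def quotientI)

lemma carrierE:
  assumes "S \<in> carrier (Aut M)" obtains f where "f \<in> mp_auts M" "S = cls f"
  using assms by (auto simp: Aut_def elim: quotientE)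

lemma cgroupE:
  assumes "S \<in> cgroup" obtains f where "f \<in> cauts" "f \<in> mp_auts M" "S = cls f"
  using assms by (auto simp: cgroup_def cauts_def)

lemma cls_eq_iff:
  assumes "f \<in> mp_auts M" "g \<in> mp_auts M"
  shows "cls f = cls g \<longleftrightarrow> (AE x in M. f x = g x)"
  using eq_equiv_class_iff[OF equiv_aut_rel assms] assms by (simp add: aut_rel_def)

lemma one_Aut: "\<one>\<^bsub>Aut M\<^esub> = cls id"
  by (simp add: Aut_def)

lemma inv_Aut:
  assumes "f \<in> mp_auts M"
  shows "inv\<^bsub>Aut M\<^esub> cls f = cls (inverse_map f)"
proof (rule group.inv_equality[OF group_Aut])
  have "AE x in M. (inverse_map f \<circ> f) x = id x"
    using AE_space by eventually_elim (simp add: mp_autsD(6)[OF assms])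
  then show "cls (inverse_map f) \<otimes>\<^bsub>Aut M\<^esub> cls f = \<one>\<^bsub>Aut M\<^esub>"
    using assms by (simp add: Aut_mult_class mp_auts_inv one_Aut cls_eq_iff mp_auts_comp mp_auts_id)
qed (use assms in \<open>auto intro: cls_carrier mp_auts_inv\<close>)

lemma cgroup_subgroup: "subgroup cgroup (Aut M)"
proof (rule group.subgroupI[OF group_Aut])
  show "cgroup \<subseteq> carrier (Aut M)" by (auto elim!: cgroupE intro: cls_carrier)
  show "cgroup \<noteq> {}" using cauts_id by (auto simp: cgroup_def)
  show "inv\<^bsub>Aut M\<^esub> S \<in> cgroup" if S: "S \<in> cgroup" for S
  proof -
    obtain f where f: "f \<in> cauts" "f \<in> mp_auts M" "S = cls f" using S by (rule cgroupE)
    show ?thesis unfolding f(3) inv_Aut[OF f(2)] cgroup_def using cauts_inv[OF f(1)] by (rule imageI)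
  qed
  show "S \<otimes>\<^bsub>Aut M\<^esub> T \<in> cgroup" if "S \<in> cgroup" "T \<in> cgroup" for S T
    using that by (auto elim!: cgroupE simp: Aut_mult_class) (simp add: cgroup_def cauts_comp)
qed

lemma mcls_malg: "B \<in> sets M \<Longrightarrow> mcls B \<in> malg M"
  by (simp add: malg_def quotientI)

lemma aut_app_malg:
  assumes "S \<in> carrier (Aut M)" "P \<in> malg M" shows "aut_app M S P \<in> malg M"
proof -
  obtain f where "f \<in> mp_auts M" "S = cls f" using assms(1) by (rule carrierE)
  moreover obtain B where "B \<in> sets M" "P = mcls B" using assms(2) by (auto simp: malg_def elim: quotientE)
  ultimately show ?thesis by (simp add: aut_app_class mcls_malg mp_auts_image)
qed

lemma malg_dist_aut_app:
  assumes "f \<in> mp_auts M" "g \<in> mp_auts M" "B \<in> sets M"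
  shows "malg_dist M (aut_app M (cls f) (mcls B)) (aut_app M (cls g) (mcls B))
    = measure M (sym_diff (f ` B) (g ` B))"
  using assms by (simp add: aut_app_class malg_dist_class mp_auts_image)

definition gdist :: "('a \<Rightarrow> 'a) set \<Rightarrow> ('a \<Rightarrow> 'a) set \<Rightarrow> real" where
  "gdist S T = malg_dist M (aut_app M S (mcls marker)) (aut_app M T (mcls marker))"

lemma gdist_cls: "f \<in> mp_auts M \<Longrightarrow> g \<in> mp_auts M \<Longrightarrow> gdist (cls f) (cls g) = marker_dist f g"
  by (simp add: gdist_def marker_dist_def malg_dist_aut_app)

lemma malg_dist_le_gdist:
  assumes "S \<in> cgroup" "T \<in> cgroup" "B \<in> sets M"
  shows "malg_dist M (aut_app M S (mcls B)) (aut_app M T (mcls B)) \<le> 2 * gdist S T"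
  using assms by (auto elim!: cgroupE simp: malg_dist_aut_app gdist_cls intro: image_dist_le)

sublocale malg: Metric_space "malg M" "malg_dist M"
  by (rule Metric_space_malg) unfold_locales

text \<open>Only definiteness needs the cocycles: distance 0 makes those of the inverses equal
  almost everywhere, hence the inverses and then the maps. The other axioms are inherited from the
  measure algebra.\<close>

lemma Metric_space_cgroup: "Metric_space cgroup gdist"
proof
  note car = subgroup.subset[OF cgroup_subgroup, THEN subsetD]
  note app = aut_app_malg[OF car mcls_malg[OF marker_sets]]
  show "0 \<le> gdist S T" for S T by (simp add: gdist_def)
  show "gdist S T = gdist T S" for S T by (simp add: gdist_def malg.commute)
  show "gdist S U \<le> gdist S T + gdist T U" if "S \<in> cgroup" "T \<in> cgroup" "U \<in> cgroup" for S T U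
    unfolding gdist_def using that by (intro malg.triangle app)
  show "gdist S T = 0 \<longleftrightarrow> S = T" if ST: "S \<in> cgroup" "T \<in> cgroup" for S T
  proof
    assume 0: "gdist S T = 0"
    obtain f g where fg: "f \<in> cauts" "f \<in> mp_auts M" "S = cls f" "g \<in> cauts" "g \<in> mp_auts M" "T = cls g"
      using ST by (meson cgroupE)
    obtain k l where kl: "cocycle k (inverse_map f)" "cocycle l (inverse_map g)"
      using fg by (meson cautsE)
    have "prob {x \<in> space M. k x \<noteq> l x} = 0"
      using cocycle_marker_dist[OF fg(2,5) kl] 0 fg by (simp add: gdist_cls)
    then have "AE x in M. k x = l x"
      using cocycle_neq_sets[OF cocycle_measurable(2)[OF kl(1)] cocycle_measurable(2)[OF kl(2)]]
      by (subst AE_iff_measurable[OF _ refl]) (auto simp: emeasure_eq_measure)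
    moreover have "AE x in M. inverse_map f x = act (k x) x" "AE x in M. inverse_map g x = act (l x) x"
      using kl by (auto simp: cocycle_def)
    ultimately have "AE x in M. inverse_map f x = inverse_map g x" by eventually_elim simp
    from mp_auts_inv_AE[OF mp_auts_inv mp_auts_inv this]
    have "AE x in M. inverse_map (inverse_map f) x = inverse_map (inverse_map g) x" using fg by simp
    then have "AE x in M. f x = g x"
      using AE_space by eventually_elim (simp add: mp_auts_inv_inv fg)
    then show "S = T" using fg by (simp add: cls_eq_iff)
  next
    assume "S = T"
    then show "gdist S T = 0" using app[OF ST(1)] by (simp add: gdist_def)
  qed
qed

sublocale cg: Metric_space cgroup gdist
  by (rule Metric_space_cgroup)

abbreviation ctop :: "('a \<Rightarrow> 'a) set topology" where
  "ctop \<equiv> subtopology (weak_topology M) cgroup"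

lemma openin_weak_basic:
  assumes "B \<in> sets M" "openin (malg_topology M) U"
  shows "openin (weak_topology M) {S \<in> carrier (Aut M). aut_app M S (mcls B) \<in> U}"
  unfolding weak_topology_def
  by (rule topology_generated_by_Basis) (use assms mcls_malg in blast)

lemma openin_weak_ball:
  assumes "S \<in> carrier (Aut M)" "B \<in> sets M"
  shows "openin (weak_topology M)
    {T \<in> carrier (Aut M). malg_dist M (aut_app M S (mcls B)) (aut_app M T (mcls B)) < \<epsilon>}"
proof -
  have "openin (malg_topology M) (malg.mball (aut_app M S (mcls B)) \<epsilon>)"
    by (simp add: malg_topology_def)
  from openin_weak_basic[OF assms(2) this] show ?thesis
    using assms by (simp add: malg.in_mball aut_app_malg mcls_malg cong: conj_cong)
qed

text \<open>The metric topology refines the weak one because evaluation at any measurable set is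
  Lipschitz, by \<open>malg_dist_le_gdist\<close>. Conversely, a ball of \<open>gdist\<close> is cut
  out by the single weakly open condition that concerns \<open>marker\<close>.\<close>

lemma ctop_eq: "ctop = cg.mtopology"
proof (rule topology_eq[THEN iffD2], intro allI iffI)
  have "continuous_map cg.mtopology (weak_topology M) (\<lambda>S. S)"
    unfolding weak_topology_def
  proof (rule continuous_on_generated_topo)
    fix V assume "V \<in> {{S \<in> carrier (Aut M). aut_app M S P \<in> U} |P U. P \<in> malg M \<and> openin (malg_topology M) U}"
    then obtain B U where B: "B \<in> sets M" and U: "openin (malg_topology M) U"
      and V: "V = {S \<in> carrier (Aut M). aut_app M S (mcls B) \<in> U}"
      by (auto simp: malg_def elim!: quotientE)
    show "openin cg.mtopology ((\<lambda>S. S) -` V \<inter> topspace cg.mtopology)"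
      unfolding cg.openin_mtopology
    proof (intro conjI allI impI)
      fix S assume "S \<in> (\<lambda>S. S) -` V \<inter> topspace cg.mtopology"
      then have S: "S \<in> V" "S \<in> cgroup" by auto
      then obtain \<epsilon> where \<epsilon>: "\<epsilon> > 0" "malg.mball (aut_app M S (mcls B)) \<epsilon> \<subseteq> U"
        using U V unfolding malg_topology_def malg.openin_mtopology by blast
      have "T \<in> V" if T: "T \<in> cgroup" "gdist S T < \<epsilon> / 2" for T
      proof -
        have TS: "T \<in> carrier (Aut M)" "S \<in> carrier (Aut M)"
          using T S subgroup.subset[OF cgroup_subgroup] by auto
        have "malg_dist M (aut_app M S (mcls B)) (aut_app M T (mcls B)) < \<epsilon>"
          using malg_dist_le_gdist[OF S(2) T(1) B] T(2) by simp
        then have "aut_app M T (mcls B) \<in> malg.mball (aut_app M S (mcls B)) \<epsilon>"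
          using TS B by (simp add: malg.in_mball aut_app_malg mcls_malg)
        then show ?thesis using \<epsilon>(2) TS V by auto
      qed
      then show "\<exists>r>0. cg.mball S r \<subseteq> (\<lambda>S. S) -` V \<inter> topspace cg.mtopology"
        using \<epsilon>(1) by (intro exI[of _ "\<epsilon> / 2"]) (auto simp: cg.in_mball)
    qed auto
  next
    have "cgroup \<subseteq> topspace (weak_topology M)"
      using topspace_weak_topology[OF finite_measure_axioms] subgroup.subset[OF cgroup_subgroup] by simp
    then show "(\<lambda>S. S) ` topspace cg.mtopology
        \<subseteq> \<Union>{{S \<in> carrier (Aut M). aut_app M S P \<in> U} |P U. P \<in> malg M \<and> openin (malg_topology M) U}"
      by (simp add: weak_topology_def)
  qed
  then have c: "continuous_map cg.mtopology (weak_topology M) (\<lambda>S. S)" .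
  fix U
  show "openin cg.mtopology U" if "openin ctop U"
  proof -
    obtain V where V: "openin (weak_topology M) V" "U = V \<inter> cgroup"
      using \<open>openin ctop U\<close> by (auto simp: openin_subtopology)
    have "U = {S \<in> topspace cg.mtopology. S \<in> V}" using V by auto
    then show ?thesis using openin_continuous_map_preimage[OF c V(1)] by simp
  qed
  show "openin ctop U" if U: "openin cg.mtopology U"
  proof (subst openin_subopen, intro ballI)
    fix S assume "S \<in> U"
    then obtain r where r: "r > 0" "cg.mball S r \<subseteq> U" and S: "S \<in> cgroup"
      using U unfolding cg.openin_mtopology by blast
    have SA: "cgroup \<subseteq> carrier (Aut M)" by (rule subgroup.subset[OF cgroup_subgroup])
    let ?W = "{T \<in> carrier (Aut M). malg_dist M (aut_app M S (mcls marker)) (aut_app M T (mcls marker)) < r}"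
    have "cg.mball S r = ?W \<inter> cgroup"
      using S SA by (auto simp: cg.in_mball gdist_def)
    moreover have "openin (weak_topology M) ?W"
      using S SA by (intro openin_weak_ball marker_sets) auto
    ultimately have "openin ctop (cg.mball S r)" by (auto simp: openin_subtopology)
    then show "\<exists>T. openin ctop T \<and> S \<in> T \<and> T \<subseteq> U" using r S by (intro exI[of _ "cg.mball S r"]) auto
  qed
qed

text \<open>A Cauchy sequence converges once a subsequence does, so one can pass to geometrically
  small gaps, as \<open>cauts_limit\<close> demands.\<close>

lemma mcomplete_cgroup: "cg.mcomplete"
  unfolding cg.mcomplete_def
proof (intro allI impI)
  fix \<sigma> assume c: "cg.MCauchy \<sigma>"
  have "\<exists>N. \<forall>n n'. N \<le> n \<longrightarrow> N \<le> n' \<longrightarrow> gdist (\<sigma> n) (\<sigma> n') < (1/2) ^ Suc m" for m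
    using c unfolding cg.MCauchy_def by (meson zero_less_power zero_less_divide_1_iff zero_less_numeral)
  then obtain N where N: "\<And>m n n'. N m \<le> n \<Longrightarrow> N m \<le> n' \<Longrightarrow> gdist (\<sigma> n) (\<sigma> n') < (1/2) ^ Suc m"
    by metis
  \<comment> \<open>The summand \<open>m\<close> makes \<open>s\<close> strictly increasing, and the
    sum keeps \<open>s m\<close> above the threshold \<open>N m\<close>.\<close>
  define s where "s m = m + (\<Sum>i\<le>m. N i)" for m
  have s: "strict_mono s" by (auto simp: strict_mono_Suc_iff s_def)
  have sN: "N m \<le> s m" for m by (simp add: s_def) (simp add: member_le_sum trans_le_add2)
  have "\<forall>n. \<exists>f. f \<in> cauts \<and> \<sigma> (s n) = cls f"
    using c unfolding cg.MCauchy_def by (meson cgroupE rangeI subsetD)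
  then obtain f where f: "\<And>n. f n \<in> cauts" "\<And>n. \<sigma> (s n) = cls (f n)" by metis
  note mp = cauts_mp[OF f(1)]
  have "marker_dist (f n) (f (Suc n)) \<le> (1/2) ^ Suc n" for n
  proof -
    have "N n \<le> s (Suc n)" using sN[of n] s by (meson le_trans strict_mono_less_eq le_SucI order_refl)
    from N[OF sN this] show ?thesis using mp by (simp add: f gdist_cls less_imp_le)
  qed
  then obtain g where g: "g \<in> cauts" "\<And>n. marker_dist (f n) g \<le> (1/2) ^ n"
    by (rule cauts_limit[of f, OF f(1)]) blast
  have "limitin cg.mtopology (\<sigma> \<circ> s) (cls g) sequentially"
    unfolding cg.limit_metric_sequentially
  proof (intro conjI allI impI)
    show "cls g \<in> cgroup" using g by (simp add: cgroup_def)
    fix \<epsilon> :: real assume "\<epsilon> > 0"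
    then obtain m where m: "(1/2 :: real) ^ m < \<epsilon>" using real_arch_pow_inv[of \<epsilon> "1/2"] by auto
    show "\<exists>N. \<forall>n\<ge>N. (\<sigma> \<circ> s) n \<in> cgroup \<and> gdist ((\<sigma> \<circ> s) n) (cls g) < \<epsilon>"
    proof (intro exI[of _ m] allI impI conjI)
      fix n assume n: "n \<ge> m"
      show "(\<sigma> \<circ> s) n \<in> cgroup" using f by (simp add: cgroup_def)
      have "gdist ((\<sigma> \<circ> s) n) (cls g) \<le> (1/2) ^ n"
        using g(2)[of n] mp cauts_mp[OF g(1)] by (simp add: f gdist_cls)
      also have "\<dots> \<le> (1/2) ^ m" using n by (intro power_decreasing) auto
      finally show "gdist ((\<sigma> \<circ> s) n) (cls g) < \<epsilon>" using m by simp
    qed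
  qed
  then show "\<exists>S. limitin cg.mtopology \<sigma> S sequentially"
    using cg.MCauchy_convergent_subsequence[OF c s] by blast
qed

text \<open>The map from \<open>f\<close> to the image of \<open>marker\<close> embeds the group
  isometrically into the separable measure algebra. As the members of \<open>\<C>\<close> need not
  be such images, one group element is chosen near each \<open>C\<close> at each scale
  \<open>n\<close> where there is one.\<close>

lemma polish_cgroup: "polish_topology ctop"
proof -
  obtain \<C> where \<C>: "countable \<C>" "\<C> \<subseteq> sets M"
    "\<And>B \<epsilon>. B \<in> sets M \<Longrightarrow> \<epsilon> > 0 \<Longrightarrow> \<exists>C\<in>\<C>. measure M (sym_diff B C) < \<epsilon>"
    by (rule separable_measure_algebra[OF e_measurable r_measurable r_e]) auto
  let ?P = "\<lambda>(C, n) f. f \<in> cauts \<and> measure M (sym_diff (f ` marker) C) < 1 / real (Suc n)"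
  define D where "D = (\<lambda>p. cls (SOME f. ?P p f)) ` {p \<in> \<C> \<times> UNIV. \<exists>f. ?P p f}"
  have some: "?P p (SOME f. ?P p f)" if "\<exists>f. ?P p f" for p using that by (rule someI_ex)
  have "countable D" unfolding D_def using \<C>(1)
    by (intro countable_image countable_Collect countable_SIGMA) auto
  moreover have Dsub: "D \<subseteq> cgroup"
    using some unfolding D_def cgroup_def by (fastforce simp: case_prod_beta)
  moreover have "ctop closure_of D = topspace ctop"
  proof
    have "S \<in> cg.mtopology closure_of D" if S: "S \<in> cgroup" for S
      unfolding cg.metric_closure_of
    proof (safe intro!: S)
      fix \<epsilon> :: real assume "\<epsilon> > 0"
      then obtain n where n: "1 / real (Suc n) < \<epsilon> / 2" using nat_approx_posE[of "\<epsilon>/2"] by auto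
      obtain f where f: "f \<in> cauts" "f \<in> mp_auts M" "S = cls f" using S by (rule cgroupE)
      have fM: "f ` marker \<in> sets M" using f by (simp add: mp_auts_image)
      obtain C where C: "C \<in> \<C>" "measure M (sym_diff (f ` marker) C) < 1 / real (Suc n)"
        using \<C>(3)[OF fM, of "1 / real (Suc n)"] by auto
      then have ex: "\<exists>f. ?P (C, n) f" using f by auto
      define g where "g = (SOME f. ?P (C, n) f)"
      have g: "g \<in> cauts" "measure M (sym_diff (g ` marker) C) < 1 / real (Suc n)"
        using some[OF ex] by (simp_all add: g_def)
      have gM: "g ` marker \<in> sets M" using cauts_mp[OF g(1)] by (simp add: mp_auts_image)
      have CM: "C \<in> sets M" using C \<C> by auto
      have "marker_dist f g \<le> measure M (sym_diff (f ` marker) C \<union> sym_diff (g ` marker) C)"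
        unfolding marker_dist_def using fM gM CM by (intro finite_measure_mono) auto
      also have "\<dots> \<le> measure M (sym_diff (f ` marker) C) + measure M (sym_diff (g ` marker) C)"
        using fM gM CM by (intro measure_Un_le) auto
      also have "\<dots> < \<epsilon>" using C(2) g(2) n by linarith
      finally have "gdist S (cls g) < \<epsilon>" using f cauts_mp[OF g(1)] by (simp add: gdist_cls)
      moreover have "cls g \<in> D" unfolding D_def g_def using C(1) ex by blast
      ultimately show "\<exists>y\<in>D. y \<in> cg.mball S \<epsilon>"
        using S Dsub by (intro bexI[of _ "cls g"]) (auto simp: cg.in_mball)
    qed
    then show "topspace ctop \<subseteq> ctop closure_of D" by (auto simp: ctop_eq)
  qed (rule closure_of_subset_topspace)
  moreover have "completely_metrizable_space ctop"
    unfolding ctop_eq using mcomplete_cgroup by (rule cg.completely_metrizable_space_mtopology)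
  ultimately show ?thesis unfolding polish_topology_def by (auto simp: ctop_eq)
qed

lemma gdist_left:
  assumes "S \<in> cgroup" "T \<in> cgroup" "U \<in> cgroup"
  shows "gdist (U \<otimes>\<^bsub>Aut M\<^esub> S) (U \<otimes>\<^bsub>Aut M\<^esub> T) = gdist S T"
  using assms by (auto elim!: cgroupE simp: Aut_mult_class gdist_cls mp_auts_comp marker_dist_left)

lemma gdist_right:
  assumes "S \<in> cgroup" "T \<in> cgroup" "U \<in> cgroup"
  shows "gdist (S \<otimes>\<^bsub>Aut M\<^esub> U) (T \<otimes>\<^bsub>Aut M\<^esub> U) \<le> gdist S T"
  using assms by (auto elim!: cgroupE simp: Aut_mult_class gdist_cls mp_auts_comp marker_dist_right)

lemma gdist_inv:
  assumes "S \<in> cgroup" "T \<in> cgroup"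
  shows "gdist (inv\<^bsub>Aut M\<^esub> S) (inv\<^bsub>Aut M\<^esub> T) \<le> gdist S T"
  using assms by (auto elim!: cgroupE simp: inv_Aut gdist_cls mp_auts_inv marker_dist_inv)

abbreviation cgrp :: "('a \<Rightarrow> 'a) set monoid" where
  "cgrp \<equiv> (Aut M)\<lparr>carrier := cgroup\<rparr>"

lemma group_cgrp: "group cgrp"
  by (rule subgroup.subgroup_is_group[OF cgroup_subgroup group_Aut])

lemma topological_group_cgrp: "topological_group cgrp ctop"
  unfolding topological_group_def
proof (intro conjI)
  note m = subgroup.m_closed[OF cgroup_subgroup] and i = subgroup.m_inv_closed[OF cgroup_subgroup]
  show "group cgrp" by (rule group_cgrp)
  show "topspace ctop = carrier cgrp" by (simp add: ctop_eq)
  show "continuous_map (prod_topology ctop ctop) ctop (\<lambda>(g, h). g \<otimes>\<^bsub>cgrp\<^esub> h)"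
    unfolding ctop_eq cg.continuous_map_to_metric
  proof (intro ballI allI impI)
    fix p and \<epsilon> :: real assume "p \<in> topspace (prod_topology cg.mtopology cg.mtopology)" and \<epsilon>: "\<epsilon> > 0"
    then obtain S T where p: "p = (S, T)" and ST: "S \<in> cgroup" "T \<in> cgroup" by auto
    let ?U = "cg.mball S (\<epsilon>/2) \<times> cg.mball T (\<epsilon>/2)"
    show "\<exists>U. openin (prod_topology cg.mtopology cg.mtopology) U \<and> p \<in> U \<and>
        (\<forall>y\<in>U. (case y of (g, h) \<Rightarrow> g \<otimes>\<^bsub>cgrp\<^esub> h) \<in> cg.mball (case p of (g, h) \<Rightarrow> g \<otimes>\<^bsub>cgrp\<^esub> h) \<epsilon>)"
    proof (intro exI[of _ ?U] conjI ballI)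
      show "openin (prod_topology cg.mtopology cg.mtopology) ?U" by (simp add: openin_prod_Times_iff)
      show "p \<in> ?U" using p ST \<epsilon> by simp
      fix y assume "y \<in> ?U"
      then obtain S' T' where y: "y = (S', T')" "S' \<in> cgroup" "T' \<in> cgroup"
        "gdist S S' < \<epsilon>/2" "gdist T T' < \<epsilon>/2" by (auto simp: cg.in_mball)
      have "gdist (S \<otimes>\<^bsub>Aut M\<^esub> T) (S' \<otimes>\<^bsub>Aut M\<^esub> T')
          \<le> gdist (S \<otimes>\<^bsub>Aut M\<^esub> T) (S \<otimes>\<^bsub>Aut M\<^esub> T') + gdist (S \<otimes>\<^bsub>Aut M\<^esub> T') (S' \<otimes>\<^bsub>Aut M\<^esub> T')"
        using ST y by (intro cg.triangle m)
      also have "\<dots> < \<epsilon>"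
        using gdist_left[OF ST(2) y(3) ST(1)] gdist_right[OF ST(1) y(2,3)] y(4,5) by linarith
      finally show "(case y of (g, h) \<Rightarrow> g \<otimes>\<^bsub>cgrp\<^esub> h)
          \<in> cg.mball (case p of (g, h) \<Rightarrow> g \<otimes>\<^bsub>cgrp\<^esub> h) \<epsilon>"
        using p ST y m by (simp add: cg.in_mball)
    qed
  qed
  have inv: "inv\<^bsub>cgrp\<^esub> S = inv\<^bsub>Aut M\<^esub> S" if "S \<in> cgroup" for S
    using group.m_inv_consistent[OF group_Aut cgroup_subgroup that] .
  have "continuous_map ctop ctop (\<lambda>S. inv\<^bsub>Aut M\<^esub> S)"
    unfolding ctop_eq cg.continuous_map_to_metric
  proof (intro ballI allI impI)
    fix S and \<epsilon> :: real assume S: "S \<in> topspace cg.mtopology" and \<epsilon>: "\<epsilon> > 0"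
    show "\<exists>U. openin cg.mtopology U \<and> S \<in> U \<and> (\<forall>T\<in>U. inv\<^bsub>Aut M\<^esub> T \<in> cg.mball (inv\<^bsub>Aut M\<^esub> S) \<epsilon>)"
    proof (intro exI[of _ "cg.mball S \<epsilon>"] conjI ballI)
      fix T assume "T \<in> cg.mball S \<epsilon>"
      then have T: "T \<in> cgroup" "gdist S T < \<epsilon>" by (auto simp: cg.in_mball)
      then show "inv\<^bsub>Aut M\<^esub> T \<in> cg.mball (inv\<^bsub>Aut M\<^esub> S) \<epsilon>"
        using gdist_inv[of S T] S i by (auto simp: cg.in_mball)
    qed (use S \<epsilon> in auto)
  qed
  then show "continuous_map ctop ctop (\<lambda>g. inv\<^bsub>cgrp\<^esub> g)"
    by (rule continuous_map_eq) (simp add: inv ctop_eq)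
qed

text \<open>A point \<open>S\<close> of the closure is approximated by group elements on finitely
  many sets at a time. Closeness on \<open>marker\<close> makes the approximants Cauchy in the
  uniform metric, so they converge to some \<open>g\<close> in the group; closeness on the remaining
  sets then forces \<open>S\<close> to be the class of \<open>g\<close>.\<close>

lemma cgroup_closed: "closedin (weak_topology M) cgroup"
proof -
  have top: "topspace (weak_topology M) = carrier (Aut M)"
    by (rule topspace_weak_topology) unfold_locales
  have "S \<in> cgroup" if S: "S \<in> (weak_topology M) closure_of cgroup" for S
  proof -
    have SA: "S \<in> carrier (Aut M)" using S top by (auto simp: in_closure_of)
    define q :: "nat \<Rightarrow> rat" where "q = from_nat_into UNIV"
    have q: "surj q" unfolding q_def by (rule range_from_nat_into) auto
    \<comment> \<open>Index 0 is the marker, so it is controlled at every stage. The preimages of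
      rational half-lines under the injection \<open>e\<close> separate points.\<close>
    define B where "B n = (case n of 0 \<Rightarrow> marker | Suc m \<Rightarrow> {x \<in> space M. e x \<le> of_rat (q m)})" for n
    have BM: "B n \<in> sets M" for n unfolding B_def by (cases n) (simp_all, measurable)
    let ?d = "\<lambda>S T n. malg_dist M (aut_app M S (mcls (B n))) (aut_app M T (mcls (B n)))"
    \<comment> \<open>With exponent \<open>n + 2\<close> the errors of two consecutive approximants
      add up to less than \<open>(1/2) ^ Suc n\<close>.\<close>
    have "\<exists>T\<in>cgroup. \<forall>i\<le>n. ?d S T i < (1/2) ^ (n + 2)" for n
    proof -
      let ?W = "\<Inter>i\<le>n. {T \<in> carrier (Aut M). ?d S T i < (1/2) ^ (n + 2)}"
      have "openin (weak_topology M) ?W"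
        by (intro openin_INT2 openin_weak_ball SA BM) auto
      moreover have "S \<in> ?W" using SA BM by (auto simp: aut_app_malg mcls_malg)
      ultimately obtain T where "T \<in> cgroup" "T \<in> ?W" using S unfolding in_closure_of by blast
      then show ?thesis by blast
    qed
    then obtain T where T: "\<And>n. T n \<in> cgroup" "\<And>n i. i \<le> n \<Longrightarrow> ?d S (T n) i < (1/2) ^ (n + 2)"
      by metis
    have TA: "T n \<in> carrier (Aut M)" for n using T(1) subgroup.subset[OF cgroup_subgroup] by auto
    note app = aut_app_malg[OF _ mcls_malg[OF BM]]
    have "\<forall>n. \<exists>f. f \<in> cauts \<and> T n = cls f" using T(1) unfolding cgroup_def by blast
    then obtain f where f: "\<And>n. f n \<in> cauts" "\<And>n. T n = cls (f n)" by metis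
    note mp = cauts_mp[OF f(1)]
    have "marker_dist (f n) (f (Suc n)) \<le> (1/2) ^ Suc n" for n
    proof -
      have "marker_dist (f n) (f (Suc n)) = ?d (T n) (T (Suc n)) 0"
        using gdist_cls[OF mp mp, of n "Suc n"] by (simp add: f gdist_def B_def)
      also have "\<dots> \<le> ?d (T n) S 0 + ?d S (T (Suc n)) 0"
        by (intro malg.triangle app SA TA)
      also have "\<dots> \<le> (1/2) ^ (n + 2) + (1/2) ^ (Suc n + 2)"
        using T(2)[of 0 n] T(2)[of 0 "Suc n"] malg.commute[of "aut_app M (T n) (mcls (B 0))"]
        by (intro add_mono) auto
      also have "\<dots> \<le> (1/2) ^ Suc n" by (simp add: field_simps)
      finally show ?thesis .
    qed
    then obtain g where g: "g \<in> cauts" "\<And>n. marker_dist (f n) g \<le> (1/2) ^ n"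
      by (rule cauts_limit[of f, OF f(1)]) blast
    have gm: "g \<in> mp_auts M" using g(1) by (rule cauts_mp)
    obtain u where u: "u \<in> mp_auts M" "S = cls u" using SA by (rule carrierE)
    have zero: "measure M (sym_diff (u ` B i) (g ` B i)) = 0" for i
    proof -
      have "?d S (cls g) i \<le> 0"
      proof (rule field_le_epsilon)
        fix \<epsilon> :: real assume "\<epsilon> > 0"
        then obtain m where m: "(1/2 :: real) ^ m < \<epsilon> / 3" using real_arch_pow_inv[of "\<epsilon>/3" "1/2"] by auto
        let ?n = "max m i"
        have pow: "(1/2 :: real) ^ ?n < \<epsilon> / 3"
          by (rule le_less_trans[OF power_decreasing m]) auto
        have "?d S (cls g) i \<le> ?d S (T ?n) i + ?d (T ?n) (cls g) i"
          by (intro malg.triangle app SA TA cls_carrier gm)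
        moreover have "?d S (T ?n) i < (1/2) ^ (?n + 2)" by (rule T(2)) simp
        moreover have "(1/2 :: real) ^ (?n + 2) \<le> (1/2) ^ ?n" by (rule power_decreasing) auto
        moreover have "?d (T ?n) (cls g) i \<le> 2 * marker_dist (f ?n) g"
          using image_dist_le[OF f(1) g(1) BM] by (simp add: f malg_dist_aut_app mp gm BM)
        moreover have "marker_dist (f ?n) g \<le> (1/2) ^ ?n" by (rule g)
        ultimately show "?d S (cls g) i \<le> 0 + \<epsilon>" using pow by linarith
      qed
      then show ?thesis
        using malg_dist_aut_app[OF u(1) gm BM, of i] measure_nonneg[of M "sym_diff (u ` B i) (g ` B i)"]
        by (simp add: u)
    qed
    have "AE x in M. inverse_map u x \<in> B (Suc m) \<longleftrightarrow> inverse_map g x \<in> B (Suc m)" for m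
    proof -
      have sub: "B (Suc m) \<subseteq> space M" by (auto simp: B_def)
      have "sym_diff (u ` B (Suc m)) (g ` B (Suc m)) \<in> null_sets M"
        using zero[of "Suc m"] mp_auts_image(1)[OF u(1) BM] mp_auts_image(1)[OF gm BM]
        by (auto simp: null_sets_def emeasure_eq_measure)
      from AE_not_in[OF this] show ?thesis
        using AE_space by eventually_elim (auto simp: mp_auts_image_eq[OF u(1) sub] mp_auts_image_eq[OF gm sub])
    qed
    then have "AE x in M. \<forall>m. inverse_map u x \<in> B (Suc m) \<longleftrightarrow> inverse_map g x \<in> B (Suc m)"
      unfolding AE_all_countable by blast
    then have "AE x in M. inverse_map u x = inverse_map g x"
      using AE_space
    proof eventually_elim
      case (elim x)
      let ?y = "inverse_map u x" and ?z = "inverse_map g x"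
      have sp: "?y \<in> space M" "?z \<in> space M" 
        using mp_autsD(5)[OF u(1)] mp_autsD(5)[OF gm] elim(2) by auto
      have rat: "e ?y \<le> of_rat p \<longleftrightarrow> e ?z \<le> of_rat p" for p
      proof -
        obtain m where "p = q m" using q by (metis surjD)
        then show ?thesis using elim(1)[rule_format, of m] sp by (simp add: B_def)
      qed
      have "e ?y = e ?z"
      proof (rule ccontr)
        assume "e ?y \<noteq> e ?z"
        then consider "e ?y < e ?z" | "e ?z < e ?y" by linarith
        then show False
        proof cases
          case 1
          then obtain p where "e ?y < of_rat p" "of_rat p < e ?z" using of_rat_dense by blast
          then show False using rat[of p] by simp
        next
          case 2
          then obtain p where "e ?z < of_rat p" "of_rat p < e ?y" using of_rat_dense by blast
          then show False using rat[of p] by simp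
        qed
      qed
      then show ?case using r_e sp by metis
    qed
    from mp_auts_inv_AE[OF mp_auts_inv mp_auts_inv this]
    have "AE x in M. inverse_map (inverse_map u) x = inverse_map (inverse_map g) x" using u gm by simp
    then have "AE x in M. u x = g x"
      using AE_space by eventually_elim (simp add: mp_auts_inv_inv u gm)
    then have "S = cls g" using u gm by (simp add: cls_eq_iff)
    then show ?thesis using g by (simp add: cgroup_def)
  qed
  then have "(weak_topology M) closure_of cgroup \<subseteq> cgroup" by blast
  then show ?thesis
    using closure_of_subset_eq[of cgroup "weak_topology M"] top subgroup.subset[OF cgroup_subgroup] by simp
qed

end

section \<open>Non-amenability\<close>

definition invariant_mean :: "('g::group_add set \<Rightarrow> real) \<Rightarrow> bool" where
  "invariant_mean b \<longleftrightarrow> (\<forall>C. 0 \<le> b C) \<and> b UNIV = 1 \<and>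
     (\<forall>C D. C \<inter> D = {} \<longrightarrow> b (C \<union> D) = b C + b D) \<and> (\<forall>\<gamma> C. b {\<kappa>. \<gamma> + \<kappa> \<in> C} = b C)"

context bernoulli_action
begin

lemma inverse_act: "x \<in> space M \<Longrightarrow> inverse_map (act \<gamma>) x = act (- \<gamma>) x"
  using act_add[of _ "- \<gamma>" \<gamma>] act_add[of _ \<gamma> "- \<gamma>"] mp_autsD(3)[OF act_mp]
  by (intro mp_autsI(2)) (auto simp: act_zero)

lemma act_cauts: "cocycle (\<lambda>_. \<gamma>) (act \<gamma>)" "act \<gamma> \<in> cauts"
proof -
  show "cocycle (\<lambda>_. \<gamma>) (act \<gamma>)" for \<gamma> by (simp add: cocycle_def)
  then have "cocycle (\<lambda>_. - \<gamma>) (inverse_map (act \<gamma>))"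
    by (rule cocycle_AE) (use AE_space in \<open>eventually_elim, simp add: inverse_act\<close>)
  then show "act \<gamma> \<in> cauts" using act_mp \<open>cocycle (\<lambda>_. \<gamma>) (act \<gamma>)\<close> by (auto simp: cauts_def)
qed

text \<open>The compact space on which the group acts without invariant measure consists of the finitely
  additive measures with first marginal \<open>M\<close> on the sets below.\<close>

definition slices :: "('a \<times> 'g) set set" where
  "slices = {W. W \<subseteq> space M \<times> UNIV \<and> (\<forall>\<kappa>. {x \<in> space M. (x, \<kappa>) \<in> W} \<in> sets M)}"

text \<open>The preimage of \<open>W\<close> under the skew product sending
  \<open>(x, \<kappa>)\<close> to \<open>(f x, h x + \<kappa>)\<close>.\<close>

definition pull :: "('a \<Rightarrow> 'a) \<Rightarrow> ('a \<Rightarrow> 'g) \<Rightarrow> ('a \<times> 'g) set \<Rightarrow> ('a \<times> 'g) set" where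
  "pull f h W = {(x, \<kappa>). x \<in> space M \<and> (f x, h x + \<kappa>) \<in> W}"

text \<open>Finite additivity and the marginal condition are equations between values at fixed sets,
  hence closed in the product of unit intervals. Finite additivity is what compactness permits on
  the group component, while the marginal ties the first component to \<open>M\<close>.\<close>

definition fibered :: "(('a \<times> 'g) set \<Rightarrow> real) set" where
  "fibered = {z \<in> slices \<rightarrow>\<^sub>E {0..1}.
     (\<forall>V\<in>slices. \<forall>W\<in>slices. V \<inter> W = {} \<longrightarrow> z (V \<union> W) = z V + z W) \<and>
     (\<forall>E\<in>sets M. z (E \<times> UNIV) = measure M E)}"

lemma slices_ops:
  assumes "V \<in> slices" "W \<in> slices"
  shows "V \<union> W \<in> slices" "V \<inter> W \<in> slices" "V - W \<in> slices"
proof -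
  have "{x \<in> space M. (x, \<kappa>) \<in> V \<union> W} = {x \<in> space M. (x, \<kappa>) \<in> V} \<union> {x \<in> space M. (x, \<kappa>) \<in> W}"
    "{x \<in> space M. (x, \<kappa>) \<in> V \<inter> W} = {x \<in> space M. (x, \<kappa>) \<in> V} \<inter> {x \<in> space M. (x, \<kappa>) \<in> W}"
    "{x \<in> space M. (x, \<kappa>) \<in> V - W} = {x \<in> space M. (x, \<kappa>) \<in> V} - {x \<in> space M. (x, \<kappa>) \<in> W}" for \<kappa>
    by auto
  then show "V \<union> W \<in> slices" "V \<inter> W \<in> slices" "V - W \<in> slices"
    using assms unfolding slices_def by auto
qed

lemma slices_Times: "E \<in> sets M \<Longrightarrow> E \<times> C \<in> slices"
proof -
  assume E: "E \<in> sets M"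
  have "{x \<in> space M. (x, \<kappa>) \<in> E \<times> C} = (if \<kappa> \<in> C then E else {})" for \<kappa>
    using sets.sets_into_space[OF E] by auto
  then show ?thesis using E sets.sets_into_space[OF E] by (auto simp: slices_def)
qed

lemma pull_slices:
  assumes f: "f \<in> measurable M M" and h: "h \<in> measurable M (count_space UNIV)" and W: "W \<in> slices"
  shows "pull f h W \<in> slices"
proof -
  have "{x \<in> space M. (x, \<kappa>) \<in> pull f h W} \<in> sets M" for \<kappa>
  proof -
    have "{x \<in> space M. (x, \<kappa>) \<in> pull f h W}
        = (\<Union>\<gamma>. (h -` {\<gamma>} \<inter> space M) \<inter> (f -` {x \<in> space M. (x, \<gamma> + \<kappa>) \<in> W} \<inter> space M))"
      using W by (auto simp: pull_def slices_def)
    also have "\<dots> \<in> sets M"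
      using W by (intro sets.countable_UN'' sets.Int measurable_sets[OF f] measurable_sets[OF h])
        (auto simp: slices_def)
    finally show ?thesis .
  qed
  then show ?thesis by (auto simp: slices_def pull_def)
qed

lemma fiberedD:
  assumes "z \<in> fibered"
  shows "W \<in> slices \<Longrightarrow> 0 \<le> z W" "W \<in> slices \<Longrightarrow> z W \<le> 1"
    "V \<in> slices \<Longrightarrow> W \<in> slices \<Longrightarrow> V \<inter> W = {} \<Longrightarrow> z (V \<union> W) = z V + z W"
    "E \<in> sets M \<Longrightarrow> z (E \<times> UNIV) = measure M E"
    "z \<in> extensional slices"
  using assms by (auto simp: fibered_def PiE_def Pi_def)

text \<open>\<open>V\<close> and \<open>W\<close> differ only over the base set \<open>D\<close>, so
  both differences lie in \<open>D \<times> UNIV\<close>, whose value is prescribed by the marginal.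
  This one estimate yields independence of representatives, the action law and continuity.\<close>

lemma fibered_diff_le:
  assumes z: "z \<in> fibered" and VW: "V \<in> slices" "W \<in> slices"
    and E: "E \<in> sets M" and ae: "AE x in M. x \<notin> E \<longrightarrow> (\<forall>\<kappa>. (x, \<kappa>) \<in> V \<longleftrightarrow> (x, \<kappa>) \<in> W)"
  shows "\<bar>z V - z W\<bar> \<le> measure M E"
proof -
  define D where "D = (\<Union>\<kappa>. sym_diff {x \<in> space M. (x, \<kappa>) \<in> V} {x \<in> space M. (x, \<kappa>) \<in> W})"
  have D: "D \<in> sets M"
    unfolding D_def using VW by (intro sets.countable_UN'') (auto simp: slices_def)
  have DE: "measure M D \<le> measure M E"
    by (rule finite_measure_mono_AE[OF _ E]) (use ae in \<open>eventually_elim, auto simp: D_def\<close>)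
  have le: "z (A - B) \<le> measure M D" and eq: "z A = z (A \<inter> B) + z (A - B)"
    if AB: "(A = V \<and> B = W) \<or> (A = W \<and> B = V)" for A B
  proof -
    have S: "A \<in> slices" "B \<in> slices" using AB VW by auto
    have sub: "A - B \<subseteq> D \<times> UNIV" using AB VW by (auto simp: D_def slices_def)
    have "z (D \<times> UNIV) = z (A - B) + z (D \<times> UNIV - (A - B))"
    proof -
      have "z ((A - B) \<union> (D \<times> UNIV - (A - B))) = z (A - B) + z (D \<times> UNIV - (A - B))"
        by (rule fiberedD(3)[OF z slices_ops(3)[OF S] slices_ops(3)[OF slices_Times[OF D] slices_ops(3)[OF S]]])
          blast
      moreover have "(A - B) \<union> (D \<times> UNIV - (A - B)) = D \<times> UNIV" using sub by blast
      ultimately show ?thesis by (simp only:)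
    qed
    then show "z (A - B) \<le> measure M D"
      using fiberedD(1)[OF z slices_ops(3)[OF slices_Times[OF D] slices_ops(3)[OF S]]] fiberedD(4)[OF z D]
      by simp
    show "z A = z (A \<inter> B) + z (A - B)"
      using fiberedD(3)[OF z slices_ops(2,3)[OF S]] by (simp add: Int_Diff_Un Int_Diff_disjoint)
  qed
  have "z V = z (V \<inter> W) + z (V - W)" "z W = z (V \<inter> W) + z (W - V)"
    using eq[of V W] eq[of W V] by (auto simp: Int_commute)
  moreover have "0 \<le> z (V - W)" "0 \<le> z (W - V)"
    using VW by (auto intro!: fiberedD(1)[OF z] slices_ops)
  ultimately show ?thesis using le[of V W] le[of W V] DE by auto
qed

lemma fibered_pull:
  assumes z: "z \<in> fibered" and f: "f \<in> mp_auts M" and h: "h \<in> measurable M (count_space UNIV)"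
  shows "(\<lambda>W\<in>slices. z (pull f h W)) \<in> fibered"
proof -
  note ps = pull_slices[OF mp_autsD(1)[OF f] h]
  have "pull f h V \<inter> pull f h W = {}" "pull f h (V \<union> W) = pull f h V \<union> pull f h W"
    if "V \<inter> W = {}" for V W
    using that by (auto simp: pull_def)
  then have add: "z (pull f h (V \<union> W)) = z (pull f h V) + z (pull f h W)"
    if "V \<in> slices" "W \<in> slices" "V \<inter> W = {}" for V W
    using that fiberedD(3)[OF z ps ps] by simp
  have "z (pull f h (E \<times> UNIV)) = measure M E" if E: "E \<in> sets M" for E
  proof -
    have "pull f h (E \<times> UNIV) = {x \<in> space M. f x \<in> E} \<times> UNIV" by (auto simp: pull_def)
    moreover have "{x \<in> space M. f x \<in> E} \<in> sets M"
      using measurable_sets[OF mp_autsD(1)[OF f] E] by (simp add: vimage_def Int_def conj_commute)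
    ultimately show ?thesis using fiberedD(4)[OF z] mp_auts_measure[OF f E] by simp
  qed
  then show ?thesis
    using add fiberedD(1,2)[OF z ps] slices_ops(1) slices_Times
    unfolding fibered_def by auto
qed

text \<open>\<open>pull\<close> uses the cocycle of the map itself, whereas
  \<open>marker_dist\<close> measures those of the inverses; hence the passage to inverses and
  back.\<close>

lemma fibered_pull_diff:
  assumes z: "z \<in> fibered" and W: "W \<in> slices"
    and fg: "f \<in> cauts" "g \<in> cauts" and hk: "cocycle h f" "cocycle k g"
  shows "\<bar>z (pull f h W) - z (pull g k W)\<bar> \<le> 2 * marker_dist f g"
proof -
  have mp: "f \<in> mp_auts M" "g \<in> mp_auts M" using fg by (auto simp: cauts_def)
  note hm = cocycle_measurable(2)[OF hk(1)] and km = cocycle_measurable(2)[OF hk(2)]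
  have ae: "AE x in M. f x = act (h x) x" "AE x in M. g x = act (k x) x"
    using hk by (auto simp: cocycle_def)
  have "\<bar>z (pull f h W) - z (pull g k W)\<bar> \<le> prob {x \<in> space M. h x \<noteq> k x}"
  proof (rule fibered_diff_le[OF z pull_slices[OF mp_autsD(1)[OF mp(1)] hm W]
        pull_slices[OF mp_autsD(1)[OF mp(2)] km W] cocycle_neq_sets[OF hm km]])
    show "AE x in M. x \<notin> {x \<in> space M. h x \<noteq> k x} \<longrightarrow>
        (\<forall>\<kappa>. (x, \<kappa>) \<in> pull f h W \<longleftrightarrow> (x, \<kappa>) \<in> pull g k W)"
      using ae by eventually_elim (auto simp: pull_def)
  qed
  also have "\<dots> = 2 * marker_dist (inverse_map f) (inverse_map g)"
  proof (rule cocycle_marker_dist)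
    show "cocycle h (inverse_map (inverse_map f))" "cocycle k (inverse_map (inverse_map g))"
      by (rule cocycle_AE[OF hk(1)] cocycle_AE[OF hk(2)];
          use AE_space in \<open>eventually_elim, simp add: mp_auts_inv_inv mp\<close>)+
  qed (auto intro: mp_auts_inv mp)
  also have "\<dots> \<le> 2 * marker_dist f g" using marker_dist_inv[OF fg] by simp
  finally show ?thesis .
qed

text \<open>Group elements are classes, so a map and a cocycle have to be chosen; by
  \<open>push_cls\<close> the resulting action does not depend on the choice.\<close>

definition rep :: "('a \<Rightarrow> 'a) set \<Rightarrow> ('a \<Rightarrow> 'a) \<times> ('a \<Rightarrow> 'g)" where
  "rep S = (SOME p. fst p \<in> cauts \<and> S = cls (fst p) \<and> cocycle (snd p) (fst p))"

lemma rep: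
  assumes "S \<in> cgroup"
  shows "fst (rep S) \<in> cauts" "fst (rep S) \<in> mp_auts M" "S = cls (fst (rep S))"
    "cocycle (snd (rep S)) (fst (rep S))"
proof -
  obtain f where f: "f \<in> cauts" "S = cls f" using assms by (auto simp: cgroup_def)
  then obtain h where "cocycle h f" by (meson cautsE)
  with f have "\<exists>p. fst p \<in> cauts \<and> S = cls (fst p) \<and> cocycle (snd p) (fst p)"
    by (intro exI[of _ "(f, h)"]) auto
  then have "fst (rep S) \<in> cauts \<and> S = cls (fst (rep S)) \<and> cocycle (snd (rep S)) (fst (rep S))"
    unfolding rep_def by (rule someI_ex)
  then show "fst (rep S) \<in> cauts" "fst (rep S) \<in> mp_auts M" "S = cls (fst (rep S))"
    "cocycle (snd (rep S)) (fst (rep S))" by (auto simp: cauts_mp)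
qed

definition push :: "('a \<Rightarrow> 'a) set \<Rightarrow> (('a \<times> 'g) set \<Rightarrow> real) \<Rightarrow> ('a \<times> 'g) set \<Rightarrow> real" where
  "push S = (\<lambda>z\<in>fibered. \<lambda>W\<in>slices. z (pull (fst (rep S)) (snd (rep S)) W))"

lemma push_fibered: "S \<in> cgroup \<Longrightarrow> z \<in> fibered \<Longrightarrow> push S z \<in> fibered"
  using fibered_pull[of z "fst (rep S)" "snd (rep S)"] rep(2)[of S] cocycle_measurable(2)[OF rep(4)[of S]]
  by (simp add: push_def)

lemma push_cls:
  assumes "f \<in> cauts" "cocycle h f" "z \<in> fibered" "W \<in> slices"
  shows "push (cls f) z W = z (pull f h W)"
proof -
  have S: "cls f \<in> cgroup" using assms by (simp add: cgroup_def)
  have "\<bar>z (pull (fst (rep (cls f))) (snd (rep (cls f))) W) - z (pull f h W)\<bar>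
      \<le> 2 * marker_dist (fst (rep (cls f))) f"
    by (rule fibered_pull_diff) (use assms rep[OF S] in auto)
  also have "marker_dist (fst (rep (cls f))) f = gdist (cls f) (cls f)"
    using gdist_cls[OF rep(2)[OF S] cauts_mp[OF assms(1)]] rep(3)[OF S] by simp
  also have "\<dots> = 0" using S by simp
  finally show ?thesis using assms by (simp add: push_def)
qed

lemma push_diff_le:
  assumes "S \<in> cgroup" "T \<in> cgroup" "z \<in> fibered" "W \<in> slices"
  shows "\<bar>push S z W - push T z W\<bar> \<le> 2 * gdist S T"
proof -
  have "gdist S T = marker_dist (fst (rep S)) (fst (rep T))"
    using gdist_cls[OF rep(2)[OF assms(1)] rep(2)[OF assms(2)]]
      rep(3)[OF assms(1)] rep(3)[OF assms(2)] by simp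
  then show ?thesis
    using fibered_pull_diff[OF assms(3,4) rep(1)[OF assms(1)] rep(1)[OF assms(2)]
        rep(4)[OF assms(1)] rep(4)[OF assms(2)]] assms by (simp add: push_def)
qed

lemma push_one: "z \<in> fibered \<Longrightarrow> push (cls id) z = z"
proof (rule extensionalityI[of _ slices])
  assume z: "z \<in> fibered"
  show "push (cls id) z W = z W" if W: "W \<in> slices" for W
  proof -
    have "pull id (\<lambda>_. 0) W = W" using W by (auto simp: pull_def slices_def)
    then show ?thesis using push_cls[OF cauts_id cocycle_0 z W] by simp
  qed
qed (auto simp: push_def fiberedD(5))

text \<open>The skew product of a composition is the composition of skew products only almost
  everywhere, since a cocycle describes its map only up to a null set.
  \<open>fibered_diff_le\<close> with the empty exceptional set shows that no member of
  \<open>fibered\<close> notices this.\<close>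

lemma push_mult:
  assumes S: "S \<in> cgroup" and T: "T \<in> cgroup" and z: "z \<in> fibered"
  shows "push (S \<otimes>\<^bsub>Aut M\<^esub> T) z = push S (push T z)"
proof (rule extensionalityI[of _ slices])
  obtain f where f: "f \<in> cauts" "f \<in> mp_auts M" "S = cls f" using S by (rule cgroupE)
  obtain g where g: "g \<in> cauts" "g \<in> mp_auts M" "T = cls g" using T by (rule cgroupE)
  obtain h where h: "cocycle h f" using f by (meson cautsE)
  obtain k where k: "cocycle k g" using g by (meson cautsE)
  let ?m = "\<lambda>x. h (act (k x) x) + k x"
  note m = cocycle_comp[OF h k g(2)]
  note hm = cocycle_measurable(2)[OF h] and km = cocycle_measurable(2)[OF k]
  fix W assume W: "W \<in> slices"
  have P: "pull f h W \<in> slices" by (rule pull_slices[OF mp_autsD(1)[OF f(2)] hm W])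
  have Tz: "push T z \<in> fibered" by (rule push_fibered[OF T z])
  have "\<bar>z (pull (f \<circ> g) ?m W) - z (pull g k (pull f h W))\<bar> \<le> measure M {}"
  proof (rule fibered_diff_le[OF z])
    show "pull (f \<circ> g) ?m W \<in> slices"
      by (rule pull_slices[OF mp_autsD(1)[OF mp_auts_comp[OF f(2) g(2)]] cocycle_measurable(2)[OF m] W])
    show "pull g k (pull f h W) \<in> slices" by (rule pull_slices[OF mp_autsD(1)[OF g(2)] km P])
    have "AE x in M. g x = act (k x) x" using k by (simp add: cocycle_def)
    then show "AE x in M. x \<notin> {} \<longrightarrow>
        (\<forall>\<kappa>. (x, \<kappa>) \<in> pull (f \<circ> g) ?m W \<longleftrightarrow> (x, \<kappa>) \<in> pull g k (pull f h W))"
      using AE_space by eventually_elim (auto simp: pull_def add.assoc mp_autsD(4)[OF g(2)] act_space)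
  qed simp
  then have "push (cls (f \<circ> g)) z W = z (pull g k (pull f h W))"
    using push_cls[OF cauts_comp[OF f(1) g(1)] m z W] by simp
  also have "\<dots> = push T z (pull f h W)" using push_cls[OF g(1) k z P] g(3) by simp
  also have "\<dots> = push S (push T z) W" using push_cls[OF f(1) h Tz W] f(3) by simp
  finally show "push (S \<otimes>\<^bsub>Aut M\<^esub> T) z W = push S (push T z) W"
    using f g by (simp add: Aut_mult_class)
qed (use push_fibered[OF T z] z in \<open>auto simp: push_def\<close>)

section \<open>Compactness of the space of fibered means and continuity of the action\<close>

definition ftop :: "(('a \<times> 'g) set \<Rightarrow> real) topology" where
  "ftop = subtopology (product_topology (\<lambda>_. top_of_set {0..1}) slices) fibered"

lemma topspace_ftop [simp]: "topspace ftop = fibered"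
  by (auto simp: ftop_def fibered_def)

lemma continuous_coordinate: "W \<in> slices \<Longrightarrow> continuous_map ftop euclideanreal (\<lambda>z. z W)"
  using continuous_map_product_projection[of W slices "\<lambda>_. top_of_set {0..1::real}"]
  by (simp add: ftop_def continuous_map_from_subtopology continuous_map_in_subtopology)

lemma Hausdorff_ftop: "Hausdorff_space ftop"
  unfolding ftop_def
  by (intro Hausdorff_space_subtopology) (simp add: Hausdorff_space_product_topology Hausdorff_space_subtopology)

lemma compact_ftop: "compact_space ftop"
proof -
  let ?P = "product_topology (\<lambda>_. top_of_set {0..1::real}) slices"
  have c: "continuous_map ?P euclideanreal (\<lambda>z. z W)" if "W \<in> slices" for W
    using continuous_map_product_projection[of W slices "\<lambda>_. top_of_set {0..1::real}"] that
    by (simp add: continuous_map_in_subtopology)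
  have "closedin ?P {z \<in> topspace ?P. z (V \<union> W) = z V + z W}" if "V \<in> slices" "W \<in> slices" for V W
    by (intro closedin_continuous_maps_eq[OF _ c continuous_map_add[OF c c]] slices_ops that
        Hausdorff_space_euclidean)
  moreover have "closedin ?P {z \<in> topspace ?P. z (E \<times> UNIV) = measure M E}" if "E \<in> sets M" for E
    using that by (intro closedin_continuous_maps_eq[OF _ c] slices_Times Hausdorff_space_euclidean) auto
  ultimately have "closedin ?P (\<Inter>({topspace ?P} \<union>
      {{z \<in> topspace ?P. z (V \<union> W) = z V + z W} |V W. V \<in> slices \<and> W \<in> slices \<and> V \<inter> W = {}} \<union>
      {{z \<in> topspace ?P. z (E \<times> UNIV) = measure M E} |E. E \<in> sets M}))"
    by (intro closedin_Inter) (auto simp del: topspace_product_topology)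
  also have "\<Inter>({topspace ?P} \<union>
      {{z \<in> topspace ?P. z (V \<union> W) = z V + z W} |V W. V \<in> slices \<and> W \<in> slices \<and> V \<inter> W = {}} \<union>
      {{z \<in> topspace ?P. z (E \<times> UNIV) = measure M E} |E. E \<in> sets M}) = fibered"
  proof (intro Set.set_eqI)
    fix z
    show "z \<in> \<Inter>({topspace ?P} \<union>
      {{z \<in> topspace ?P. z (V \<union> W) = z V + z W} |V W. V \<in> slices \<and> W \<in> slices \<and> V \<inter> W = {}} \<union>
      {{z \<in> topspace ?P. z (E \<times> UNIV) = measure M E} |E. E \<in> sets M}) \<longleftrightarrow> z \<in> fibered"
      unfolding fibered_def by (simp add: Ball_def) blast
  qed
  finally have "closedin ?P fibered" .
  moreover have "compact_space ?P" by (simp add: compact_space_product_topology compact_space_subtopology)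
  ultimately show ?thesis unfolding ftop_def
    by (intro compact_space_subtopology closedin_compact_space)
qed

lemma fibered_nonempty: "fibered \<noteq> {}"
proof -
  \<comment> \<open>The product of \<open>M\<close> with the point mass at the neutral
    element.\<close>
  let ?z = "\<lambda>W\<in>slices. measure M {x \<in> space M. (x, 0) \<in> W}"
  have "measure M {x \<in> space M. (x, 0) \<in> V \<union> W}
      = measure M {x \<in> space M. (x, 0) \<in> V} + measure M {x \<in> space M. (x, 0) \<in> W}"
    if "V \<in> slices" "W \<in> slices" "V \<inter> W = {}" for V W
  proof -
    have "{x \<in> space M. (x, 0) \<in> V \<union> W} = {x \<in> space M. (x, 0) \<in> V} \<union> {x \<in> space M. (x, 0) \<in> W}" by auto
    moreover have "measure M ({x \<in> space M. (x, 0) \<in> V} \<union> {x \<in> space M. (x, 0) \<in> W})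
        = measure M {x \<in> space M. (x, 0) \<in> V} + measure M {x \<in> space M. (x, 0) \<in> W}"
      using that by (intro finite_measure_Union) (auto simp: slices_def)
    ultimately show ?thesis by simp
  qed
  moreover have "measure M {x \<in> space M. (x, 0 :: 'g) \<in> E \<times> UNIV} = measure M E" if "E \<in> sets M" for E
  proof -
    have "{x \<in> space M. (x, 0 :: 'g) \<in> E \<times> UNIV} = E" using sets.sets_into_space[OF that] by auto
    then show ?thesis by simp
  qed
  ultimately have "?z \<in> fibered"
    unfolding fibered_def by (auto simp: slices_ops slices_Times prob_le_1)
  then show ?thesis by blast
qed

text \<open>Joint continuity is checked at each coordinate \<open>W\<close>, comparing
  \<open>(S, z)\<close> with \<open>(T, y)\<close> through \<open>(S, y)\<close>. The first
  difference is that of \<open>z\<close> and \<open>y\<close> at the fixed set \<open>?V\<close>;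
  the second is at most \<open>2 * gdist S T\<close> uniformly in \<open>y\<close>. Radii
  \<epsilon>/2 and \<epsilon>/4 absorb the factor 2.\<close>

lemma continuous_action_push: "continuous_action cgrp ctop ftop push"
proof -
  interpret cgrp: group cgrp by (rule group_cgrp)
  have cl: "inv\<^bsub>cgrp\<^esub> S \<in> cgroup" if "S \<in> cgroup" for S using cgrp.inv_closed that by simp
  have cancel: "push (inv\<^bsub>cgrp\<^esub> S) (push S z) = z" "push S (push (inv\<^bsub>cgrp\<^esub> S) z) = z"
    if "S \<in> cgroup" "z \<in> fibered" for S z
    using push_mult[OF cl[OF that(1)] that] push_mult[OF that(1) cl[OF that(1)] that(2)]
      cgrp.l_inv[of S] cgrp.r_inv[of S] that push_one by (simp_all add: one_Aut)
  have bij: "push S \<in> Bij fibered" if S: "S \<in> cgroup" for S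
  proof -
    have "bij_betw (push S) fibered fibered"
      by (rule bij_betwI[where g = "push (inv\<^bsub>cgrp\<^esub> S)"]) (use S cl cancel push_fibered in auto)
    then show ?thesis by (simp add: Bij_def push_def)
  qed
  have "group_action cgrp fibered push"
    unfolding group_action_def group_hom_def group_hom_axioms_def
  proof (intro conjI homI)
    show "push S \<in> carrier (BijGroup fibered)" if "S \<in> carrier cgrp" for S
      using bij that by (simp add: BijGroup_def)
    show "push (S \<otimes>\<^bsub>cgrp\<^esub> T) = push S \<otimes>\<^bsub>BijGroup fibered\<^esub> push T"
      if "S \<in> carrier cgrp" "T \<in> carrier cgrp" for S T
    proof (rule extensionalityI[of _ fibered])
      show "push (S \<otimes>\<^bsub>cgrp\<^esub> T) z = (push S \<otimes>\<^bsub>BijGroup fibered\<^esub> push T) z" if "z \<in> fibered" for z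
        using push_mult[of S T z] that \<open>S \<in> carrier cgrp\<close> \<open>T \<in> carrier cgrp\<close> bij
        by (simp add: BijGroup_def compose_eq)
    qed (use that bij in \<open>simp_all add: push_def BijGroup_def\<close>)
  qed (simp_all add: group_cgrp group_BijGroup)
  moreover have "continuous_map (prod_topology ctop ftop) ftop (\<lambda>(S, z). push S z)"
  proof -
    have coord: "continuous_map (prod_topology ctop ftop) (top_of_set {0..1}) (\<lambda>p. (case p of (S, z) \<Rightarrow> push S z) W)"
      if W: "W \<in> slices" for W
    proof -
    have "continuous_map (prod_topology ctop ftop) euclideanreal (\<lambda>p. push (fst p) (snd p) W)"
      unfolding mtopology_is_euclidean[symmetric] Met_TC.continuous_map_to_metric
    proof (intro ballI allI impI)
      fix p and \<epsilon> :: real assume "p \<in> topspace (prod_topology ctop ftop)" and \<epsilon>: "\<epsilon> > 0"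
      then obtain S z where p: "p = (S, z)" and S: "S \<in> cgroup" and z: "z \<in> fibered"
        by (auto simp: ctop_eq)
      let ?V = "pull (fst (rep S)) (snd (rep S)) W"
      have V: "?V \<in> slices"
        by (rule pull_slices[OF mp_autsD(1)[OF rep(2)[OF S]] cocycle_measurable(2)[OF rep(4)[OF S]] W])
      let ?O = "{y \<in> topspace ftop. y ?V \<in> ball (z ?V) (\<epsilon>/2)}"
      have O: "openin ftop ?O"
        by (rule openin_continuous_map_preimage[OF continuous_coordinate[OF V]]) simp
      show "\<exists>U. openin (prod_topology ctop ftop) U \<and> p \<in> U \<and>
          (\<forall>q\<in>U. push (fst q) (snd q) W \<in> Met_TC.mball (push (fst p) (snd p) W) \<epsilon>)"
      proof (intro exI[of _ "cg.mball S (\<epsilon>/4) \<times> ?O"] conjI ballI)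
        show "openin (prod_topology ctop ftop) (cg.mball S (\<epsilon>/4) \<times> ?O)"
          using O by (simp add: openin_prod_Times_iff ctop_eq)
        show "p \<in> cg.mball S (\<epsilon>/4) \<times> ?O" using p S z \<epsilon> by simp
        fix q assume "q \<in> cg.mball S (\<epsilon>/4) \<times> ?O"
        then obtain T y where q: "q = (T, y)" "T \<in> cgroup" "gdist S T < \<epsilon>/4" "y \<in> fibered"
          "dist (z ?V) (y ?V) < \<epsilon>/2" by (auto simp: cg.in_mball)
        have "push S z W = z ?V" "push S y W = y ?V" using z q W by (auto simp: push_def)
        then have "dist (push S z W) (push T y W) < \<epsilon>"
          using push_diff_le[OF S q(2,4) W] q(3,5) unfolding dist_real_def by linarith
        then show "push (fst q) (snd q) W \<in> Met_TC.mball (push (fst p) (snd p) W) \<epsilon>"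
          using p q by simp
      qed
    qed
    moreover have "push (fst p) (snd p) W \<in> {0..1}" if "p \<in> topspace (prod_topology ctop ftop)" for p
      using that fiberedD(1,2)[OF push_fibered W] by (auto simp: ctop_eq)
    ultimately show "continuous_map (prod_topology ctop ftop) (top_of_set {0..1}) (\<lambda>p. (case p of (S, z) \<Rightarrow> push S z) W)"
      by (auto simp: continuous_map_in_subtopology case_prod_beta)
    qed
    have mem: "push S z \<in> fibered" "push S z \<in> extensional slices"
      if "(S, z) \<in> topspace (prod_topology ctop ftop)" for S z
      using that push_fibered fiberedD(5) by (auto simp: ctop_eq)
    have "continuous_map (prod_topology ctop ftop) (product_topology (\<lambda>_. top_of_set {0..1}) slices)
        (\<lambda>(S, z). push S z)"
      by (subst continuous_map_componentwise) (use coord mem in auto)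
    then show ?thesis
      by (subst ftop_def) (use mem in \<open>auto simp: continuous_map_in_subtopology\<close>)
  qed
  ultimately show ?thesis by (simp add: continuous_action_def)
qed

text \<open>The mean of \<open>C\<close> is the average of \<open>z (space M \<times> C)\<close>
  over an invariant measure. Since \<open>act \<gamma>\<close> has the constant cocycle \<gamma> and
  maps the space to itself, its skew product merely translates \<open>C\<close>.\<close>

theorem amenable_imp_invariant_mean:
  assumes "amenable cgrp ctop"
  obtains b :: "'g set \<Rightarrow> real" where "invariant_mean b"
proof -
  have "has_invariant_measure cgrp ftop push"
    using assms topological_group_cgrp fibered_nonempty compact_ftop Hausdorff_ftop continuous_action_push
    by (intro amenable_any_space) auto
  then obtain N where N: "regular_borel_prob ftop N"
    and inv: "\<And>S. S \<in> cgroup \<Longrightarrow> distr N N (push S) = N"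
    unfolding has_invariant_measure_def by auto
  interpret N: prob_space N using N by (simp add: regular_borel_prob_def)
  have sN: "sets N = sets (borel_of ftop)" using N by (simp add: regular_borel_prob_def)
  have spN: "space N = fibered" using sets_eq_imp_space_eq[OF sN] by (simp add: space_borel_of)
  have sR: "sets (borel_of euclideanreal) = sets borel" by (simp add: sets_borel_of borel_def)
  have coord: "(\<lambda>z. z W) \<in> borel_measurable N" if "W \<in> slices" for W
    using continuous_map_borel_of[OF continuous_coordinate[OF that]]
    unfolding measurable_cong_sets[OF sN sR[symmetric]] .
  have pushm: "push S \<in> measurable N N" if "S \<in> cgroup" for S
  proof -
    have "continuous_map ftop (prod_topology ctop ftop) (\<lambda>z. (S, z))"
      using that by (simp add: continuous_map_pairedI ctop_eq)
    from continuous_map_compose[OF this, of ftop "\<lambda>(S, z). push S z"]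
    have "continuous_map ftop ftop (push S)"
      using continuous_action_push by (simp add: continuous_action_def comp_def)
    then show ?thesis using continuous_map_borel_of measurable_cong_sets[OF sN sN] by blast
  qed
  have int: "integrable N (\<lambda>z. z W)" if "W \<in> slices" for W
    by (rule N.integrable_const_bound[where B = 1])
      (use coord that fiberedD(1,2) in \<open>auto simp: spN intro!: AE_I2\<close>)
  have sl: "space M \<times> C \<in> slices" for C :: "'g set" by (rule slices_Times) simp
  define b where "b C = (\<integral>z. z (space M \<times> C) \<partial>N)" for C :: "'g set"
  have "invariant_mean b"
    unfolding invariant_mean_def
  proof (intro conjI allI impI)
    show "0 \<le> b C" for C
      unfolding b_def by (rule Bochner_Integration.integral_nonneg) (auto simp: spN fiberedD(1)[OF _ sl])
    have "b UNIV = (\<integral>z. 1 \<partial>N)"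
      unfolding b_def by (rule Bochner_Integration.integral_cong) (auto simp: spN fiberedD(4) prob_space)
    then show "b UNIV = 1" by (simp add: N.prob_space)
    show "b (C \<union> D) = b C + b D" if CD: "C \<inter> D = {}" for C D
    proof -
      have "b (C \<union> D) = (\<integral>z. z (space M \<times> C) + z (space M \<times> D) \<partial>N)"
        unfolding b_def
      proof (rule Bochner_Integration.integral_cong)
        fix z assume "z \<in> space N"
        then have "z (space M \<times> C \<union> space M \<times> D) = z (space M \<times> C) + z (space M \<times> D)"
          using CD by (intro fiberedD(3) sl) (auto simp: spN)
        then show "z (space M \<times> (C \<union> D)) = z (space M \<times> C) + z (space M \<times> D)"
          by (simp add: Sigma_Un_distrib2)
      qed simp
      also have "\<dots> = b C + b D"
        unfolding b_def by (intro Bochner_Integration.integral_add int sl)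
      finally show ?thesis .
    qed
    show "b {\<kappa>. \<gamma> + \<kappa> \<in> C} = b C" for \<gamma> C
    proof -
      let ?S = "cls (act \<gamma>)"
      have S: "?S \<in> cgroup" using act_cauts by (simp add: cgroup_def)
      have "b C = (\<integral>z. z (space M \<times> C) \<partial>distr N N (push ?S))" by (simp add: b_def inv[OF S])
      also have "\<dots> = (\<integral>z. push ?S z (space M \<times> C) \<partial>N)"
        by (rule integral_distr[OF pushm[OF S] coord[OF sl]])
      also have "\<dots> = b {\<kappa>. \<gamma> + \<kappa> \<in> C}"
        unfolding b_def
      proof (rule Bochner_Integration.integral_cong)
        fix z assume "z \<in> space N"
        then have "push ?S z (space M \<times> C) = z (pull (act \<gamma>) (\<lambda>_. \<gamma>) (space M \<times> C))"
          by (intro push_cls act_cauts sl) (simp add: spN)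
        moreover have "pull (act \<gamma>) (\<lambda>_. \<gamma>) (space M \<times> C) = space M \<times> {\<kappa>. \<gamma> + \<kappa> \<in> C}"
          by (auto simp: pull_def act_space)
        ultimately show "push ?S z (space M \<times> C) = z (space M \<times> {\<kappa>. \<gamma> + \<kappa> \<in> C})" by simp
      qed simp
      finally show ?thesis by simp
    qed
  qed
  then show ?thesis by (rule that)
qed

end

section \<open>Whirliness\<close>

context bernoulli_action
begin

lemma act_image:
  assumes "B \<subseteq> space M"
  shows "act \<gamma> ` B = {x \<in> space M. act (- \<gamma>) x \<in> B}"
  using mp_auts_image_eq[OF act_mp assms] by (auto simp: inverse_act)

text \<open>\<open>generate\<close> replaces \<open>B\<close>, up to a null set, by a set of
  \<open>cyl UNIV\<close>, which is generated by the algebra of cylinders over finite index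
  sets.\<close>

lemma cylinder_approximation:
  assumes B: "B \<in> sets M" and \<epsilon>: "\<epsilon> > 0"
  obtains I C where "finite I" "C \<in> sets (cyl I)" "prob (sym_diff B C) < \<epsilon>"
proof -
  let ?\<A> = "\<Union>I\<in>{I. finite I}. sets (cyl I)"
  have AM: "?\<A> \<subseteq> sets M" using cyl_subset by blast
  have alg: "algebra (space M) ?\<A>"
  proof (rule algebra_iff_Un[THEN iffD2], intro conjI ballI)
    show "?\<A> \<subseteq> Pow (space M)" using AM sets.sets_into_space by blast
    show "{} \<in> ?\<A>" by (rule UN_I[of "{}"]) simp_all
    show "space M - X \<in> ?\<A>" if "X \<in> ?\<A>" for X
    proof -
      obtain I where I: "finite I" "X \<in> sets (cyl I)" using \<open>X \<in> ?\<A>\<close> by blast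
      have "space M - X \<in> sets (cyl I)" using sets.compl_sets[OF I(2)] by simp
      then show ?thesis using I(1) by blast
    qed
    show "X \<union> Y \<in> ?\<A>" if "X \<in> ?\<A>" "Y \<in> ?\<A>" for X Y
    proof -
      obtain I J where IJ: "finite I" "X \<in> sets (cyl I)" "finite J" "Y \<in> sets (cyl J)"
        using \<open>X \<in> ?\<A>\<close> \<open>Y \<in> ?\<A>\<close> by blast
      then have "X \<union> Y \<in> sets (cyl (I \<union> J))"
        using cyl_mono[of I "I \<union> J"] cyl_mono[of J "I \<union> J"] by blast
      then show ?thesis using IJ by blast
    qed
  qed
  have sub: "sets (cyl UNIV) \<subseteq> sigma_sets (space M) ?\<A>"
  proof
    fix X assume X: "X \<in> sets (cyl UNIV)"
    let ?N = "sigma (space M) ?\<A>"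
    have Pow: "?\<A> \<subseteq> Pow (space M)" using AM sets.sets_into_space by blast
    have sN: "sets ?N = sigma_sets (space M) ?\<A>" and spN: "space ?N = space M"
      using sets_measure_of[OF Pow] space_measure_of[OF Pow] by auto
    have "(\<lambda>x. x) \<in> measurable ?N (cyl UNIV)"
    proof (rule measurable_cyl_I)
      fix i
      have "\<xi> i \<in> borel_measurable (cyl {i})" by (rule xi_measurable_cyl) simp
      moreover have "sets (cyl {i}) \<subseteq> sets ?N"
      proof
        fix Y assume "Y \<in> sets (cyl {i})"
        then have "Y \<in> ?\<A>" by (intro UN_I[of "{i}"]) simp_all
        then show "Y \<in> sets ?N" unfolding sN by (rule sigma_sets.Basic)
      qed
      ultimately show "\<xi> i \<in> borel_measurable ?N"
        using spN by (auto simp: measurable_def)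
    qed (simp add: spN)
    from measurable_sets[OF this X] show "X \<in> sigma_sets (space M) ?\<A>"
      using sets.sets_into_space[OF X] by (simp add: sN spN Int_absorb2)
  qed
  obtain D where D: "D \<in> sets (PiM UNIV (\<lambda>_. borel))" and ae: "AE x in M. x \<in> B \<longleftrightarrow> (\<lambda>i. \<xi> i x) \<in> D"
    using generate[OF B] by blast
  let ?X = "(\<lambda>x. restrict (\<lambda>i. \<xi> i x) UNIV) -` D \<inter> space M"
  have X: "?X \<in> sets (cyl UNIV)" unfolding sets_cyl using D by blast
  then obtain C where C: "C \<in> ?\<A>" "prob (sym_diff ?X C) < \<epsilon>"
    using approximation_by_algebra[OF alg AM _ \<epsilon>] sub by blast
  then obtain I where I: "finite I" "C \<in> sets (cyl I)" by blast
  have XM: "?X \<in> sets M" "C \<in> sets M" using X I cyl_subset by auto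
  have "prob (sym_diff B C) \<le> prob (sym_diff ?X C)"
  proof (rule finite_measure_mono_AE)
    show "AE x in M. x \<in> sym_diff B C \<longrightarrow> x \<in> sym_diff ?X C"
      using ae AE_space by eventually_elim (auto simp: restrict_UNIV)
  qed (use XM in auto)
  then show ?thesis using that[OF I] C(2) by simp
qed

text \<open>Both sets are approximated by cylinders over finite \<open>I\<close> and
  \<open>J\<close>. A group element outside the finite set of differences moves \<open>J\<close> off
  \<open>I\<close>, so the approximants become independent.\<close>

lemma mixing:
  assumes C: "C \<in> sets M" "prob C > 0" and B: "B \<in> sets M" "prob B > 0"
  shows "\<exists>\<gamma>. prob (C \<inter> act \<gamma> ` B) > 0"
proof -
  \<comment> \<open>The product of the approximate measures loses at most
    \<open>2 * \<epsilon>\<close>, and replacing the two sets costs another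
    \<open>2 * \<epsilon>\<close>; half of \<open>prob C * prob B\<close> survives.\<close>
  define \<epsilon> where "\<epsilon> = prob C * prob B / 8"
  have \<epsilon>: "\<epsilon> > 0" using C B by (simp add: \<epsilon>_def)
  obtain I C' where I: "finite I" "C' \<in> sets (cyl I)" "prob (sym_diff C C') < \<epsilon>"
    using cylinder_approximation[OF C(1) \<epsilon>] by blast
  obtain J B' where J: "finite J" "B' \<in> sets (cyl J)" "prob (sym_diff B B') < \<epsilon>"
    using cylinder_approximation[OF B(1) \<epsilon>] by blast
  have "finite ((\<lambda>(i, j). fst i - fst j) ` (I \<times> J))" using I J by simp
  then obtain \<gamma> where \<gamma>: "\<gamma> \<notin> (\<lambda>(i, j). fst i - fst j) ` (I \<times> J)"
    using infinite_group ex_new_if_finite by blast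
  \<comment> \<open>The image under \<open>act \<gamma>\<close> is the preimage under
    \<open>act (- \<gamma>)\<close>, whence the double minus.\<close>
  let ?J = "(\<lambda>(\<delta>, b). (- (- \<gamma>) + \<delta>, b)) ` J"
  have disj: "I \<inter> ?J = {}"
  proof (rule ccontr)
    assume "I \<inter> ?J \<noteq> {}"
    then obtain \<delta> b where j: "(\<delta>, b) \<in> J" "(\<gamma> + \<delta>, b) \<in> I" by auto
    have "\<gamma> = fst (\<gamma> + \<delta>, b) - fst (\<delta>, b)" by simp
    then have "\<gamma> \<in> (\<lambda>(i, j). fst i - fst j) ` (I \<times> J)" using j by force
    with \<gamma> show False by simp
  qed
  have M: "C' \<in> sets M" "B' \<in> sets M" using I J cyl_subset by auto
  have sub: "B' \<subseteq> space M" using M sets.sets_into_space by blast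
  have "act \<gamma> ` B' \<in> sets (cyl ?J)"
    using measurable_sets[OF act_measurable_cyl[of "- \<gamma>" J] J(2)]
    by (simp add: act_image[OF sub] vimage_def Int_def conj_commute)
  then have "prob (C' \<inter> act \<gamma> ` B') = prob C' * prob (act \<gamma> ` B')"
    by (rule cyl_indep[OF disj I(2)])
  also have "prob (act \<gamma> ` B') = prob B'"
    using mp_auts_image(2)[OF act_mp M(2)] by (simp add: measure_def)
  finally have ind: "prob (C' \<inter> act \<gamma> ` B') = prob C' * prob B'" .
  have im: "act \<gamma> ` B \<in> sets M" "act \<gamma> ` B' \<in> sets M"
    using mp_auts_image(1)[OF act_mp] B M by auto
  have "prob C \<le> prob C' + prob (sym_diff C C')" "prob B \<le> prob B' + prob (sym_diff B B')"
    using M B C by (auto intro!: measure_le_Un_AE)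
  then have le: "prob C - \<epsilon> \<le> prob C'" "prob B - \<epsilon> \<le> prob B'" using I J by auto
  have pC: "prob C \<le> 1" and pB: "prob B \<le> 1" by auto
  have "\<epsilon> \<le> prob C" "\<epsilon> \<le> prob B"
  proof -
    have "prob C * prob B \<le> prob C * 1" "prob C * prob B \<le> 1 * prob B"
      by (rule mult_left_mono[OF pB] mult_right_mono[OF pC]; simp)+
    then show "\<epsilon> \<le> prob C" "\<epsilon> \<le> prob B" unfolding \<epsilon>_def using C B by linarith+
  qed
  then have "(prob C - \<epsilon>) * (prob B - \<epsilon>) \<le> prob C' * prob B'"
    using le by (intro mult_mono) auto
  moreover have "(prob C - \<epsilon>) * (prob B - \<epsilon>) \<ge> prob C * prob B - 2 * \<epsilon>"
  proof -
    have "prob C + prob B \<le> 2" using pC pB by linarith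
    then have "\<epsilon> * (prob C + prob B) \<le> \<epsilon> * 2" using \<epsilon> by (intro mult_left_mono) auto
    then have "prob C * prob B - 2 * \<epsilon> \<le> prob C * prob B - \<epsilon> * (prob C + prob B) + \<epsilon> * \<epsilon>"
      using zero_le_square[of \<epsilon>] by linarith
    also have "\<dots> = (prob C - \<epsilon>) * (prob B - \<epsilon>)" by (simp add: algebra_simps)
    finally show ?thesis .
  qed
  moreover have "prob (C' \<inter> act \<gamma> ` B') \<le> prob (C \<inter> act \<gamma> ` B) + prob (sym_diff C C' \<union> sym_diff (act \<gamma> ` B) (act \<gamma> ` B'))"
    using M B C im by (intro measure_le_Un_AE) auto
  moreover have "prob (sym_diff C C' \<union> sym_diff (act \<gamma> ` B) (act \<gamma> ` B'))
      \<le> prob (sym_diff C C') + prob (sym_diff (act \<gamma> ` B) (act \<gamma> ` B'))"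
    using M B C im by (intro measure_Un_le) auto
  moreover have "prob (sym_diff (act \<gamma> ` B) (act \<gamma> ` B')) = prob (sym_diff B B')"
    by (rule mp_auts_image_sym_diff[OF act_mp B(1) M(2)])
  ultimately have "prob (C \<inter> act \<gamma> ` B) > prob C * prob B - 4 * \<epsilon>"
    using ind I(3) J(3) by linarith
  moreover have "prob C * prob B = 8 * \<epsilon>" by (simp add: \<epsilon>_def)
  ultimately have "prob (C \<inter> act \<gamma> ` B) > 0" using \<epsilon> by linarith
  then show ?thesis by blast
qed

lemma prob_xi_cell:
  assumes "n > 0" "j < n"
  shows "prob {x \<in> space M. \<lfloor>real n * \<xi> i x\<rfloor> = int j} = 1 / real n"
proof -
  let ?S = "{y :: real. \<lfloor>real n * y\<rfloor> = int j}"
  have "?S = {real j / real n ..< (real j + 1) / real n}"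
    using assms by (auto simp: floor_eq_iff field_simps)
  moreover have "{0<..<1} \<inter> {real j / real n ..< (real j + 1) / real n}
      = (if j = 0 then {0 <..< 1 / real n} else {real j / real n ..< (real j + 1) / real n})"
  proof -
    have "(real j + 1) / real n \<le> 1" using assms by (simp add: field_simps)
    moreover have "0 < real j / real n" if "j \<noteq> 0" using assms that by simp
    ultimately show ?thesis by auto
  qed
  ultimately have "measure lborel ({0<..<1} \<inter> ?S) = 1 / real n"
    using assms by (auto simp: field_simps)
  moreover have "prob {x \<in> space M. \<xi> i x \<in> ?S} = measure lborel ({0<..<1} \<inter> ?S)"
    by (rule prob_xi) measurable
  ultimately show ?thesis by simp
qed

text \<open>The sets \<open>E j\<close> below, on which the coordinates at \<open>0\<close> and \<open>\<gamma>\<close> lie in different cells of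
  a partition of the unit interval, are disjoint from their translates and cover almost everything.\<close>

lemma small_displaced_set:
  assumes C: "C \<in> sets M" "prob C > 0" and \<gamma>: "\<gamma> \<noteq> 0" and \<epsilon>: "\<epsilon> > 0"
  obtains E where "E \<in> sets base" "prob E \<le> \<epsilon>" "E \<inter> act \<gamma> ` E = {}" "prob (C \<inter> act \<gamma> ` E) > 0"
proof -
  \<comment> \<open>The cell size 1/n bounds the measure of each \<open>E j\<close>, and also that
    of the set missed by all the translates; the latter must be smaller than
    \<open>prob C\<close>.\<close>
  obtain n where n: "n > 0" "1 / real n < min \<epsilon> (prob C)"
    using nat_approx_posE[of "min \<epsilon> (prob C)"] \<epsilon> C by (metis min_less_iff_conj zero_less_Suc)
  let ?q = "\<lambda>\<delta> x. \<lfloor>real n * \<xi> (\<delta>, False) x\<rfloor>"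
  define E where "E j = {x \<in> space M. ?q 0 x = int j \<and> ?q \<gamma> x \<noteq> int j}" for j
  have xb: "\<xi> (\<delta>, False) \<in> borel_measurable base" for \<delta>
    unfolding base_def by (rule xi_measurable_cyl) simp
  have Eb: "E j \<in> sets base" for j
  proof -
    note [measurable] = xb
    have "{x \<in> space base. ?q 0 x = int j \<and> ?q \<gamma> x \<noteq> int j} \<in> sets base" by measurable
    then show ?thesis by (simp add: E_def)
  qed
  have EM: "E j \<in> sets M" for j using Eb base_subset by blast
  have Esub: "E j \<subseteq> space M" for j by (auto simp: E_def)
  have aE: "act \<gamma> ` E j = {x \<in> space M. ?q \<gamma> x = int j \<and> ?q (\<gamma> + \<gamma>) x \<noteq> int j}" for j
    by (subst act_image[OF Esub]) (auto simp: E_def xi_act act_space)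
  have aEM: "act \<gamma> ` E j \<in> sets M" for j by (rule mp_auts_image(1)[OF act_mp EM])
  have small: "prob (E j) \<le> \<epsilon>" if "j < n" for j
  proof -
    have "prob (E j) \<le> prob {x \<in> space M. ?q 0 x = int j}"
      by (rule finite_measure_mono) (auto simp: E_def)
    also have "\<dots> = 1 / real n" by (rule prob_xi_cell[OF n(1) that])
    finally show ?thesis using n by simp
  qed
  \<comment> \<open>Up to the null set \<open>?Z\<close>, the images of the \<open>E j\<close> under
    \<open>act \<gamma>\<close> miss only \<open>?R\<close>, where the coordinates at
    \<open>\<gamma>\<close> and \<open>\<gamma> + \<gamma>\<close> share a cell. These coordinates
    are independent, so \<open>?R\<close> has probability n times 1/n squared, which is 1/n.\<close>
  let ?R = "\<Union>j<n. {x \<in> space M. ?q \<gamma> x = int j} \<inter> {x \<in> space M. ?q (\<gamma> + \<gamma>) x = int j}"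
  let ?Z = "{x \<in> space M. \<xi> (\<gamma>, False) x \<in> - {0<..<1}}"
  have R: "?R \<in> sets M" and Z: "?Z \<in> sets M" by measurable
  have "prob ?Z = 0" using prob_xi[of "- {0<..<1}" "(\<gamma>, False)"] by simp
  have indR: "prob ({x \<in> space M. ?q \<gamma> x = int j} \<inter> {x \<in> space M. ?q (\<gamma> + \<gamma>) x = int j})
      = 1 / real n * (1 / real n)" if j: "j < n" for j
  proof -
    have c: "{x \<in> space M. ?q \<delta> x = int j} \<in> sets (cyl {(\<delta>, False)})" for \<delta>
    proof -
      have [measurable]: "\<xi> (\<delta>, False) \<in> borel_measurable (cyl {(\<delta>, False)})"
        by (rule xi_measurable_cyl) simp
      have "{x \<in> space (cyl {(\<delta>, False)}). ?q \<delta> x = int j} \<in> sets (cyl {(\<delta>, False)})" by measurable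
      then show ?thesis by simp
    qed
    have "prob ({x \<in> space M. ?q \<gamma> x = int j} \<inter> {x \<in> space M. ?q (\<gamma> + \<gamma>) x = int j})
        = prob {x \<in> space M. ?q \<gamma> x = int j} * prob {x \<in> space M. ?q (\<gamma> + \<gamma>) x = int j}"
      by (rule cyl_indep[OF _ c c]) (use \<gamma> add_left_cancel[of \<gamma> \<gamma> 0] in auto)
    then show ?thesis by (simp only: prob_xi_cell[OF n(1) j])
  qed
  have "prob ?R \<le> (\<Sum>j<n. prob ({x \<in> space M. ?q \<gamma> x = int j} \<inter> {x \<in> space M. ?q (\<gamma> + \<gamma>) x = int j}))"
    by (rule measure_UNION_le) auto
  also have "\<dots> = (\<Sum>j<n. 1 / real n * (1 / real n))" by (rule sum.cong) (use indR in auto)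
  also have "\<dots> = 1 / real n" using n by simp
  finally have PR: "prob ?R < prob C" using n by simp
  have "\<exists>j<n. prob (C \<inter> act \<gamma> ` E j) > 0"
  proof (rule ccontr)
    assume "\<not> ?thesis"
    then have zero: "prob (C \<inter> act \<gamma> ` E j) = 0" if "j < n" for j
      using that by (meson measure_nonneg not_le antisym)
    have "prob (\<Union>j<n. C \<inter> act \<gamma> ` E j) \<le> (\<Sum>j<n. prob (C \<inter> act \<gamma> ` E j))"
      using C aEM by (intro measure_UNION_le) auto
    then have U0: "prob (\<Union>j<n. C \<inter> act \<gamma> ` E j) \<le> 0" using zero by simp
    have "C \<subseteq> (\<Union>j<n. C \<inter> act \<gamma> ` E j) \<union> (?R \<union> ?Z)"
    proof
      fix x assume x: "x \<in> C"
      then have sp: "x \<in> space M" using C sets.sets_into_space by blast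
      show "x \<in> (\<Union>j<n. C \<inter> act \<gamma> ` E j) \<union> (?R \<union> ?Z)"
      proof (cases "\<xi> (\<gamma>, False) x \<in> {0<..<1}")
        case True
        then have "0 \<le> real n * \<xi> (\<gamma>, False) x" "real n * \<xi> (\<gamma>, False) x < real n" using n by auto
        then have "0 \<le> ?q \<gamma> x" "?q \<gamma> x < int n" by (auto simp: floor_less_iff)
        then obtain j where "j < n" "?q \<gamma> x = int j" by (metis nat_0_le of_nat_less_iff)
        then show ?thesis using x sp unfolding aE by blast
      qed (use sp in auto)
    qed
    then have "prob C \<le> prob ((\<Union>j<n. C \<inter> act \<gamma> ` E j) \<union> (?R \<union> ?Z))"
      using C aEM R Z by (intro finite_measure_mono) auto
    also have "\<dots> \<le> prob (\<Union>j<n. C \<inter> act \<gamma> ` E j) + prob (?R \<union> ?Z)"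
      using C aEM R Z by (intro measure_Un_le) auto
    also have "prob (?R \<union> ?Z) \<le> prob ?R + prob ?Z" using R Z by (intro measure_Un_le)
    finally show False using U0 PR \<open>prob ?Z = 0\<close> by linarith
  qed
  then obtain j where j: "j < n" "prob (C \<inter> act \<gamma> ` E j) > 0" by blast
  have "E j \<inter> act \<gamma> ` E j = {}" unfolding aE by (auto simp: E_def)
  then show ?thesis using that[OF Eb small[OF j(1)] _ j(2)] by blast
qed

text \<open>The involution exchanging \<open>E\<close> with its translate. As both sets lie in
  \<open>base\<close>, so does its cocycle, which also serves for the inverse. The support has
  measure \<open>2 * prob E\<close>, and the marker distance is half the measure where cocycles
  differ.\<close>

lemma swap_cauts:
  assumes E: "E \<in> sets base" and disj: "E \<inter> act \<gamma> ` E = {}"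
  obtains f where "f \<in> cauts" "\<And>x. x \<in> E \<Longrightarrow> f x = act \<gamma> x" "marker_dist id f \<le> prob E"
proof -
  let ?E' = "act \<gamma> ` E"
  have EM: "E \<in> sets M" using E base_subset by blast
  have sub: "E \<subseteq> space M" using EM sets.sets_into_space by blast
  have E'M: "?E' \<in> sets M" by (rule mp_auts_image(1)[OF act_mp EM])
  have E'eq: "?E' = {x \<in> space M. act (- \<gamma>) x \<in> E}" by (rule act_image[OF sub])
  have E': "?E' \<in> sets base"
    using measurable_sets[OF act_measurable_base[of "- \<gamma>"] E]
    by (simp add: E'eq vimage_def Int_def conj_commute)
  define h where "h x = (if x \<in> E then \<gamma> else if x \<in> ?E' then - \<gamma> else 0)" for x
  have h: "h \<in> measurable base (count_space UNIV)"
    unfolding h_def using E E' by measurable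
  define f where "f x = act (h x) x" for x
  have fm: "f \<in> measurable M M"
    unfolding f_def by (rule act_random_measurable[OF measurable_base_M[OF h]])
  have cancel: "act (- \<gamma>) (act \<gamma> x) = x" "act \<gamma> (act (- \<gamma>) x) = x" if "x \<in> space M" for x
    using act_add[OF that, of "- \<gamma>" \<gamma>] act_add[OF that, of \<gamma> "- \<gamma>"] act_zero[OF that] by auto
  have f1: "f x = act \<gamma> x" if "x \<in> E" for x using that by (simp add: f_def h_def)
  have f2: "f x = act (- \<gamma>) x" if "x \<in> ?E'" for x using that disj by (auto simp: f_def h_def)
  have f3: "f x = x" if "x \<in> space M" "x \<notin> E" "x \<notin> ?E'" for x
    using that act_zero by (simp add: f_def h_def)
  have ff: "f (f x) = x" if x: "x \<in> space M" for x
  proof -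
    consider "x \<in> E" | "x \<in> ?E'" | "x \<notin> E" "x \<notin> ?E'" by blast
    then show ?thesis
    proof cases
      case 1
      then have "f x \<in> ?E'" using f1 by auto
      then show ?thesis using 1 f1 f2 cancel x by simp
    next
      case 2
      then have "f x \<in> E" using f2 E'eq by auto
      then show ?thesis using 2 f1 f2 cancel x by simp
    next
      case 3
      then show ?thesis using f3 x by simp
    qed
  qed
  have "distr M M f = M"
  proof (rule measure_eqI)
    fix B assume "B \<in> sets (distr M M f)"
    then have B: "B \<in> sets M" by simp
    have Bs: "B \<subseteq> space M" using B sets.sets_into_space by blast
    \<comment> \<open>The preimage of \<open>B\<close> splits into its parts in \<open>E\<close>, in
      the translate, and in the fixed set. The first two are translates of
      \<open>B \<inter> ?E'\<close> and \<open>B \<inter> E\<close>, so together the three have the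
      measure of \<open>B\<close>.\<close>
    let ?V1 = "act (- \<gamma>) ` (B \<inter> ?E')" and ?V2 = "act \<gamma> ` (B \<inter> E)" and ?V3 = "B - E - ?E'"
    have V1: "?V1 = {x \<in> E. f x \<in> B}"
    proof -
      have "B \<inter> ?E' \<subseteq> space M" using Bs by auto
      from act_image[OF this, of "- \<gamma>"] have eq: "?V1 = {x \<in> space M. act \<gamma> x \<in> B \<inter> ?E'}"
        by (simp only: minus_minus)
      have "act \<gamma> x \<in> ?E' \<longleftrightarrow> x \<in> E" if "x \<in> space M" for x
        using cancel(1)[OF that] act_space[OF that] by (simp add: E'eq)
      then show ?thesis
        unfolding eq using sub f1 by (intro Collect_cong) (metis IntD1 IntD2 IntI subsetD)
    qed
    have V2: "?V2 = {x \<in> ?E'. f x \<in> B}"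
    proof -
      have "B \<inter> E \<subseteq> space M" using Bs by auto
      from act_image[OF this, of \<gamma>] show ?thesis using f2 E'eq by auto
    qed
    have "f -` B \<inter> space M = ?V1 \<union> (?V2 \<union> ?V3)"
      unfolding V1 V2
    proof (intro Set.set_eqI iffI)
      fix x assume "x \<in> f -` B \<inter> space M"
      then show "x \<in> {x \<in> E. f x \<in> B} \<union> ({x \<in> ?E'. f x \<in> B} \<union> (B - E - ?E'))"
        using f3[of x] by (cases "x \<in> E \<union> ?E'") auto
    next
      fix x assume "x \<in> {x \<in> E. f x \<in> B} \<union> ({x \<in> ?E'. f x \<in> B} \<union> (B - E - ?E'))"
      then consider "x \<in> E \<union> ?E'" "f x \<in> B" | "x \<in> B" "x \<notin> E" "x \<notin> ?E'" by blast
      then show "x \<in> f -` B \<inter> space M"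
      proof cases
        case 1
        then show ?thesis using sub sets.sets_into_space[OF E'M] by blast
      next
        case 2
        then show ?thesis using f3[of x] Bs by auto
      qed
    qed
    moreover have M: "?V1 \<in> sets M" "?V2 \<in> sets M" "?V3 \<in> sets M"
      using B EM E'M by (auto intro!: mp_auts_image(1)[OF act_mp])
    moreover have "prob (?V1 \<union> (?V2 \<union> ?V3)) = prob ?V1 + (prob ?V2 + prob ?V3)"
    proof -
      have "?V1 \<inter> (?V2 \<union> ?V3) = {}" "?V2 \<inter> ?V3 = {}" unfolding V1 V2 using disj by auto
      then show ?thesis using M by (subst finite_measure_Union; (simp add: finite_measure_Union)?)
    qed
    moreover have "prob ?V1 = prob (B \<inter> ?E')" "prob ?V2 = prob (B \<inter> E)"
      using mp_auts_image(2)[OF act_mp, of "B \<inter> ?E'"] mp_auts_image(2)[OF act_mp, of "B \<inter> E"] B EM E'M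
      by (simp_all add: measure_def)
    moreover have "prob B = prob (B \<inter> ?E') + (prob (B \<inter> E) + prob ?V3)"
    proof -
      have "prob B = prob ((B \<inter> ?E') \<union> ((B \<inter> E) \<union> ?V3))" by (rule arg_cong[where f = prob]) auto
      also have "\<dots> = prob (B \<inter> ?E') + prob ((B \<inter> E) \<union> ?V3)"
        using B EM E'M disj by (intro finite_measure_Union) auto
      also have "prob ((B \<inter> E) \<union> ?V3) = prob (B \<inter> E) + prob ?V3"
        using B EM E'M by (intro finite_measure_Union) auto
      finally show ?thesis .
    qed
    ultimately show "emeasure (distr M M f) B = emeasure M B"
      using B fm by (simp add: emeasure_distr emeasure_eq_measure)
  qed simp
  then have fmp: "f \<in> mp_auts M" "\<And>x. x \<in> space M \<Longrightarrow> inverse_map f x = f x"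
    using mp_autsI[OF fm _ fm ff ff] by auto
  have ch: "cocycle h f" using h by (simp add: cocycle_def f_def)
  have ci: "cocycle h (inverse_map f)"
    by (rule cocycle_AE[OF ch]) (use AE_space in \<open>eventually_elim, simp add: fmp\<close>)
  have "cocycle (\<lambda>_. 0) (inverse_map id)"
    by (rule cocycle_AE[OF cocycle_0])
      (use AE_space in \<open>eventually_elim, simp add: mp_autsD(6)[OF mp_auts_id, simplified]\<close>)
  from cocycle_marker_dist[OF mp_auts_id fmp(1) this ci]
  have "2 * marker_dist id f = prob {x \<in> space M. 0 \<noteq> h x}" by (rule sym)
  also have "\<dots> \<le> prob E + prob ?E'"
    by (rule measure_le_Un_AE) (use EM E'M in \<open>auto simp: h_def\<close>)
  also have "prob ?E' = prob E" using mp_auts_image(2)[OF act_mp EM] by (simp add: measure_def)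
  finally have "marker_dist id f \<le> prob E" by linarith
  moreover have "f \<in> cauts" using fmp ch ci by (auto simp: cauts_def)
  ultimately show ?thesis using that f1 by blast
qed

lemma whirly_cgroup:
  assumes std: "standard_prob_space M"
  shows "whirly M cgrp ctop (\<lambda>g. g)"
  unfolding whirly_def
proof (intro conjI ballI impI allI)
  show "standard_prob_space M" by fact
  show "polish_group cgrp ctop"
    using topological_group_cgrp polish_cgroup by (simp add: polish_group_def)
  show "near_action M cgrp (\<lambda>g. g)"
    using subgroup.subset[OF cgroup_subgroup] by (auto simp: near_action_def hom_def)
  show "continuous_map ctop (weak_topology M) (\<lambda>g. g)"
    by (simp add: continuous_map_from_subtopology)
  fix A B U V
  assume A: "A \<in> sets M" and B: "B \<in> sets M" and pos: "0 < prob A * prob B"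
    and UV: "openin ctop V \<and> \<one>\<^bsub>cgrp\<^esub> \<in> V \<and> V \<subseteq> U"
  have pA: "prob A > 0" and pB: "prob B > 0"
    using pos measure_nonneg[of M A] measure_nonneg[of M B] by (auto simp: zero_less_mult_iff)
  have one: "\<one>\<^bsub>cgrp\<^esub> = cls id" by (simp add: one_Aut)
  obtain \<epsilon> where \<epsilon>: "\<epsilon> > 0" "cg.mball (cls id) \<epsilon> \<subseteq> V"
    using UV unfolding ctop_eq cg.openin_mtopology one by blast
  have idm: "cls id \<in> cgroup" using cauts_id by (simp add: cgroup_def)
  have "\<exists>f. f \<in> cauts \<and> marker_dist id f < \<epsilon> \<and> prob (A \<inter> f ` B) > 0"
  proof -
    obtain \<gamma> where \<gamma>: "prob (A \<inter> act \<gamma> ` B) > 0" using mixing[OF A pA B pB] by blast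
    show ?thesis
    proof (cases "\<gamma> = 0")
      case True
      have "act 0 ` B = id ` B" 
        using sets.sets_into_space[OF B] act_zero by (intro image_cong) auto
      then show ?thesis using \<gamma> True \<epsilon>(1) cauts_id by (intro exI[of _ id]) (auto simp: marker_dist_def)
    next
      case False
      have im: "act \<gamma> ` X \<in> sets M" if "X \<in> sets M" for X using that by (rule mp_auts_image(1)[OF act_mp])
      \<comment> \<open>The displaced set is chosen to meet the part of \<open>A\<close> that
        \<gamma> already reaches from \<open>B\<close>; there the swap agrees with
        \<open>act \<gamma>\<close> and so carries points of \<open>B\<close> into
        \<open>A\<close>.\<close>
      have C: "A \<inter> act \<gamma> ` B \<in> sets M" using A im[OF B] by auto
      obtain E where E: "E \<in> sets base" "prob E \<le> \<epsilon> / 2" "E \<inter> act \<gamma> ` E = {}"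
        "prob (A \<inter> act \<gamma> ` B \<inter> act \<gamma> ` E) > 0"
        using small_displaced_set[OF C \<gamma> False, of "\<epsilon>/2"] \<epsilon>(1) by auto
      obtain f where f: "f \<in> cauts" "\<And>x. x \<in> E \<Longrightarrow> f x = act \<gamma> x" "marker_dist id f \<le> prob E"
        using swap_cauts[OF E(1,3)] by blast
      have EM: "E \<in> sets M" using E(1) base_subset by blast
      have "A \<inter> act \<gamma> ` B \<inter> act \<gamma> ` E \<subseteq> A \<inter> f ` B"
      proof
        fix y assume y: "y \<in> A \<inter> act \<gamma> ` B \<inter> act \<gamma> ` E"
        have "y \<in> space M" using y sets.sets_into_space[OF A] by auto
        then have "act (- \<gamma>) y \<in> B" "act (- \<gamma>) y \<in> E"
          using y act_image[OF sets.sets_into_space[OF B]] act_image[OF sets.sets_into_space[OF EM]] by auto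
        moreover have "act \<gamma> (act (- \<gamma>) y) = y"
          using act_add[OF \<open>y \<in> space M\<close>, of \<gamma> "- \<gamma>"] act_zero[OF \<open>y \<in> space M\<close>] by simp
        ultimately show "y \<in> A \<inter> f ` B" using y f(2)[of "act (- \<gamma>) y"] by (auto intro!: image_eqI)
      qed
      moreover have "A \<inter> f ` B \<in> sets M"
        using A mp_auts_image(1)[OF cauts_mp[OF f(1)] B] by auto
      ultimately have "prob (A \<inter> act \<gamma> ` B \<inter> act \<gamma> ` E) \<le> prob (A \<inter> f ` B)"
        by (rule finite_measure_mono)
      then show ?thesis using f E \<epsilon>(1) by (intro exI[of _ f]) auto
    qed
  qed
  then obtain f where f: "f \<in> cauts" "marker_dist id f < \<epsilon>" "prob (A \<inter> f ` B) > 0" by blast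
  have fm: "cls f \<in> cgroup" using f by (simp add: cgroup_def)
  have "cls f \<in> cg.mball (cls id) \<epsilon>"
    using f(2) fm idm gdist_cls[OF mp_auts_id cauts_mp[OF f(1)]] by (simp add: cg.in_mball)
  then have "cls f \<in> U" using \<epsilon>(2) UV by blast
  moreover have "f \<in> cls f" using cauts_mp[OF f(1)] by (simp add: aut_rel_def)
  ultimately show "{g \<in> carrier cgrp. \<exists>f\<in>g. 0 < prob (A \<inter> f ` B)} \<inter> U \<noteq> {}"
    using f(3) fm by auto
qed

end

section \<open>The group SL(2,Z) and the absence of an invariant mean\<close>

typedef sl2 = "{(a, b, c, d). a * d - b * c = (1 :: int)}"
  by (rule exI[of _ "(1, 0, 0, 1)"]) simp

definition sl2_mult ::
  "int \<times> int \<times> int \<times> int \<Rightarrow> int \<times> int \<times> int \<times> int \<Rightarrow> int \<times> int \<times> int \<times> int" where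
  "sl2_mult = (\<lambda>(a, b, c, d) (a', b', c', d').
     (a * a' + b * c', a * b' + b * d', c * a' + d * c', c * b' + d * d'))"

instance sl2 :: countable
  by (rule countable_classI[of "\<lambda>g. to_nat (Rep_sl2 g)"]) (simp add: Rep_sl2_inject)

text \<open>The group \<open>SL\<^sub>2(\<int>)\<close>, written additively to fit the type class of not necessarily
  commutative groups.\<close>

instantiation sl2 :: group_add
begin

definition "0 = Abs_sl2 (1, 0, 0, 1)"
definition "g + h = Abs_sl2 (sl2_mult (Rep_sl2 g) (Rep_sl2 h))"
definition "- g = Abs_sl2 (case Rep_sl2 g of (a, b, c, d) \<Rightarrow> (d, - b, - c, a))"
definition "g - h = g + - (h :: sl2)"

lemma Rep_sl2_0: "Rep_sl2 0 = (1, 0, 0, 1)"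
  unfolding zero_sl2_def by (rule Abs_sl2_inverse) simp

lemma Rep_sl2_plus: "Rep_sl2 (g + h) = sl2_mult (Rep_sl2 g) (Rep_sl2 h)"
proof -
  obtain a b c d where g: "Rep_sl2 g = (a, b, c, d)" by (cases "Rep_sl2 g")
  obtain a' b' c' d' where h: "Rep_sl2 h = (a', b', c', d')" by (cases "Rep_sl2 h")
  have "a * d - b * c = 1" "a' * d' - b' * c' = 1" using Rep_sl2[of g] Rep_sl2[of h] g h by auto
  moreover have "(a * a' + b * c') * (c * b' + d * d') - (a * b' + b * d') * (c * a' + d * c')
      = (a * d - b * c) * (a' * d' - b' * c')" by (simp add: algebra_simps)
  ultimately have "sl2_mult (Rep_sl2 g) (Rep_sl2 h) \<in> {(a, b, c, d). a * d - b * c = 1}"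
    by (simp add: sl2_mult_def g h)
  then show ?thesis unfolding plus_sl2_def by (rule Abs_sl2_inverse)
qed

lemma Rep_sl2_uminus: "Rep_sl2 (- g) = (case Rep_sl2 g of (a, b, c, d) \<Rightarrow> (d, - b, - c, a))"
proof -
  have "(case Rep_sl2 g of (a, b, c, d) \<Rightarrow> (d, - b, - c, a)) \<in> {(a, b, c, d). a * d - b * c = 1}"
    using Rep_sl2[of g] by (auto simp: mult.commute)
  then show ?thesis unfolding uminus_sl2_def by (rule Abs_sl2_inverse)
qed

instance
proof
  fix g h k :: sl2
  show "g + h + k = g + (h + k)"
    by (simp add: Rep_sl2_inject[symmetric] Rep_sl2_plus sl2_mult_def split: prod.split)
      (simp add: algebra_simps)
  show "0 + g = g" "g + 0 = g"
    by (simp_all add: Rep_sl2_inject[symmetric] Rep_sl2_plus Rep_sl2_0 sl2_mult_def split: prod.split)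
  show "- g + g = 0"
    using Rep_sl2[of g]
    by (auto simp: Rep_sl2_inject[symmetric] Rep_sl2_plus Rep_sl2_0 Rep_sl2_uminus sl2_mult_def algebra_simps)
  show "g + - h = g - h" by (simp add: minus_sl2_def)
qed

end

lemma infinite_sl2: "infinite (UNIV :: sl2 set)"
proof -
  have "inj (\<lambda>n. Abs_sl2 (1, n, 0, 1))"
    by (rule injI) (simp add: Abs_sl2_inject)
  then have "infinite (range (\<lambda>n :: int. Abs_sl2 (1, n, 0, 1)))"
    using infinite_UNIV_char_0 finite_imageD by blast
  then show ?thesis by (rule infinite_super[OF subset_UNIV])
qed

text \<open>The hypotheses make \<open>C\<close> and its preimages under one and two translations by
  \<open>u\<close> pairwise disjoint: the first one, read at \<open>u + \<kappa>\<close>, also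
  separates the two preimages. Three sets of equal mass then share a total of at most 1.\<close>

lemma invariant_mean_three_translates:
  assumes b: "invariant_mean b"
    and disj: "\<And>\<kappa>. \<kappa> \<in> C \<Longrightarrow> u + \<kappa> \<notin> C" "\<And>\<kappa>. \<kappa> \<in> C \<Longrightarrow> u + (u + \<kappa>) \<notin> C"
  shows "3 * b C \<le> 1"
proof -
  note b = b[unfolded invariant_mean_def]
  let ?C1 = "{\<kappa>. u + \<kappa> \<in> C}" and ?C2 = "{\<kappa>. u + (u + \<kappa>) \<in> C}"
  have add: "b (X \<union> Y) = b X + b Y" if "X \<inter> Y = {}" for X Y using b that by blast
  have "b ?C1 = b C" using b by blast
  moreover have "b ?C2 = b C"
  proof -
    have "b ?C2 = b {\<kappa>. u + u + \<kappa> \<in> C}" by (simp add: add.assoc)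
    then show ?thesis using b by simp
  qed
  moreover have "C \<inter> ?C1 = {}" "(C \<union> ?C1) \<inter> ?C2 = {}" using disj by auto
  ultimately have "b (C \<union> ?C1 \<union> ?C2) = 3 * b C" using add by simp
  moreover have "b X \<le> 1" for X
  proof -
    have "b X + b (- X) = 1" using add[of X "- X"] b by (simp add: Compl_partition)
    moreover have "0 \<le> b (- X)" using b by blast
    ultimately show ?thesis by linarith
  qed
  ultimately show ?thesis by metis
qed

text \<open>The first column of a matrix is nonzero, so multiplication by \<open>(1 3; 0 1)\<close> displaces the
  matrices whose upper left entry is dominated by the lower left one, and symmetrically.\<close>

lemma no_invariant_mean_sl2: "\<not> invariant_mean (b :: sl2 set \<Rightarrow> real)"
proof
  assume b: "invariant_mean b"
  let ?a = "\<lambda>g. fst (Rep_sl2 g)" and ?c = "\<lambda>g. fst (snd (snd (Rep_sl2 g)))"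
  let ?P = "{g. \<bar>?a g\<bar> \<le> \<bar>?c g\<bar>}" and ?Q = "{g. \<bar>?c g\<bar> \<le> \<bar>?a g\<bar>}"
  have nz: "?a g \<noteq> 0 \<or> ?c g \<noteq> 0" for g using Rep_sl2[of g] by auto
  \<comment> \<open>If \<open>\<bar>a\<bar> \<le> \<bar>c\<bar>\<close> then \<open>c\<close> is
    nonzero, and \<open>a + 3 * c\<close> and \<open>a + 6 * c\<close> have absolute value at least
    \<open>2 * \<bar>c\<bar>\<close>. With 2 in place of 3 the case \<open>a = - c\<close> would not
    leave the set. The two sets cover the group but have mass at most 1/3 each.\<close>
  define u where "u = Abs_sl2 (1, 3, 0, 1)"
  define v where "v = Abs_sl2 (1, 0, 3, 1)"
  have "Rep_sl2 u = (1, 3, 0, 1)" "Rep_sl2 v = (1, 0, 3, 1)"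
    unfolding u_def v_def by (simp_all add: Abs_sl2_inverse)
  then have u: "?a (u + g) = ?a g + 3 * ?c g" "?c (u + g) = ?c g"
    and v: "?a (v + g) = ?a g" "?c (v + g) = 3 * ?a g + ?c g" for g
    by (simp_all add: Rep_sl2_plus sl2_mult_def split: prod.split)
  have "3 * b ?P \<le> 1"
  proof (rule invariant_mean_three_translates[OF b, of _ u])
    fix g assume "g \<in> ?P"
    then show "u + g \<notin> ?P" "u + (u + g) \<notin> ?P"
      using nz[of g] by (auto simp: u abs_le_iff abs_if split: if_splits)
  qed
  moreover have "3 * b ?Q \<le> 1"
  proof (rule invariant_mean_three_translates[OF b, of _ v])
    fix g assume "g \<in> ?Q"
    then show "v + g \<notin> ?Q" "v + (v + g) \<notin> ?Q"
      using nz[of g] by (auto simp: v abs_le_iff abs_if split: if_splits)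
  qed
  moreover have "1 \<le> b ?P + b ?Q"
  proof -
    note b' = b[unfolded invariant_mean_def]
    have add: "b (X \<union> Y) = b X + b Y" if "X \<inter> Y = {}" for X Y using b' that by blast
    have "?P \<union> (?Q - ?P) = UNIV" by auto
    then have "b ?P + b (?Q - ?P) = 1" using add[of ?P "?Q - ?P"] b' by auto
    moreover have "b ?Q = b (?Q - ?P) + b (?Q \<inter> ?P)"
    proof -
      have "b ((?Q - ?P) \<union> (?Q \<inter> ?P)) = b (?Q - ?P) + b (?Q \<inter> ?P)" by (rule add) blast
      moreover have "(?Q - ?P) \<union> (?Q \<inter> ?P) = ?Q" by blast
      ultimately show ?thesis by (simp only:)
    qed
    moreover have "0 \<le> b (?Q \<inter> ?P)" using b' by blast
    ultimately show ?thesis by linarith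
  qed
  ultimately show False by linarith
qed

theorem corollary1p5:
  fixes M :: "'a measure"
  assumes "standard_prob_space M" and "nonatomic M"
  shows "\<exists>G. subgroup G (Aut M) \<and> closedin (weak_topology M) G \<and>
           \<not> amenable ((Aut M)\<lparr>carrier := G\<rparr>) (subtopology (weak_topology M) G) \<and>
           whirly M ((Aut M)\<lparr>carrier := G\<rparr>) (subtopology (weak_topology M) G) (\<lambda>g. g)"
proof -
  obtain act :: "sl2 \<Rightarrow> 'a \<Rightarrow> 'a" and \<xi> e r where "bernoulli_action M act \<xi> e r"
    using ex_bernoulli_action[OF assms infinite_sl2] by blast
  then interpret bernoulli_action M act \<xi> e r .
  have "\<not> amenable cgrp ctop"
    using amenable_imp_invariant_mean no_invariant_mean_sl2 by blast
  then show ?thesis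
    using cgroup_subgroup cgroup_closed whirly_cgroup[OF assms(1)] by blast
qed

end
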